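(* Let $q_1,\dots,q_n$ be a Williamson basis (as in the context) of a Cartan subalgebra of the algebra $Q(2n,\mathbb{R})$ of quadratic forms on $\mathbb{R}^{2n}$, and let $\mathbf{q}$ be the corresponding completely integrable system on $(\mathbb{R}^{2n},\omega_0)$. Then $\mathbf{q}$ is $C^\infty$-infinitesimally stable at $0$, i.e. $H^1(\mathbf{q})=0$. Concretely: for any germs $g_1,\dots,g_n$ of smooth functions at $0$ (considered modulo $\mathcal{C}_{\mathbf{q}}$) satisfying $\{g_i,q_j\}=\{g_j,q_i\}$ for all $i,j$, there exists a germ $h$ of smooth function at $0$ such that $g_i-\{q_i,h\}\in\mathcal{C}_{\mathbf{q}}$ for all $i$.
   Context: $\mathbb{R}^{2n}$ has coordinates $(x_1,y_1,\dots,x_n,y_n)$ and the Darboux form $\omega_0=\sum dx_i\wedge dy_i$ with its Poisson bracket $\{\cdot,\cdot\}$. A Williamson basis: there are $k_e,k_h,k_f$ with $n=k_e+k_h+2k_f$ and $q_i=x_i^2+y_i^2$ for $1\le i\le k_e$, $q_i=x_iy_i$ for $k_e<i\le k_e+k_h$, and for $i=k_e+k_h+2j-1$, $1\le j\le k_f$, $q_i=x_iy_i+x_{i+1}y_{i+1}$, $q_{i+1}=x_iy_{i+1}-x_{i+1}y_i$. Let $X$ be the Poisson algebra of germs at $0$ of smooth functions, $\mathbf{q}$ the real linear span of $q_1,\dots,q_n$, and $\mathcal{C}_{\mathbf{q}}=\{h\in X:\{q_i,h\}=0\ \forall i\}$. Let $L_0\cong\mathbb{R}^n$ be the abelian Lie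 algebra with basis $e_1,\dots,e_n$ and $\mathbf{q}(e_i)=q_i$; $L_0$ acts on $X$ by $(\ell,g)\mapsto\{\mathbf{q}(\ell),g\}$ and hence on $X/\mathcal{C}_{\mathbf{q}}$. The deformation complex $C^\bullet(\mathbf{q})$ is $0\to X/\mathcal{C}_{\mathbf{q}}\xrightarrow{\bar d}C^1(L_0,X/\mathcal{C}_{\mathbf{q}})\xrightarrow{\partial}C^2(L_0,X)\xrightarrow{d}C^3(L_0,X)\to\cdots$, where $C^k(L_0,V)$ are alternating $k$-linear maps $L_0^k\to V$, $\bar d$ and $d$ are the Chevalley–Eilenberg differentials ($d(\phi)(l_1,\dots,l_{k+1})=\frac1{k+1}\sum_i(-1)^{i+1}\{\mathbf{q}(l_i),\phi(l_1,\dots,\widehat{l_i},\dots,l_{k+1})\}$, $\bar d(h)(\ell)=\{\mathbf{q}(\ell),h\}$ mod $\mathcal{C}_{\mathbf{q}}$), and $\partial$ is $d$ applied to any lift of a cochain with values in $X/\mathcal{C}_{\mathbf{q}}$ to one with values in $X$ (well defined since $d$ kills $\mathcal{C}_{\mathbf{q}}$-valued cochains). $H^1(\mathbf{q})=\ker\partial/\operatorname{im}\bar d$. A 1-cocycle is thus given by $g_i=\alpha(e_i)$ mod $\mathcal{C}_{\mathbf{q}}$ with $\{g_i,q_j\}=\{g_j,q_i\}$, and it is a coboundary iff $g_i\equiv\{q_i,h\}$ mod $\mathcal{C}_{\mathbf{q}}$ for some $h\in X$. *)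

theory Defs
  imports "HOL-Analysis.Analysis"
begin

text \<open>Points of R^{2n}: pairs (x,y) with x,y in R^n; the coordinate index type 'n
  has CARD('n) = n elements and is labelled 1..n by a bijection sigma.\<close>

type_synonym 'n pt = "(real^'n) \<times> (real^'n)"

definition pd :: "('n::finite pt \<Rightarrow> real) \<Rightarrow> 'n pt \<Rightarrow> 'n pt \<Rightarrow> real" where
  "pd f v = (\<lambda>p. frechet_derivative f (at p) v)"

definition smooth_on :: "'n::finite pt set \<Rightarrow> ('n pt \<Rightarrow> real) \<Rightarrow> bool" where
  "smooth_on U f \<longleftrightarrow> (\<forall>ds. \<forall>p\<in>U. (foldr (\<lambda>v g. pd g v) ds f) differentiable (at p))"

definition smooth_germ :: "('n::finite pt \<Rightarrow> real) \<Rightarrow> bool" where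
  "smooth_germ f \<longleftrightarrow> (\<exists>U. open U \<and> 0 \<in> U \<and> smooth_on U f)"

definition ex :: "'n::finite \<Rightarrow> 'n pt" where "ex i = (axis i 1, 0)"
definition ey :: "'n::finite \<Rightarrow> 'n pt" where "ey i = (0, axis i 1)"

text \<open>Poisson bracket of omega_0 = sum dx_i ^ dy_i.\<close>
definition pbr :: "('n::finite pt \<Rightarrow> real) \<Rightarrow> ('n pt \<Rightarrow> real) \<Rightarrow> 'n pt \<Rightarrow> real" where
  "pbr f g = (\<lambda>p. \<Sum>i\<in>UNIV. pd f (ex i) p * pd g (ey i) p - pd f (ey i) p * pd g (ex i) p)"

definition xc :: "(nat \<Rightarrow> 'n::finite) \<Rightarrow> nat \<Rightarrow> 'n pt \<Rightarrow> real" where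
  "xc \<sigma> i p = fst p $ \<sigma> i"
definition yc :: "(nat \<Rightarrow> 'n::finite) \<Rightarrow> nat \<Rightarrow> 'n pt \<Rightarrow> real" where
  "yc \<sigma> i p = snd p $ \<sigma> i"

definition wq :: "(nat \<Rightarrow> 'n::finite) \<Rightarrow> nat \<Rightarrow> nat \<Rightarrow> nat \<Rightarrow> 'n pt \<Rightarrow> real" where
  "wq \<sigma> ke kh i = (\<lambda>p.
     if i \<le> ke then (xc \<sigma> i p)^2 + (yc \<sigma> i p)^2
     else if i \<le> ke + kh then xc \<sigma> i p * yc \<sigma> i p
     else if odd (i - (ke + kh)) then
       xc \<sigma> i p * yc \<sigma> i p + xc \<sigma> (i+1) p * yc \<sigma> (i+1) p
     else xc \<sigma> (i-1) p * yc \<sigma> i p - xc \<sigma> i p * yc \<sigma> (i-1) p)"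

definition in_Cq :: "(nat \<Rightarrow> 'n::finite) \<Rightarrow> nat \<Rightarrow> nat \<Rightarrow> ('n pt \<Rightarrow> real) \<Rightarrow> bool" where
  "in_Cq \<sigma> ke kh f \<longleftrightarrow> smooth_germ f \<and>
     (\<forall>\<^sub>F p in nhds 0. \<forall>i\<in>{1..CARD('n)}. pbr (wq \<sigma> ke kh i) f p = 0)"

end

theory Submission
  imports Defs "HOL-Probability.Probability" "HOL-Real_Asymp.Real_Asymp"
begin

text \<open>
Every \<open>q\<^sub>i\<close> acts by a linear field \<open>A\<^sub>i\<close>, and all these fields commute: each one either has a periodic isometric
flow or is diagonalisable with eigenvalues \<open>1, -1, 0\<close>. In the periodic case averaging over a period splits a function
into an invariant part and a derivative along the field. In the hyperbolic case a smooth \<open>r\<close> is locally a derivative along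
\<open>A\<close> as soon as its Taylor coefficients of weight \<open>0\<close> vanish on the zero set of \<open>A\<close>. To see this, convolve
along the flow with a kernel \<open>K\<close> with \<open>K' = \<rho> - \<delta>\<close>, where \<open>\<rho>\<close> decays faster than any exponential and has
\<open>\<integral>\<rho>(t) exp(l t) dt = 0\<close> for all integers \<open>l \<noteq> 0\<close>: this solves the equation up to an error that is flat on the zero set
of \<open>A\<close>, and flat errors are integrated along the flow from \<open>\<plusminus>\<infinity>\<close>. No Borel lemma is needed. The solution operators
preserve the kernels of the other fields and the weight \<open>0\<close> condition, so that a cocycle component \<open>g\<^sub>k\<close> can be
corrected, one field \<open>A\<^sub>j\<close> after the other and without changing its weight \<open>0\<close> coefficients, to an element of
\<open>C\<^sub>q\<close>; the total correction is then a derivative along \<open>A\<^sub>k\<close>.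
\<close>

text \<open>At a zero of \<open>A\<close>, the derivation \<open>lie A\<close> multiplies a Taylor
  coefficient of weight l by l (up to terms that vanish there), so only weight 0 obstructs.
  Averaging with a kernel multiplies the same coefficient by the l-th exponential moment of the
  kernel: one kernel therefore settles all orders at once. Derivatives of order n grow like exp(n
  |t|) along the flow, hence the demand for decay beyond every exponential. The obstacle is that a
  hyperbolic flow leaves every neighbourhood of 0 while the data are germs. Cutoffs are unavoidable,
  yet a cutoff usually destroys the equations for the other fields. Here it is a function of the
  squared norms of the expanding and contracting parts, which the other fields preserve. The squared
  norm of the neutral part is constant along the flow, so a cutoff in it equals 1 on an invariant
  tube. Preservation matters because components are treated one at a time: by the cocycle identity,
  the next component is killed by the fields already treated; its correction can be chosen killed by
  them too, and what was achieved stays.\<close>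

declare split_paired_All [simp del] split_paired_Ex [simp del]

subsection \<open>Iterated directional derivatives\<close>

text \<open>The head of the list is the outermost derivative. \<open>pds_Cons\<close> peels it off
  at a fixed \<open>f\<close>; \<open>pds_snoc\<close> peels off the innermost one and suits
  inductions that generalise over \<open>f\<close>.\<close>

definition pds :: "'n::finite pt list \<Rightarrow> ('n pt \<Rightarrow> real) \<Rightarrow> 'n pt \<Rightarrow> real" where
  "pds ds f = foldr (\<lambda>v g. pd g v) ds f"

lemma pds_Nil [simp]: "pds [] f = f"
  and pds_Cons: "pds (v # ds) f = pd (pds ds f) v"
  and pds_append: "pds (ds @ es) f = pds ds (pds es f)"
  by (simp_all add: pds_def)

lemma pds_snoc: "pds (ds @ [v]) f = pds ds (pd f v)"
  by (simp add: pds_def)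

lemma smooth_on_pds: "smooth_on U f \<longleftrightarrow> (\<forall>ds. \<forall>p\<in>U. pds ds f differentiable (at p))"
  by (simp add: smooth_on_def pds_def)

lemma pd_eqI: "(f has_derivative f') (at p) \<Longrightarrow> pd f v p = f' v"
  unfolding pd_def by (metis frechet_derivative_at)

lemma has_derivative_pd: "f differentiable (at p) \<Longrightarrow> (f has_derivative (\<lambda>v. pd f v p)) (at p)"
  unfolding pd_def by (simp add: frechet_derivative_works)

lemma pd_linear: "f differentiable (at p) \<Longrightarrow> linear (\<lambda>v. pd f v p)"
  using has_derivative_linear[OF has_derivative_pd] .

lemma pd_zero_dir [simp]: "f differentiable (at p) \<Longrightarrow> pd f 0 p = 0"
  by (rule linear_0[OF pd_linear])

lemma has_derivative_cong_open:
  assumes "open U" "p \<in> U" "\<And>q. q \<in> U \<Longrightarrow> f q = g q"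
  shows "(f has_derivative f') (at p) \<longleftrightarrow> (g has_derivative f') (at p)"
proof
  show "(g has_derivative f') (at p)" if "(f has_derivative f') (at p)"
    by (rule has_derivative_transform_within_open[OF that assms])
  show "(f has_derivative f') (at p)" if "(g has_derivative f') (at p)"
    by (rule has_derivative_transform_within_open[OF that assms(1,2)]) (simp add: assms(3))
qed

lemma differentiable_cong_open:
  assumes "open U" "p \<in> U" "\<And>q. q \<in> U \<Longrightarrow> f q = g q"
  shows "f differentiable (at p) \<longleftrightarrow> g differentiable (at p)"
  unfolding differentiable_def using has_derivative_cong_open[OF assms] by simp

text \<open>No differentiability enters: \<open>frechet_derivative\<close> is a choice from the set
  of all derivatives, and this set is the same for both functions.\<close>

lemma pd_cong_open:
  assumes "open U" "p \<in> U" "\<And>q. q \<in> U \<Longrightarrow> f q = g q"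
  shows "pd f v p = pd g v p"
  unfolding pd_def frechet_derivative_def using has_derivative_cong_open[OF assms] by simp

lemma pds_cong_open:
  assumes "open U" "\<And>q. q \<in> U \<Longrightarrow> f q = g q" "p \<in> U"
  shows "pds ds f p = pds ds g p"
  using assms(3)
proof (induction ds arbitrary: p)
  case (Cons v ds)
  show ?case unfolding pds_Cons
    by (rule pd_cong_open[OF assms(1) Cons.prems]) (rule Cons.IH)
qed (simp add: assms)

lemma pds_cong_ev:
  assumes "eventually (\<lambda>q. f q = g q) (nhds p)"
  shows "pds ds f p = pds ds g p"
  using assms pds_cong_open unfolding eventually_nhds by metis

lemma smooth_on_cong:
  assumes "open U" "\<And>q. q \<in> U \<Longrightarrow> f q = g q"
  shows "smooth_on U f \<longleftrightarrow> smooth_on U g"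
proof -
  have "pds ds f differentiable at p \<longleftrightarrow> pds ds g differentiable at p" if "p \<in> U" for p ds
    by (rule differentiable_cong_open[OF assms(1) that]) (rule pds_cong_open[OF assms])
  then show ?thesis unfolding smooth_on_pds by blast
qed

lemma smooth_on_subset: "smooth_on U f \<Longrightarrow> V \<subseteq> U \<Longrightarrow> smooth_on V f"
  unfolding smooth_on_def by blast

text \<open>\<open>smooth_on\<close> is a condition on single points with derivatives taken in the
  full space, so pieces glue whether or not they are open.\<close>

lemma smooth_on_UN: "(\<And>p. p \<in> U \<Longrightarrow> \<exists>V. p \<in> V \<and> smooth_on V f) \<Longrightarrow> smooth_on U f"
  unfolding smooth_on_def by blast

lemma smooth_on_Un: "smooth_on U f \<Longrightarrow> smooth_on V f \<Longrightarrow> smooth_on (U \<union> V) f"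
  unfolding smooth_on_def by blast

lemma smooth_on_diff: "smooth_on U f \<Longrightarrow> p \<in> U \<Longrightarrow> f differentiable (at p)"
  unfolding smooth_on_pds by (metis pds_Nil)

lemma smooth_on_pds': "smooth_on U f \<Longrightarrow> smooth_on U (pds ds f)"
  unfolding smooth_on_pds by (simp flip: pds_append)

lemma smooth_on_pd: "smooth_on U f \<Longrightarrow> smooth_on U (pd f v)"
  using smooth_on_pds'[of U f "[v]"] by (simp add: pds_Cons)

text \<open>Order of differentiability as an induction measure: by \<open>smooth_n_Suc\<close> the
  innermost derivative has one order less, and product, quotient and chain rule express it by
  functions of that order.\<close>

definition smooth_n :: "nat \<Rightarrow> 'n::finite pt set \<Rightarrow> ('n pt \<Rightarrow> real) \<Rightarrow> bool" where
  "smooth_n n U f \<longleftrightarrow> (\<forall>ds. length ds < n \<longrightarrow> (\<forall>p\<in>U. pds ds f differentiable (at p)))"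

lemma smooth_n_0 [simp]: "smooth_n 0 U f"
  by (simp add: smooth_n_def)

lemma smooth_n_Suc:
  "smooth_n (Suc n) U f \<longleftrightarrow> (\<forall>p\<in>U. f differentiable (at p)) \<and> (\<forall>v. smooth_n n U (pd f v))"
proof (intro iffI conjI allI ballI)
  assume L: "smooth_n (Suc n) U f"
  show "f differentiable at p" if "p \<in> U" for p
    using L that unfolding smooth_n_def by (metis length_0_conv pds_Nil zero_less_Suc)
  show "smooth_n n U (pd f v)" for v
    unfolding smooth_n_def
  proof (intro allI impI)
    fix ds :: "'a pt list" assume "length ds < n"
    then show "\<forall>p\<in>U. pds ds (pd f v) differentiable at p"
      using L unfolding smooth_n_def by (metis Suc_mono length_append_singleton pds_snoc)
  qed
next
  assume R: "(\<forall>p\<in>U. f differentiable at p) \<and> (\<forall>v. smooth_n n U (pd f v))"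
  show "smooth_n (Suc n) U f" unfolding smooth_n_def
  proof (intro allI impI ballI)
    fix ds :: "'a pt list" and p assume ds: "length ds < Suc n" and p: "p \<in> U"
    show "pds ds f differentiable at p"
      using ds p R by (cases ds rule: rev_cases) (auto simp: pds_snoc smooth_n_def)
  qed
qed

lemma smooth_on_smooth_n: "smooth_on U f \<longleftrightarrow> (\<forall>n. smooth_n n U f)"
  unfolding smooth_n_def smooth_on_pds by blast

lemma smooth_n_SucD: "smooth_n (Suc n) U f \<Longrightarrow> smooth_n n U f"
  unfolding smooth_n_def by auto

lemma smooth_n_cong:
  assumes "open U" "\<And>q. q \<in> U \<Longrightarrow> f q = g q" "smooth_n n U f"
  shows "smooth_n n U g"
proof -
  have "pds ds f differentiable at p \<longleftrightarrow> pds ds g differentiable at p" if "p \<in> U" for p ds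
    by (rule differentiable_cong_open[OF assms(1) that]) (rule pds_cong_open[OF assms(1,2)])
  then show ?thesis using assms(3) unfolding smooth_n_def by blast
qed

lemma pd_const [simp]: "pd (\<lambda>p. c) v = (\<lambda>p. 0)"
  by (rule ext) (rule pd_eqI[OF has_derivative_const])

lemma pd_add: "f differentiable (at p) \<Longrightarrow> g differentiable (at p)
   \<Longrightarrow> pd (\<lambda>p. f p + g p) v p = pd f v p + pd g v p"
  by (rule pd_eqI) (intro has_derivative_add has_derivative_pd)

lemma pd_diff: "f differentiable (at p) \<Longrightarrow> g differentiable (at p)
   \<Longrightarrow> pd (\<lambda>p. f p - g p) v p = pd f v p - pd g v p"
  by (rule pd_eqI) (intro has_derivative_diff has_derivative_pd)

lemma pd_mult: "f differentiable (at p) \<Longrightarrow> g differentiable (at p)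
   \<Longrightarrow> pd (\<lambda>p. f p * g p) v p = pd f v p * g p + f p * pd g v p"
proof (rule pd_eqI)
  assume *: "f differentiable (at p)" "g differentiable (at p)"
  show "((\<lambda>p. f p * g p) has_derivative (\<lambda>v. pd f v p * g p + f p * pd g v p)) (at p)"
    using has_derivative_mult[OF *[THEN has_derivative_pd]] by (simp add: add.commute)
qed

lemma pd_cmult: "f differentiable (at p) \<Longrightarrow> pd (\<lambda>p. c * f p) v p = c * pd f v p"
  by (rule pd_eqI) (intro has_derivative_mult_right has_derivative_pd)

lemma pd_sum: "(\<And>i. i \<in> I \<Longrightarrow> f i differentiable (at p))
   \<Longrightarrow> pd (\<lambda>p. \<Sum>i\<in>I. f i p) v p = (\<Sum>i\<in>I. pd (f i) v p)"
  by (rule pd_eqI) (intro has_derivative_sum has_derivative_pd)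

lemma smooth_n_const: "smooth_n n U (\<lambda>p. c)"
  by (induction n arbitrary: c) (auto simp: smooth_n_Suc)

lemma smooth_n_add: "open U \<Longrightarrow> smooth_n n U f \<Longrightarrow> smooth_n n U g \<Longrightarrow> smooth_n n U (\<lambda>p. f p + g p)"
proof (induction n arbitrary: f g)
  case (Suc n)
  note U = \<open>open U\<close>
  have f: "\<forall>p\<in>U. f differentiable at p" "\<And>v. smooth_n n U (pd f v)"
    using Suc.prems(2) unfolding smooth_n_Suc by blast+
  have g: "\<forall>p\<in>U. g differentiable at p" "\<And>v. smooth_n n U (pd g v)"
    using Suc.prems(3) unfolding smooth_n_Suc by blast+
  have "smooth_n n U (\<lambda>p. pd f v p + pd g v p)" for v
    by (intro Suc.IH[OF U] f g)
  then have "smooth_n n U (pd (\<lambda>p. f p + g p) v)" for v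
    by (rule smooth_n_cong[OF U, rotated]) (use f g in \<open>simp add: pd_add\<close>)
  then show ?case unfolding smooth_n_Suc using f g by (simp add: differentiable_add)
qed simp

lemma smooth_n_mult: "open U \<Longrightarrow> smooth_n n U f \<Longrightarrow> smooth_n n U g \<Longrightarrow> smooth_n n U (\<lambda>p. f p * g p)"
proof (induction n arbitrary: f g)
  case (Suc n)
  note U = \<open>open U\<close>
  have f: "smooth_n n U f" "\<forall>p\<in>U. f differentiable at p" "\<And>v. smooth_n n U (pd f v)"
    using Suc.prems(2) smooth_n_SucD unfolding smooth_n_Suc by blast+
  have g: "smooth_n n U g" "\<forall>p\<in>U. g differentiable at p" "\<And>v. smooth_n n U (pd g v)"
    using Suc.prems(3) smooth_n_SucD unfolding smooth_n_Suc by blast+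
  have "smooth_n n U (\<lambda>p. pd f v p * g p + f p * pd g v p)" for v
    by (intro smooth_n_add[OF U] Suc.IH[OF U] f g)
  then have "smooth_n n U (pd (\<lambda>p. f p * g p) v)" for v
    by (rule smooth_n_cong[OF U, rotated]) (use f g in \<open>simp add: pd_mult\<close>)
  then show ?case unfolding smooth_n_Suc using f g by (simp add: differentiable_mult)
qed simp

lemma smooth_on_const [simp]: "smooth_on U (\<lambda>p. c)"
  by (simp add: smooth_on_smooth_n smooth_n_const)

lemma smooth_on_add: "open U \<Longrightarrow> smooth_on U f \<Longrightarrow> smooth_on U g \<Longrightarrow> smooth_on U (\<lambda>p. f p + g p)"
  by (simp add: smooth_on_smooth_n smooth_n_add)

lemma smooth_on_mult: "open U \<Longrightarrow> smooth_on U f \<Longrightarrow> smooth_on U g \<Longrightarrow> smooth_on U (\<lambda>p. f p * g p)"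
  by (simp add: smooth_on_smooth_n smooth_n_mult)

lemma smooth_on_minus: "open U \<Longrightarrow> smooth_on U f \<Longrightarrow> smooth_on U g \<Longrightarrow> smooth_on U (\<lambda>p. f p - g p)"
  using smooth_on_add[of U f "\<lambda>p. (-1) * g p"] smooth_on_mult[of U "\<lambda>p. -1" g] by simp

lemma smooth_on_sum: "open U \<Longrightarrow> (\<And>i. i \<in> I \<Longrightarrow> smooth_on U (f i)) \<Longrightarrow> smooth_on U (\<lambda>p. \<Sum>i\<in>I. f i p)"
  by (induction I rule: infinite_finite_induct) (auto intro: smooth_on_add)

lemma smooth_onI_pd:
  assumes "\<And>p. p \<in> U \<Longrightarrow> f differentiable (at p)" "\<And>v. smooth_on U (pd f v)"
  shows "smooth_on U f"
  unfolding smooth_on_smooth_n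
proof
  fix n show "smooth_n n U f"
    using assms by (cases n) (auto simp: smooth_n_Suc smooth_on_smooth_n)
qed

lemma pds_lin:
  assumes "open U" "smooth_on U f" "smooth_on U g" "p \<in> U"
  shows "pds ds (\<lambda>p. a * f p + b * g p) p = a * pds ds f p + b * pds ds g p"
  using assms(4)
proof (induction ds arbitrary: p)
  case (Cons v ds)
  have "pd (pds ds (\<lambda>p. a * f p + b * g p)) v p = pd (\<lambda>p. a * pds ds f p + b * pds ds g p) v p"
    by (rule pd_cong_open[OF assms(1) Cons.prems]) (rule Cons.IH)
  also have "\<dots> = a * pd (pds ds f) v p + b * pd (pds ds g) v p"
    using assms(2,3) Cons.prems unfolding smooth_on_pds
    by (auto simp: pd_add pd_cmult intro!: differentiable_mult)
  finally show ?case by (simp add: pds_Cons)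
qed simp

lemma pds_const0 [simp]: "pds ds (\<lambda>p. 0) = (\<lambda>p. 0)"
  by (induction ds) (auto simp: pds_Cons)

lemma pds_add: "open U \<Longrightarrow> smooth_on U f \<Longrightarrow> smooth_on U g \<Longrightarrow> p \<in> U
    \<Longrightarrow> pds ds (\<lambda>p. f p + g p) p = pds ds f p + pds ds g p"
  using pds_lin[of U f g p ds 1 1] by simp

lemma pds_minus: "open U \<Longrightarrow> smooth_on U f \<Longrightarrow> smooth_on U g \<Longrightarrow> p \<in> U
    \<Longrightarrow> pds ds (\<lambda>p. f p - g p) p = pds ds f p - pds ds g p"
  using pds_lin[of U f g p ds 1 "-1"] by simp

lemma pds_cmult: "open U \<Longrightarrow> smooth_on U f \<Longrightarrow> p \<in> U
    \<Longrightarrow> pds ds (\<lambda>p. c * f p) p = c * pds ds f p"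
  using pds_lin[of U f f p ds c 0] by simp

lemma pds_sum:
  assumes "open U" "\<And>i. i \<in> I \<Longrightarrow> smooth_on U (f i)" "p \<in> U"
  shows "pds ds (\<lambda>p. \<Sum>i\<in>I. c i * f i p) p = (\<Sum>i\<in>I. c i * pds ds (f i) p)"
  using assms(2)
proof (induction I rule: infinite_finite_induct)
  case (insert i I)
  have "smooth_on U (\<lambda>p. \<Sum>i\<in>I. c i * f i p)"
    by (intro smooth_on_sum smooth_on_mult assms(1) smooth_on_const) (use insert in auto)
  from pds_lin[OF assms(1) _ this assms(3), of "f i" ds "c i" 1] insert
  show ?case by simp
qed auto

lemma pd_Basis:
  assumes "f differentiable (at p)"
  shows "pd f v p = (\<Sum>b\<in>Basis. (v \<bullet> b) * pd f b p)"
proof -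
  have "pd f v p = pd f (\<Sum>b\<in>Basis. (v \<bullet> b) *\<^sub>R b) p" by (simp add: euclidean_representation)
  also have "\<dots> = (\<Sum>b\<in>Basis. (v \<bullet> b) * pd f b p)"
    by (simp only: linear_sum[OF pd_linear[OF assms]] linear_cmul[OF pd_linear[OF assms]] real_scaleR_def)
  finally show ?thesis .
qed

text \<open>Linearity in the innermost direction. Inductions based on it pass from fixed basis
  directions to directions that move with a flow.\<close>

lemma pds_snoc_Basis:
  assumes "open U" "smooth_on U f" "p \<in> U"
  shows "pds (ds @ [v]) f p = (\<Sum>b\<in>Basis. (v \<bullet> b) * pds ds (pd f b) p)"
proof -
  have "pds (ds @ [v]) f p = pds ds (\<lambda>p. \<Sum>b\<in>Basis. (v \<bullet> b) * pd f b p) p"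
    unfolding pds_snoc
    by (rule pds_cong_open[OF assms(1) _ assms(3)]) (intro pd_Basis smooth_on_diff[OF assms(2)])
  also have "\<dots> = (\<Sum>b\<in>Basis. (v \<bullet> b) * pds ds (pd f b) p)"
    by (rule pds_sum[OF assms(1) _ assms(3)]) (intro smooth_on_pd assms(2))
  finally show ?thesis .
qed

lemma pds_snoc_add:
  assumes "open U" "smooth_on U f" "p \<in> U"
  shows "pds (ds @ [a *\<^sub>R v + b *\<^sub>R w]) f p = a * pds (ds @ [v]) f p + b * pds (ds @ [w]) f p"
  unfolding pds_snoc_Basis[OF assms]
  by (simp add: inner_add_left algebra_simps sum.distrib sum_distrib_left)

lemma smooth_on_linear:
  assumes "bounded_linear L" shows "smooth_on U L" "pd L v p = L v"
proof -
  show *: "pd L v p = L v" for v p by (rule pd_eqI) (rule bounded_linear_imp_has_derivative[OF assms])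
  have e: "pd L v = (\<lambda>p. L v)" for v by (rule ext) (rule *)
  show "smooth_on U L"
    by (rule smooth_onI_pd, rule bounded_linear_imp_differentiable[OF assms], simp only: e smooth_on_const)
qed

lemma has_derivative_line:
  assumes "f differentiable (at (p + s *\<^sub>R v))"
  shows "((\<lambda>s. f (p + s *\<^sub>R v)) has_real_derivative pd f v (p + s *\<^sub>R v)) (at s)"
proof -
  have "((\<lambda>s. f (p + s *\<^sub>R v)) has_derivative (\<lambda>h. pd f (h *\<^sub>R v) (p + s *\<^sub>R v))) (at s)"
    by (rule has_derivative_compose[where g = f and f = "\<lambda>s. p + s *\<^sub>R v", OF _ has_derivative_pd[OF assms]])
      (auto intro!: derivative_eq_intros)
  moreover have "pd f (h *\<^sub>R v) (p + s *\<^sub>R v) = pd f v (p + s *\<^sub>R v) * h" for h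
    using linear_cmul[OF pd_linear[OF assms]] by simp
  ultimately show ?thesis by (simp add: has_field_derivative_def fun_eq_iff)
qed

lemma pds_compose_linear:
  assumes "linear L" "open U" "smooth_on U f" "\<And>q. q \<in> V \<Longrightarrow> L q \<in> U" "open V" "p \<in> V"
  shows "pds ds (\<lambda>p. f (L p)) p = pds (map L ds) f (L p)"
proof -
  have bl: "bounded_linear L" using assms(1) by (simp add: linear_conv_bounded_linear)
  show ?thesis using assms(6)
  proof (induction ds arbitrary: p)
    case (Cons v ds)
    have "pd (pds ds (\<lambda>p. f (L p))) v p = pd (\<lambda>p. pds (map L ds) f (L p)) v p"
      by (rule pd_cong_open[OF assms(5) Cons.prems]) (rule Cons.IH)
    also have "\<dots> = pd (pds (map L ds) f) (L v) (L p)"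
    proof (rule pd_eqI, rule has_derivative_compose[where f = L and g = "pds (map L ds) f",
      OF bounded_linear_imp_has_derivative[OF bl]])
      show "(pds (map L ds) f has_derivative (\<lambda>w. pd (pds (map L ds) f) w (L p))) (at (L p))"
        using assms(3,4) Cons.prems unfolding smooth_on_pds by (intro has_derivative_pd) blast
    qed
    finally show ?case by (simp add: pds_Cons)
  qed simp
qed

lemma smooth_on_compose_linear:
  assumes "linear L" "open U" "smooth_on U f" "\<And>q. q \<in> V \<Longrightarrow> L q \<in> U" "open V"
  shows "smooth_on V (\<lambda>p. f (L p))"
  unfolding smooth_on_pds
proof (intro allI ballI)
  fix ds p assume p: "p \<in> V"
  have bl: "bounded_linear L" using assms(1) by (simp add: linear_conv_bounded_linear)
  have "(\<lambda>p. pds (map L ds) f (L p)) differentiable at p"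
    by (rule differentiable_compose[where f = "pds (map L ds) f" and g = L,
      OF smooth_on_diff[OF smooth_on_pds'[OF assms(3)] assms(4)[OF p]]
        bounded_linear_imp_differentiable[OF bl]])
  then show "pds ds (\<lambda>p. f (L p)) differentiable at p"
    using differentiable_cong_open[OF assms(5) p pds_compose_linear[OF assms]] by simp
qed

lemma smooth_on_cont: "smooth_on U f \<Longrightarrow> p \<in> U \<Longrightarrow> isCont (pds ds f) p"
  unfolding smooth_on_pds by (simp add: differentiable_imp_continuous_within)

text \<open>Schwarz: both mixed derivatives are limits of the same second difference quotient.\<close>

lemma second_difference:
  assumes "0 < s" "\<And>a b. 0 \<le> a \<Longrightarrow> a \<le> s \<Longrightarrow> 0 \<le> b \<Longrightarrow> b \<le> s \<Longrightarrow> p + a *\<^sub>R v + b *\<^sub>R w \<in> U"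
    and "smooth_on U f"
  shows "\<exists>a b. 0 < a \<and> a < s \<and> 0 < b \<and> b < s \<and>
    f (p + s *\<^sub>R v + s *\<^sub>R w) - f (p + s *\<^sub>R v) - f (p + s *\<^sub>R w) + f p
     = s * s * pd (pd f v) w (p + a *\<^sub>R v + b *\<^sub>R w)"
proof -
  define h where "h a = f (p + s *\<^sub>R w + a *\<^sub>R v) - f (p + a *\<^sub>R v)" for a
  have inU: "p + b *\<^sub>R w + a *\<^sub>R v \<in> U" if "0 \<le> a" "a \<le> s" "0 \<le> b" "b \<le> s" for a b
    using assms(2)[OF that] by (simp add: algebra_simps)
  have inU0: "p + a *\<^sub>R v \<in> U" if "0 \<le> a" "a \<le> s" for a
    using inU[OF that, of 0] assms(1) by simp
  have "\<exists>z>0. z < s \<and> h s - h 0 = (s - 0) * (pd f v (p + s *\<^sub>R w + z *\<^sub>R v) - pd f v (p + z *\<^sub>R v))"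
  proof (rule MVT2[OF assms(1)])
    fix x assume x: "0 \<le> x" "x \<le> s"
    show "(h has_real_derivative pd f v (p + s *\<^sub>R w + x *\<^sub>R v) - pd f v (p + x *\<^sub>R v)) (at x)"
      unfolding h_def using x assms(1)
      by (intro DERIV_diff has_derivative_line smooth_on_diff[OF assms(3)] inU inU0) auto
  qed
  then obtain a where a: "0 < a" "a < s"
    "h s - h 0 = s * (pd f v (p + s *\<^sub>R w + a *\<^sub>R v) - pd f v (p + a *\<^sub>R v))" by auto
  have "\<exists>z>0. z < s \<and> pd f v (p + a *\<^sub>R v + s *\<^sub>R w) - pd f v (p + a *\<^sub>R v + 0 *\<^sub>R w)
      = (s - 0) * (pd (pd f v) w (p + a *\<^sub>R v + z *\<^sub>R w))"
    using a by (intro MVT2[OF assms(1)] has_derivative_line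
      smooth_on_diff[OF smooth_on_pd[OF assms(3)]] assms(2)) auto
  then obtain b where b: "0 < b" "b < s" "pd f v (p + a *\<^sub>R v + s *\<^sub>R w) - pd f v (p + a *\<^sub>R v)
      = s * (pd (pd f v) w (p + a *\<^sub>R v + b *\<^sub>R w))" by auto
  have "f (p + s *\<^sub>R v + s *\<^sub>R w) - f (p + s *\<^sub>R v) - f (p + s *\<^sub>R w) + f p = h s - h 0"
    by (simp add: h_def algebra_simps)
  also have "\<dots> = s * (s * (pd (pd f v) w (p + a *\<^sub>R v + b *\<^sub>R w)))"
    using a(3) b(3) by (simp add: algebra_simps)
  finally show ?thesis using a b by (auto simp: mult.assoc)
qed

lemma pd_commute:
  assumes "open U" "p \<in> U" "smooth_on U f"
  shows "pd (pd f v) w p = pd (pd f w) v p"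
proof (rule ccontr)
  assume ne: "\<not> ?thesis"
  define e where "e = \<bar>pd (pd f v) w p - pd (pd f w) v p\<bar> / 2"
  have e: "e > 0" using ne by (simp add: e_def)
  have c: "isCont (pd (pd f v) w) p" for v w
    using smooth_on_cont[OF assms(3,2), of "[w,v]"] by (simp add: pds_Cons)
  obtain d1 where d1: "d1 > 0" "\<And>q. dist q p < d1 \<Longrightarrow> dist (pd (pd f v) w q) (pd (pd f v) w p) < e"
    using c[of v w] e unfolding continuous_at_eps_delta by blast
  obtain d2 where d2: "d2 > 0" "\<And>q. dist q p < d2 \<Longrightarrow> dist (pd (pd f w) v q) (pd (pd f w) v p) < e"
    using c[of w v] e unfolding continuous_at_eps_delta by blast
  obtain d3 where d3: "d3 > 0" "ball p d3 \<subseteq> U" using assms(1,2) by (meson openE)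
  define d where "d = min d1 (min d2 d3)"
  \<comment> \<open>\<open>s\<close> is chosen so that the whole parallelogram with sides
    \<open>s\<close> times \<open>v\<close> and \<open>w\<close> lies within \<open>d\<close> of
    \<open>p\<close>; the summand 1 keeps the denominator positive.\<close>
  define m where "m = norm v + norm w + 1"
  define s where "s = d / (2 * m)"
  have d: "d > 0" using d1 d2 d3 by (simp add: d_def)
  have nn: "m > 0" unfolding m_def by (smt (verit) norm_ge_zero)
  have s: "s > 0" using d nn by (simp add: s_def)
  have near: "dist (p + a *\<^sub>R v + b *\<^sub>R w) p < d" if "0 \<le> a" "a \<le> s" "0 \<le> b" "b \<le> s" for a b
  proof -
    have "dist (p + a *\<^sub>R v + b *\<^sub>R w) p = norm (a *\<^sub>R v + b *\<^sub>R w)"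
      by (simp add: dist_norm algebra_simps)
    also have "\<dots> \<le> a * norm v + b * norm w"
      using that by (smt (verit) norm_triangle_ineq norm_scaleR)
    also have "\<dots> \<le> s * norm v + s * norm w"
      by (intro add_mono mult_right_mono) (use that in auto)
    also have "\<dots> \<le> s * m" using s by (simp add: m_def algebra_simps)
    also have "\<dots> = d / 2" using nn by (simp add: s_def)
    finally show ?thesis using d by simp
  qed
  have U1: "p + a *\<^sub>R v + b *\<^sub>R w \<in> U" if "0 \<le> a" "a \<le> s" "0 \<le> b" "b \<le> s" for a b
    using near[OF that] d3 by (auto simp: d_def dist_commute)
  then have U2: "p + a *\<^sub>R w + b *\<^sub>R v \<in> U" if "0 \<le> a" "a \<le> s" "0 \<le> b" "b \<le> s" for a b
    using U1[OF that(3,4,1,2)] by (simp add: algebra_simps)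
  obtain a b where ab: "0 < a" "a < s" "0 < b" "b < s"
    "f (p + s *\<^sub>R v + s *\<^sub>R w) - f (p + s *\<^sub>R v) - f (p + s *\<^sub>R w) + f p
     = s * s * pd (pd f v) w (p + a *\<^sub>R v + b *\<^sub>R w)"
    using second_difference[OF s U1 assms(3)] by blast
  obtain a' b' where ab': "0 < a'" "a' < s" "0 < b'" "b' < s"
    "f (p + s *\<^sub>R w + s *\<^sub>R v) - f (p + s *\<^sub>R w) - f (p + s *\<^sub>R v) + f p
     = s * s * pd (pd f w) v (p + a' *\<^sub>R w + b' *\<^sub>R v)"
    using second_difference[OF s U2 assms(3)] by blast
  have sw: "p + s *\<^sub>R w + s *\<^sub>R v = p + s *\<^sub>R v + s *\<^sub>R w" by (simp add: algebra_simps)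
  have "s * s * pd (pd f v) w (p + a *\<^sub>R v + b *\<^sub>R w) = s * s * pd (pd f w) v (p + a' *\<^sub>R w + b' *\<^sub>R v)"
    using ab(5) ab'(5)[unfolded sw] by linarith
  then have eq: "pd (pd f v) w (p + a *\<^sub>R v + b *\<^sub>R w) = pd (pd f w) v (p + a' *\<^sub>R w + b' *\<^sub>R v)"
    using s by simp
  have n1: "dist (p + a *\<^sub>R v + b *\<^sub>R w) p < d1" using near[of a b] ab by (auto simp: d_def)
  have n2: "dist (p + a' *\<^sub>R w + b' *\<^sub>R v) p < d2"
    using near[of b' a'] ab' by (auto simp: d_def algebra_simps)
  from d1(2)[OF n1] d2(2)[OF n2] eq show False
    unfolding dist_real_def e_def by (smt (verit) field_sum_of_halves)
qed

subsection \<open>Differentiation under the integral sign\<close>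

text \<open>Two uses of the mean value theorem replace Taylor's formula; the factor 1/2 is given
  up.\<close>

lemma second_order_bound:
  assumes "open U" "smooth_on U f" "\<And>s. 0 \<le> s \<Longrightarrow> s \<le> 1 \<Longrightarrow> p + s *\<^sub>R v \<in> U"
    and "\<And>q b c. q \<in> U \<Longrightarrow> b \<in> Basis \<Longrightarrow> c \<in> Basis \<Longrightarrow> \<bar>pds [c, b] f q\<bar> \<le> B b c"
  shows "\<bar>f (p + v) - f p - pd f v p\<bar> \<le> (norm v)\<^sup>2 * (\<Sum>b\<in>Basis. \<Sum>c\<in>Basis. B b c)"
proof -
  have "\<exists>z>0. z < 1 \<and> f (p + 1 *\<^sub>R v) - f (p + 0 *\<^sub>R v) = (1 - 0) * pd f v (p + z *\<^sub>R v)"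
    by (rule MVT2) (auto intro!: has_derivative_line smooth_on_diff[OF assms(2)] assms(3))
  then obtain z where z: "0 < z" "z < 1" "f (p + v) - f p = pd f v (p + z *\<^sub>R v)" by auto
  have "\<exists>y>0. y < z \<and> pd f v (p + z *\<^sub>R v) - pd f v (p + 0 *\<^sub>R v) = (z - 0) * pd (pd f v) v (p + y *\<^sub>R v)"
    using z by (intro MVT2) (auto intro!: has_derivative_line smooth_on_diff[OF smooth_on_pd[OF assms(2)]] assms(3))
  then obtain y where y: "0 < y" "y < z" "pd f v (p + z *\<^sub>R v) - pd f v p = z * pd (pd f v) v (p + y *\<^sub>R v)"
    by auto
  let ?q = "p + y *\<^sub>R v"
  have q: "?q \<in> U" using y z by (intro assms(3)) auto
  have vb: "\<bar>v \<bullet> b\<bar> \<le> norm v" if "b \<in> Basis" for b using Basis_le_norm[OF that] .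
  have "pds [v, v] f ?q = (\<Sum>b\<in>Basis. (v \<bullet> b) * pds [v] (pd f b) ?q)"
    using pds_snoc_Basis[OF assms(1,2) q, of "[v]" v] by simp
  also have "\<dots> = (\<Sum>b\<in>Basis. \<Sum>c\<in>Basis. (v \<bullet> b) * (v \<bullet> c) * pds [c, b] f ?q)"
    by (rule sum.cong[OF refl])
      (simp add: pds_Cons pd_Basis[OF smooth_on_diff[OF smooth_on_pd[OF assms(2)] q], of _ v]
        sum_distrib_left mult.assoc)
  finally have "\<bar>pds [v, v] f ?q\<bar> \<le> (\<Sum>b\<in>Basis. \<Sum>c\<in>Basis. \<bar>(v \<bullet> b) * (v \<bullet> c) * pds [c, b] f ?q\<bar>)"
    by (simp only:) (intro order_trans[OF sum_abs] sum_mono sum_abs)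
  also have "\<dots> \<le> (\<Sum>b\<in>Basis. \<Sum>c\<in>Basis. (norm v)\<^sup>2 * B b c)"
    unfolding abs_mult power2_eq_square
    by (intro sum_mono mult_mono assms(4) vb q) auto
  also have "\<dots> = (norm v)\<^sup>2 * (\<Sum>b\<in>Basis. \<Sum>c\<in>Basis. B b c)"
    by (simp add: sum_distrib_left)
  finally have b: "\<bar>pd (pd f v) v ?q\<bar> \<le> (norm v)\<^sup>2 * (\<Sum>b\<in>Basis. \<Sum>c\<in>Basis. B b c)"
    by (simp add: pds_Cons)
  have "\<bar>f (p + v) - f p - pd f v p\<bar> = z * \<bar>pd (pd f v) v ?q\<bar>"
    using z y by (simp add: abs_mult)
  also have "\<dots> \<le> 1 * \<bar>pd (pd f v) v ?q\<bar>" using z by (intro mult_right_mono) auto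
  finally show ?thesis using b by simp
qed

text \<open>The domination hypothesis on all iterated derivatives gives a quadratic bound for the remainder
  that is uniform in the parameter, so differentiation under the integral needs no limit theorem.\<close>

locale param_family =
  fixes M :: "real measure" and U :: "'n::finite pt set" and F :: "real \<Rightarrow> 'n pt \<Rightarrow> real"
  assumes open_U: "open U"
    and smooth: "smooth_on U (F t)"
    and measurable: "p \<in> U \<Longrightarrow> (\<lambda>t. pds ds (F t) p) \<in> borel_measurable M"
    and dominated: "\<exists>B. integrable M B \<and> (\<forall>t. \<forall>p\<in>U. \<bar>pds ds (F t) p\<bar> \<le> B t)"
begin

lemma integrable: "p \<in> U \<Longrightarrow> integrable M (\<lambda>t. pds ds (F t) p)"
proof -
  assume p: "p \<in> U"
  obtain B where B: "integrable M B" "\<forall>t. \<forall>p\<in>U. \<bar>pds ds (F t) p\<bar> \<le> B t" using dominated by blast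
  show ?thesis
    by (rule Bochner_Integration.integrable_bound[OF B(1) measurable[OF p]])
      (use B(2) p in \<open>auto intro!: AE_I2 order_trans[OF _ abs_ge_self]\<close>)
qed

lemma has_derivative_integral_param:
  assumes p: "p \<in> U"
  shows "((\<lambda>p. \<integral>t. F t p \<partial>M) has_derivative (\<lambda>v. \<integral>t. pd (F t) v p \<partial>M)) (at p)"
proof -
  have "\<exists>B. \<forall>ds. integrable M (B ds) \<and> (\<forall>t. \<forall>p\<in>U. \<bar>pds ds (F t) p\<bar> \<le> B ds t)"
    using dominated by metis
  then obtain B where B: "\<And>ds. integrable M (B ds)"
    "\<And>ds t q. q \<in> U \<Longrightarrow> \<bar>pds ds (F t) q\<bar> \<le> B ds t" by blast
  \<comment> \<open>An integrable bound for all second derivatives at once; it controls the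
    linearisation error of every \<open>F t\<close> with the same power of the increment.\<close>
  define C where "C t = (\<Sum>b\<in>Basis. \<Sum>c\<in>Basis. B [c, b] t)" for t
  have iC: "integrable M C" unfolding C_def by (intro Bochner_Integration.integrable_sum B)
  obtain e where e: "e > 0" "ball p e \<subseteq> U" using open_U p by (meson openE)
  have i0: "integrable M (\<lambda>t. F t q)" if "q \<in> U" for q
    using integrable[OF that, of "[]"] by simp
  have i1: "integrable M (\<lambda>t. pd (F t) v p)" for v
    using integrable[OF p, of "[v]"] by (simp add: pds_Cons)
  have lin: "linear (\<lambda>v. \<integral>t. pd (F t) v p \<partial>M)"
  proof (rule linearI)
    note l = pd_linear[OF smooth_on_diff[OF smooth p]]
    show "(\<integral>t. pd (F t) (v + w) p \<partial>M) = (\<integral>t. pd (F t) v p \<partial>M) + (\<integral>t. pd (F t) w p \<partial>M)" for v w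
      using linear_add[OF l] i1 by simp
    show "(\<integral>t. pd (F t) (c *\<^sub>R v) p \<partial>M) = c *\<^sub>R (\<integral>t. pd (F t) v p \<partial>M)" for c v
      using linear_cmul[OF l] by simp
  qed
  have bound: "\<bar>(\<integral>t. F t q \<partial>M) - (\<integral>t. F t p \<partial>M) - (\<integral>t. pd (F t) (q - p) p \<partial>M)\<bar>
      \<le> (norm (q - p))\<^sup>2 * (\<integral>t. C t \<partial>M)" if q: "dist q p < e" for q
  proof -
    have seg: "p + s *\<^sub>R (q - p) \<in> U" if s: "0 \<le> s" "s \<le> 1" for s
    proof -
      have "dist p (p + s *\<^sub>R (q - p)) = s * dist q p" using s by (simp add: dist_norm)
      also have "\<dots> \<le> 1 * dist q p" using s by (intro mult_right_mono) auto
      finally have "dist p (p + s *\<^sub>R (q - p)) < e" using q by simp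
      then show ?thesis using e(2) by (meson mem_ball subsetD)
    qed
    have qU: "q \<in> U" using seg[of 1] by simp
    have pw: "\<bar>F t q - F t p - pd (F t) (q - p) p\<bar> \<le> (norm (q - p))\<^sup>2 * C t" for t
      using second_order_bound[OF open_U smooth seg B(2), of t] unfolding C_def by simp
    have "(\<integral>t. F t q \<partial>M) - (\<integral>t. F t p \<partial>M) - (\<integral>t. pd (F t) (q - p) p \<partial>M)
      = (\<integral>t. F t q - F t p - pd (F t) (q - p) p \<partial>M)"
      using i0[OF qU] i0[OF p] i1 by simp
    also have "\<bar>\<dots>\<bar> \<le> (\<integral>t. \<bar>F t q - F t p - pd (F t) (q - p) p\<bar> \<partial>M)"
      by (rule integral_abs_bound)
    also have "\<dots> \<le> (\<integral>t. (norm (q - p))\<^sup>2 * C t \<partial>M)"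
      by (rule integral_mono) (use i0[OF qU] i0[OF p] i1 iC pw in auto)
    finally show ?thesis by simp
  qed
  show ?thesis
  proof (rule has_derivativeI_sandwich[OF e(1)])
    show "bounded_linear (\<lambda>v. \<integral>t. pd (F t) v p \<partial>M)"
      using lin by (simp add: linear_conv_bounded_linear)
    show "((\<lambda>q. norm (q - p) * (\<integral>t. C t \<partial>M)) \<longlongrightarrow> 0) (at p)"
      by (rule tendsto_eq_intros refl | simp)+
    fix q assume q: "q \<noteq> p" "dist q p < e"
    have n: "norm (q - p) > 0" using q by simp
    show "norm ((\<integral>t. F t q \<partial>M) - (\<integral>t. F t p \<partial>M) - (\<integral>t. pd (F t) (q - p) p \<partial>M)) / norm (q - p)
      \<le> norm (q - p) * (\<integral>t. C t \<partial>M)"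
      using bound[OF q(2)] n by (simp add: divide_le_eq power2_eq_square mult_ac)
  qed
qed

end

lemma param_family_pd:
  assumes "param_family M U F"
  shows "param_family M U (\<lambda>t. pd (F t) v)"
proof -
  interpret param_family M U F by fact
  show ?thesis
  proof
    show "open U" by (rule open_U)
    show "smooth_on U (pd (F t) v)" for t by (rule smooth_on_pd[OF smooth])
    show "(\<lambda>t. pds ds (pd (F t) v) p) \<in> borel_measurable M" if "p \<in> U" for p ds
      using measurable[OF that, of "ds @ [v]"] by (simp add: pds_snoc)
    show "\<exists>B. integrable M B \<and> (\<forall>t. \<forall>p\<in>U. \<bar>pds ds (pd (F t) v) p\<bar> \<le> B t)" for ds
      using dominated[of "ds @ [v]"] by (simp add: pds_snoc)
  qed
qed

lemma param_family_pds:
  "param_family M U F \<Longrightarrow> param_family M U (\<lambda>t. pds ds (F t))"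
  by (induction ds) (auto simp: pds_Cons intro: param_family_pd)

lemma (in param_family) pds_integral:
  assumes "p \<in> U"
  shows "pds ds (\<lambda>p. \<integral>t. F t p \<partial>M) p = (\<integral>t. pds ds (F t) p \<partial>M)"
  using assms
proof (induction ds arbitrary: p)
  case (Cons v ds)
  interpret D: param_family M U "\<lambda>t. pds ds (F t)" by (rule param_family_pds) (rule param_family_axioms)
  have "pd (pds ds (\<lambda>p. \<integral>t. F t p \<partial>M)) v p = pd (\<lambda>p. \<integral>t. pds ds (F t) p \<partial>M) v p"
    by (rule pd_cong_open[OF open_U Cons.prems]) (rule Cons.IH)
  also have "\<dots> = (\<integral>t. pd (pds ds (F t)) v p \<partial>M)"
    by (rule pd_eqI[OF D.has_derivative_integral_param[OF Cons.prems]])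
  finally show ?case by (simp add: pds_Cons)
qed simp

lemma (in param_family) smooth_integral: "smooth_on U (\<lambda>p. \<integral>t. F t p \<partial>M)"
  unfolding smooth_on_pds
proof (intro allI ballI)
  fix ds p assume p: "p \<in> U"
  interpret D: param_family M U "\<lambda>t. pds ds (F t)" by (rule param_family_pds) (rule param_family_axioms)
  have "(\<lambda>p. \<integral>t. pds ds (F t) p \<partial>M) differentiable at p"
    unfolding differentiable_def by (rule exI) (rule D.has_derivative_integral_param[OF p])
  then show "pds ds (\<lambda>p. \<integral>t. F t p \<partial>M) differentiable at p"
    using differentiable_cong_open[OF open_U p, of "pds ds (\<lambda>p. \<integral>t. F t p \<partial>M)"
      "\<lambda>p. \<integral>t. pds ds (F t) p \<partial>M"] pds_integral by simp
qed

text \<open>The constants in the hypothesis depend on the directions in an unknown way. Expansion in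
  the finite basis makes one constant serve all lists of length \<open>n\<close>, with the norms as
  explicit factors; the weight \<open>W\<close> is carried along.\<close>

lemma pds_multilinear_bound:
  assumes "open U"
  shows "smooth_on U f \<Longrightarrow> (\<And>ds. \<exists>C. \<forall>p\<in>U. \<bar>pds ds f p\<bar> \<le> C * W p)
    \<Longrightarrow> \<exists>C. \<forall>ds. length ds = n \<longrightarrow> (\<forall>p\<in>U. \<bar>pds ds f p\<bar> \<le> C * prod_list (map norm ds) * W p)"
proof (induction n arbitrary: f)
  case 0
  from 0(2)[of "[]"] show ?case by auto
next
  case (Suc n)
  have "\<exists>C. \<forall>ds. length ds = n \<longrightarrow>
     (\<forall>p\<in>U. \<bar>pds ds (pd f b) p\<bar> \<le> C * prod_list (map norm ds) * W p)" for b
    by (rule Suc.IH[OF smooth_on_pd[OF Suc.prems(1)]]) (simp flip: pds_snoc, rule Suc.prems(2))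
  then obtain C where C: "\<And>b ds p. length ds = n \<Longrightarrow> p \<in> U \<Longrightarrow>
      \<bar>pds ds (pd f b) p\<bar> \<le> C b * prod_list (map norm ds) * W p" by metis
  show ?case
  proof (intro exI[of _ "\<Sum>b\<in>Basis. C b"] allI impI ballI)
    fix ds :: "'a pt list" and p assume len: "length ds = Suc n" and p: "p \<in> U"
    obtain es v where ds: "ds = es @ [v]" using len by (cases ds rule: rev_cases) auto
    then have le: "length es = n" using len by simp
    have "\<bar>pds ds f p\<bar> = \<bar>\<Sum>b\<in>Basis. (v \<bullet> b) * pds es (pd f b) p\<bar>"
      unfolding ds pds_snoc_Basis[OF assms Suc.prems(1) p] ..
    also have "\<dots> \<le> (\<Sum>b\<in>Basis. \<bar>v \<bullet> b\<bar> * \<bar>pds es (pd f b) p\<bar>)"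
      by (rule order_trans[OF sum_abs]) (simp add: abs_mult)
    also have "\<dots> \<le> (\<Sum>b\<in>Basis. norm v * (C b * prod_list (map norm es) * W p))"
      by (intro sum_mono mult_mono Basis_le_norm C le p) auto
    also have "\<dots> = (\<Sum>b\<in>Basis. C b) * prod_list (map norm ds) * W p"
      by (simp add: ds sum_distrib_left sum_distrib_right mult_ac)
    finally show "\<bar>pds ds f p\<bar> \<le> (\<Sum>b\<in>Basis. C b) * prod_list (map norm ds) * W p" .
  qed
qed

subsection \<open>A smooth step function\<close>

primrec diff_n :: "nat \<Rightarrow> (real \<Rightarrow> real) \<Rightarrow> bool" where
  "diff_n 0 f = True"
| "diff_n (Suc n) f = (\<exists>f'. (\<forall>t. (f has_real_derivative f' t) (at t)) \<and> diff_n n f')"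

lemma diff_n_SucI: "(\<And>t. (f has_real_derivative f' t) (at t)) \<Longrightarrow> diff_n n f' \<Longrightarrow> diff_n (Suc n) f"
  by auto

lemma diff_n_SucD: "diff_n (Suc n) f \<Longrightarrow> diff_n n f"
  by (induction n arbitrary: f) auto

lemma diff_n_const: "diff_n n (\<lambda>t. c)"
proof (induction n arbitrary: c)
  case (Suc n)
  show ?case by (rule diff_n_SucI[OF _ Suc.IH[of 0]]) simp
qed simp

lemma diff_n_add: "diff_n n f \<Longrightarrow> diff_n n g \<Longrightarrow> diff_n n (\<lambda>t. f t + g t)"
proof (induction n arbitrary: f g)
  case (Suc n)
  obtain f' g' where *: "\<forall>t. (f has_real_derivative f' t) (at t)" "diff_n n f'"
    "\<forall>t. (g has_real_derivative g' t) (at t)" "diff_n n g'" using Suc.prems by auto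
  show ?case
    by (rule diff_n_SucI[OF DERIV_add[OF *(1)[rule_format] *(3)[rule_format]] Suc.IH[OF *(2,4)]])
qed simp

lemma diff_n_mult: "diff_n n f \<Longrightarrow> diff_n n g \<Longrightarrow> diff_n n (\<lambda>t. f t * g t)"
proof (induction n arbitrary: f g)
  case (Suc n)
  obtain f' g' where *: "\<forall>t. (f has_real_derivative f' t) (at t)" "diff_n n f'"
    "\<forall>t. (g has_real_derivative g' t) (at t)" "diff_n n g'" using Suc.prems by auto
  have "diff_n n (\<lambda>t. f' t * g t + g' t * f t)"
    by (intro diff_n_add Suc.IH * diff_n_SucD[OF Suc.prems(1)] diff_n_SucD[OF Suc.prems(2)])
  then show ?case
    by (rule diff_n_SucI[rotated]) (intro DERIV_mult *(1,3)[rule_format])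
qed simp

lemma diff_n_inverse: "diff_n n g \<Longrightarrow> (\<And>t. g t \<noteq> 0) \<Longrightarrow> diff_n n (\<lambda>t. inverse (g t))"
proof (induction n)
  case (Suc n)
  obtain g' where *: "\<forall>t. (g has_real_derivative g' t) (at t)" "diff_n n g'" using Suc.prems by auto
  have "diff_n n (\<lambda>t. (-1) * (g' t * (inverse (g t) * inverse (g t))))"
    by (intro diff_n_mult diff_n_const * Suc.IH diff_n_SucD[OF Suc.prems(1)] Suc.prems(2))
  moreover have "((\<lambda>t. inverse (g t)) has_real_derivative (-1) * (g' t * (inverse (g t) * inverse (g t)))) (at t)" for t
    using DERIV_inverse_fun[OF *(1)[rule_format] Suc.prems(2), of t] by (simp add: power2_eq_square mult_ac)
  ultimately show ?case by (rule diff_n_SucI[rotated])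
qed simp

lemma diff_n_affine: "diff_n n f \<Longrightarrow> diff_n n (\<lambda>t. f (a * t + b))"
proof (induction n arbitrary: f)
  case (Suc n)
  obtain f' where *: "\<forall>t. (f has_real_derivative f' t) (at t)" "diff_n n f'" using Suc.prems by auto
  have "((\<lambda>t. f (a * t + b)) has_real_derivative f' (a * t + b) * a) (at t)" for t
    by (rule DERIV_chain2[of f]) (use * in \<open>auto intro!: derivative_eq_intros\<close>)
  moreover have "diff_n n (\<lambda>t. f' (a * t + b) * a)" by (intro diff_n_mult diff_n_const Suc.IH *)
  ultimately show ?case by (rule diff_n_SucI)
qed simp

text \<open>The exponent \<open>k\<close> makes the family closed under differentiation up to linear
  combinations, which gives smoothness at 0 by induction.\<close>

definition exp_inv :: "nat \<Rightarrow> real \<Rightarrow> real" where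
  "exp_inv k t = (if t > 0 then exp (-1 / t) / t ^ k else 0)"

lemma exp_inv_deriv:
  "(exp_inv k has_real_derivative (- real k) * exp_inv (Suc k) t + exp_inv (k + 2) t) (at t)"
proof -
  consider "t > 0" | "t < 0" | "t = 0" by linarith
  then show ?thesis
  proof cases
    case 1
    have "((\<lambda>t. exp (-1 / t) / t ^ k) has_real_derivative (- real k) * exp_inv (Suc k) t + exp_inv (k + 2) t) (at t)"
    proof -
      have k: "real k * t ^ (k - Suc 0) = real k * t ^ k / t" using 1 by (cases k) auto
      have "((\<lambda>t. exp (-1 / t) / t ^ k) has_real_derivative
          (exp (-1 / t) * (1 / t\<^sup>2) * t ^ k - exp (-1 / t) * (real k * t ^ (k - Suc 0))) / (t ^ k * t ^ k)) (at t)"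
        using 1 by (auto intro!: derivative_eq_intros simp: power2_eq_square)
      also have "(exp (-1 / t) * (1 / t\<^sup>2) * t ^ k - exp (-1 / t) * (real k * t ^ (k - Suc 0))) / (t ^ k * t ^ k)
          = (- real k) * exp_inv (Suc k) t + exp_inv (k + 2) t"
        unfolding k using 1 by (simp add: exp_inv_def field_simps power2_eq_square)
      finally show ?thesis .
    qed
    then show ?thesis
      by (rule has_field_derivative_transform_within_open[of _ _ _ "{0<..}"])
        (use 1 in \<open>auto simp: exp_inv_def\<close>)
  next
    case 2
    have "((\<lambda>t. 0) has_real_derivative (- real k) * exp_inv (Suc k) t + exp_inv (k + 2) t) (at t)"
      using 2 by (simp add: exp_inv_def)
    then show ?thesis
      by (rule has_field_derivative_transform_within_open[of _ _ _ "{..<0}"])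
        (use 2 in \<open>auto simp: exp_inv_def\<close>)
  next
    case 3
    have r: "((\<lambda>h. exp (-1 / h) / h ^ Suc k) \<longlongrightarrow> 0) (at_right (0::real))"
      by real_asymp
    have "((\<lambda>h. (exp_inv k (0 + h) - exp_inv k 0) / h) \<longlongrightarrow> 0) (at 0)"
      proof (rule filterlim_split_at)
      show "((\<lambda>h. (exp_inv k (0 + h) - exp_inv k 0) / h) \<longlongrightarrow> 0) (at_left 0)"
        by (rule tendsto_eventually) (auto simp: eventually_at_filter exp_inv_def)
      show "((\<lambda>h. (exp_inv k (0 + h) - exp_inv k 0) / h) \<longlongrightarrow> 0) (at_right 0)"
        by (rule Lim_transform_eventually[OF r])
          (auto simp: eventually_at_filter exp_inv_def field_simps)
    qed
    then show ?thesis using 3 by (simp add: DERIV_def exp_inv_def)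
  qed
qed

lemma diff_n_exp_inv: "diff_n n (exp_inv k)"
proof (induction n arbitrary: k)
  case (Suc n)
  have "diff_n n (\<lambda>t. (- real k) * exp_inv (Suc k) t + exp_inv (k + 2) t)"
    by (intro diff_n_add diff_n_mult diff_n_const Suc.IH)
  then show ?case by (rule diff_n_SucI[OF exp_inv_deriv])
qed simp

lemma diff_n_deriv:
  assumes "\<And>n. diff_n n f"
  shows "(f has_real_derivative deriv f t) (at t)" "diff_n n (deriv f)"
proof -
  obtain f' where *: "\<forall>t. (f has_real_derivative f' t) (at t)" "diff_n n f'"
    using assms[of "Suc n"] by auto
  have "deriv f = f'" by (rule ext) (rule DERIV_imp_deriv, simp add: *)
  then show "(f has_real_derivative deriv f t) (at t)" "diff_n n (deriv f)" using * by auto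
qed

text \<open>The quotient s / (s + r) of a bump \<open>s\<close> starting at 1/3 and its mirror image
  \<open>r\<close> ending at 2/3. The mirror symmetry gives the last clause, which later turns two
  cutoffs into a partition of unity. \<open>F k\<close> is the k-th derivative.\<close>

lemma smooth_step_exists:
  "\<exists>F :: nat \<Rightarrow> real \<Rightarrow> real. (\<forall>k t. (F k has_real_derivative F (Suc k) t) (at t))
     \<and> (\<forall>k. \<forall>t<1/3. F k t = 0) \<and> (\<forall>t>2/3. F 0 t = 1) \<and> (\<forall>t. F 0 t + F 0 (1 - t) = 1)"
proof -
  define s where "s t = exp_inv 0 (1 * t + (- 1/3))" for t
  define r where "r t = exp_inv 0 ((- 1) * t + 2/3)" for t
  define \<beta> where "\<beta> t = s t * inverse (s t + r t)" for t
  have pos: "s t + r t > 0" for t unfolding s_def r_def exp_inv_def by (auto simp: add_pos_pos)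
  have ne: "s t + r t \<noteq> 0" for t using pos[of t] by linarith
  have diff_n\<beta>: "diff_n n \<beta>" for n
    unfolding \<beta>_def using ne unfolding s_def r_def
    by (intro diff_n_mult diff_n_inverse diff_n_add diff_n_affine diff_n_exp_inv) auto
  define F where "F k = (deriv ^^ k) \<beta>" for k
  have FS: "F (Suc k) = deriv (F k)" for k by (simp add: F_def)
  have dnF: "diff_n n (F k)" for n k
    by (induction k arbitrary: n) (use diff_n\<beta> in \<open>auto simp: F_def intro: diff_n_deriv\<close>)
  have D: "(F k has_real_derivative F (Suc k) t) (at t)" for k t
    unfolding FS by (rule diff_n_deriv(1)) (rule dnF)
  have Z: "F k t = 0" if "t < 1/3" for k t
    using that
  proof (induction k arbitrary: t)
    case 0 then show ?case by (simp add: F_def \<beta>_def s_def exp_inv_def)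
  next
    case (Suc k)
    have "(F k has_real_derivative 0) (at t)"
      by (rule has_field_derivative_transform_within_open[of "\<lambda>t. 0" _ _ "{..<1/3}"])
        (use Suc in auto)
    then show ?case by (rule DERIV_unique[OF D])
  qed
  have O: "F 0 t = 1" if "t > 2/3" for t
  proof -
    have "r t = 0" using that by (simp add: r_def exp_inv_def)
    moreover have "s t \<noteq> 0" using ne[of t] \<open>r t = 0\<close> by simp
    ultimately show ?thesis by (simp add: F_def \<beta>_def)
  qed
  have S: "F 0 t + F 0 (1 - t) = 1" for t
  proof -
    have "s (1 - t) = r t" "r (1 - t) = s t" by (simp_all add: s_def r_def algebra_simps)
    then have "F 0 t + F 0 (1 - t) = (s t + r t) * inverse (s t + r t)"
      by (simp add: F_def \<beta>_def algebra_simps)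
    then show ?thesis using ne[of t] by simp
  qed
  show ?thesis by (rule exI[of _ F]) (use D Z O S in auto)
qed

lemma smooth_n_compose_real:
  assumes "\<And>k t. (F k has_real_derivative F (Suc k) t) (at t)" "open U" "smooth_on U c"
  shows "smooth_n n U (\<lambda>p. F k (c p))"
proof (induction n arbitrary: k)
  case (Suc n)
  have d: "((\<lambda>p. F k (c p)) has_derivative (\<lambda>v. pd c v p * F (Suc k) (c p))) (at p)" if "p \<in> U" for p
    using has_derivative_compose[where g = "F k" and f = c,
        OF has_derivative_pd[OF smooth_on_diff[OF assms(3) that]]
          assms(1)[of k "c p", unfolded has_field_derivative_def]]
    by (simp add: mult.commute)
  have s: "smooth_n n U (\<lambda>p. pd c v p * F (Suc k) (c p))" for v
    using smooth_on_pd[OF assms(3)]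
    by (intro smooth_n_mult[OF assms(2)] Suc.IH) (simp add: smooth_on_smooth_n)
  have "smooth_n n U (pd (\<lambda>p. F k (c p)) v)" for v
    by (rule smooth_n_cong[OF assms(2) _ s[of v]]) (simp add: pd_eqI[OF d])
  moreover have "\<forall>p\<in>U. (\<lambda>p. F k (c p)) differentiable at p"
    using differentiableI[OF d] by blast
  ultimately show ?case by (simp add: smooth_n_Suc)
qed simp

lemma smooth_on_compose_real:
  assumes "\<And>k t. (F k has_real_derivative F (Suc k) t) (at t)" "open U" "smooth_on U c"
  shows "smooth_on U (\<lambda>p. F k (c p))"
  unfolding smooth_on_smooth_n by (intro allI smooth_n_compose_real) (rule assms)+

definition step :: "nat \<Rightarrow> real \<Rightarrow> real" where
  "step = (SOME F. (\<forall>k t. (F k has_real_derivative F (Suc k) t) (at t))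
     \<and> (\<forall>k. \<forall>t<1/3. F k t = 0) \<and> (\<forall>t>2/3. F 0 t = 1) \<and> (\<forall>t. F 0 t + F 0 (1 - t) = 1))"

lemma step_deriv: "(step k has_real_derivative step (Suc k) t) (at t)"
  and step_0: "t < 1/3 \<Longrightarrow> step k t = 0"
  and step_1: "t > 2/3 \<Longrightarrow> step 0 t = 1"
  and step_sym: "step 0 t + step 0 (1 - t) = 1"
  using someI_ex[OF smooth_step_exists, folded step_def] by blast+

lemma step_bounded: "\<exists>C. \<forall>t. 0 \<le> t \<and> t \<le> 1 \<longrightarrow> \<bar>step k t\<bar> \<le> C"
proof -
  have "continuous_on {0..1} (step k)"
    using step_deriv by (intro continuous_at_imp_continuous_on) (blast intro: DERIV_isCont)
  then have "bounded (step k ` {0..1})"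
    by (intro compact_imp_bounded compact_continuous_image) auto
  then obtain C where "\<forall>x\<in>step k ` {0..1}. norm x \<le> C" unfolding bounded_iff by blast
  then show ?thesis by (intro exI[of _ C]) auto
qed

subsection \<open>Rapidly decaying kernels\<close>

lemma integrable_exp_neg_abs: "integrable lborel (\<lambda>t::real. exp (- \<bar>t\<bar>))"
proof (rule Bochner_Integration.integrable_bound)
  show "integrable lborel (\<lambda>x::real. 2 * inverse (1 + x\<^sup>2))"
    using integrable_inverse_1_plus_square
    by (simp add: set_integrable_def einterval_def)
  have "exp (- \<bar>t\<bar>) \<le> 2 * inverse (1 + t\<^sup>2)" for t :: real
  proof -
    have "1 + \<bar>t\<bar> + \<bar>t\<bar>\<^sup>2 / 2 \<le> exp \<bar>t\<bar>" by (rule exp_lower_Taylor_quadratic) simp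
    then have "(1 + t\<^sup>2) / 2 \<le> exp \<bar>t\<bar>" by simp
    then have "inverse (exp \<bar>t\<bar>) \<le> inverse ((1 + t\<^sup>2) / 2)"
      by (intro le_imp_inverse_le) (auto simp: add_pos_nonneg)
    moreover have "inverse ((1 + t\<^sup>2) / 2) = 2 * inverse (1 + t\<^sup>2)"
      by (simp only: divide_inverse inverse_mult_distrib inverse_inverse_eq mult.commute)
    ultimately show ?thesis by (simp only: exp_minus)
  qed
  then show "AE x in lborel. norm (exp (- \<bar>x\<bar>)) \<le> norm (2 * inverse (1 + x\<^sup>2) :: real)"
    by (auto simp: abs_mult)
qed auto

text \<open>One kernel has to be integrable against derivatives of every order, and order n costs a
  factor exp(n |t|).\<close>

definition superexp :: "(real \<Rightarrow> real) \<Rightarrow> bool" where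
  "superexp f \<longleftrightarrow> f \<in> borel_measurable borel \<and> (\<forall>n::nat. \<exists>C. \<forall>t. \<bar>f t\<bar> \<le> C * exp (- real n * \<bar>t\<bar>))"

lemma superexpD:
  assumes "superexp f"
  obtains C where "C \<ge> 0" "\<And>t. \<bar>f t\<bar> \<le> C * exp (- real n * \<bar>t\<bar>)"
proof -
  obtain C where C: "\<forall>t. \<bar>f t\<bar> \<le> C * exp (- real n * \<bar>t\<bar>)" using assms unfolding superexp_def by blast
  have "0 \<le> C" using C[rule_format, of 0] by simp
  then show ?thesis using C that by blast
qed

lemma superexp_bound:
  assumes "superexp f"
  obtains B where "integrable lborel B" "\<And>t. \<bar>f t\<bar> * exp (real n * \<bar>t\<bar>) \<le> B t"
proof -
  obtain C where C: "C \<ge> 0" "\<And>t. \<bar>f t\<bar> \<le> C * exp (- real (Suc n) * \<bar>t\<bar>)" using superexpD[OF assms] by blast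
  have "\<bar>f t\<bar> * exp (real n * \<bar>t\<bar>) \<le> C * exp (- \<bar>t\<bar>)" for t
  proof -
    have "\<bar>f t\<bar> * exp (real n * \<bar>t\<bar>) \<le> C * exp (- real (Suc n) * \<bar>t\<bar>) * exp (real n * \<bar>t\<bar>)"
      by (intro mult_right_mono C) auto
    also have "\<dots> = C * exp (- \<bar>t\<bar>)" by (simp add: mult_exp_exp algebra_simps)
    finally show ?thesis .
  qed
  then show ?thesis by (intro that[of "\<lambda>t. C * exp (- \<bar>t\<bar>)"]) (auto intro: integrable_exp_neg_abs)
qed

lemma superexp_integrable:
  assumes "superexp f" "g \<in> borel_measurable borel" "\<And>t. \<bar>g t\<bar> \<le> C * exp (real n * \<bar>t\<bar>)"
  shows "integrable lborel (\<lambda>t. f t * g t)"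
proof -
  obtain B where B: "integrable lborel B" "\<And>t. \<bar>f t\<bar> * exp (real n * \<bar>t\<bar>) \<le> B t"
    using superexp_bound[OF assms(1)] by blast
  have fm: "f \<in> borel_measurable borel" using assms(1) by (simp add: superexp_def)
  have b: "\<bar>f t * g t\<bar> \<le> \<bar>C * B t\<bar>" for t
  proof -
    have "0 \<le> C" using assms(3)[of 0] by simp
    have "\<bar>f t * g t\<bar> \<le> \<bar>f t\<bar> * (C * exp (real n * \<bar>t\<bar>))"
      unfolding abs_mult by (intro mult_left_mono assms(3)) auto
    also have "\<dots> \<le> C * B t" using mult_left_mono[OF B(2)[of t] \<open>0 \<le> C\<close>] by (simp add: mult_ac)
    finally show ?thesis by linarith
  qed
  show ?thesis
    by (rule Bochner_Integration.integrable_bound[of _ "\<lambda>t. C * B t"])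
      (use B(1) fm assms(2) b in auto)
qed

lemma superexp_integrable1: "superexp f \<Longrightarrow> integrable lborel f"
  using superexp_integrable[of f "\<lambda>t. 1" 1 0] by simp

lemma superexp_tendsto:
  assumes "superexp f" "\<And>t. \<bar>g t\<bar> \<le> C * exp (real n * \<bar>t\<bar>)"
  shows "((\<lambda>t. f t * g t) \<longlongrightarrow> 0) at_top" "((\<lambda>t. f t * g t) \<longlongrightarrow> 0) at_bot"
proof -
  obtain D where D: "D \<ge> 0" "\<And>t. \<bar>f t\<bar> \<le> D * exp (- real (Suc n) * \<bar>t\<bar>)" using superexpD[OF assms(1)] by blast
  have b: "norm (f t * g t) \<le> D * C * exp (- \<bar>t\<bar>)" for t
  proof -
    have "\<bar>f t\<bar> * \<bar>g t\<bar> \<le> D * exp (- real (Suc n) * \<bar>t\<bar>) * (C * exp (real n * \<bar>t\<bar>))"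
      by (intro mult_mono D assms(2)) (use D(1) in auto)
    also have "\<dots> = D * C * exp (- \<bar>t\<bar>)" by (simp add: mult_exp_exp algebra_simps)
    finally show ?thesis by (simp add: abs_mult)
  qed
  have t: "((\<lambda>t::real. D * C * exp (- \<bar>t\<bar>)) \<longlongrightarrow> 0) at_top" by real_asymp
  have t': "((\<lambda>t::real. D * C * exp (- \<bar>t\<bar>)) \<longlongrightarrow> 0) at_bot" by real_asymp
  show "((\<lambda>t. f t * g t) \<longlongrightarrow> 0) at_top" "((\<lambda>t. f t * g t) \<longlongrightarrow> 0) at_bot"
    by (rule Lim_null_comparison[OF always_eventually[OF allI[OF b]]]; fact t t')+
qed

text \<open>The primitive of \<^term>\<open>f\<close> from the left, with the jump at 0 that makes it decay on both sides.\<close>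

definition left_primitive :: "(real \<Rightarrow> real) \<Rightarrow> real \<Rightarrow> real" where
  "left_primitive f t = (LBINT s=-\<infinity>..ereal t. f s) - (if t > 0 then LBINT s=-\<infinity>..\<infinity>. f s else 0)"

lemma LBINT_UNIV: "(LBINT s=-\<infinity>..\<infinity>. f s) = (\<integral>s. f s \<partial>lborel)" for f :: "real \<Rightarrow> real"
  by (simp add: interval_lebesgue_integral_def set_lebesgue_integral_def einterval_def)

lemma interval_integrable_lborel: "integrable lborel f \<Longrightarrow> interval_lebesgue_integrable lborel a b f" for f :: "real \<Rightarrow> real"
  unfolding interval_lebesgue_integrable_def set_integrable_def
  using integrable_mult_indicator[of _ lborel f] by simp

text \<open>On both sides of 0 the value is, up to sign, the integral of \<open>f\<close> over the
  half-line beyond \<open>t\<close>: for positive \<open>t\<close> the subtracted total turns the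
  left integral into minus the right one. Tails of \<open>f\<close> inherit its decay.\<close>

lemma superexp_left_primitive:
  assumes f: "superexp f" "\<And>t. isCont f t"
  shows "superexp (left_primitive f)"
    and "((\<lambda>t. LBINT s=-\<infinity>..ereal t. f s) has_real_derivative f t) (at t)"
proof -
  have int: "integrable lborel f" by (rule superexp_integrable1[OF f(1)])
  have fm: "f \<in> borel_measurable borel" using f(1) by (simp add: superexp_def)
  show D: "((\<lambda>t. LBINT s=-\<infinity>..ereal t. f s) has_real_derivative f t) (at t)" for t
  proof -
    define G where "G u = (LBINT s=ereal (t - 1)..ereal u. f s)" for u
    have e: "(LBINT s=-\<infinity>..ereal u. f s) = (LBINT s=-\<infinity>..ereal (t - 1). f s) + G u" for u
      unfolding G_def by (rule interval_integral_sum[symmetric]) (rule interval_integrable_lborel[OF int])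
    have "continuous_on {t - 1..t + 1} f" by (rule continuous_at_imp_continuous_on) (simp add: f(2))
    then have "(G has_vector_derivative f t) (at t within {t - 1..t + 1})"
      unfolding G_def by (intro interval_integral_FTC2) auto
    moreover have "at t within {t - 1..t + 1} = at t" by (rule at_within_interior) simp
    ultimately have "(G has_real_derivative f t) (at t)"
      by (simp add: has_real_derivative_iff_has_vector_derivative)
    then have "((\<lambda>u. (LBINT s=-\<infinity>..ereal (t - 1). f s) + G u) has_real_derivative 0 + f t) (at t)"
      by (intro DERIV_add DERIV_const)
    then show ?thesis unfolding e[symmetric] by simp
  qed
  have "continuous_on UNIV (\<lambda>t. LBINT s=-\<infinity>..ereal t. f s)"
    by (rule continuous_at_imp_continuous_on, rule ballI, rule DERIV_isCont, rule D)
  then have m: "(\<lambda>t. LBINT s=-\<infinity>..ereal t. f s) \<in> borel_measurable borel"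
    by (rule borel_measurable_continuous_onI)
  have meas: "left_primitive f \<in> borel_measurable borel" unfolding left_primitive_def using m by measurable
  have R: "left_primitive f t = - (LBINT s=ereal t..\<infinity>. f s)" if "t > 0" for t
    using interval_integral_sum[OF interval_integrable_lborel[OF int], of "-\<infinity>" "ereal t" "\<infinity>"] that
    by (simp add: left_primitive_def)
  have "\<exists>C. \<forall>t. \<bar>left_primitive f t\<bar> \<le> C * exp (- real n * \<bar>t\<bar>)" for n
  proof -
    \<comment> \<open>One exponential more than claimed: the spare factor exp(-|s|) makes the tail
      integrable.\<close>
    obtain C where C: "C \<ge> 0" "\<And>t. \<bar>f t\<bar> \<le> C * exp (- real (Suc n) * \<bar>t\<bar>)" using superexpD[OF f(1)] by blast
    define I where "I = (\<integral>t. exp (- \<bar>t :: real\<bar>) \<partial>lborel)"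
    have *: "\<bar>\<integral>s. indicator S s * f s \<partial>lborel\<bar> \<le> C * I * exp (- real n * \<bar>t\<bar>)"
      if S: "S \<in> sets borel" "\<And>s. s \<in> S \<Longrightarrow> \<bar>t\<bar> \<le> \<bar>s\<bar>" for S t
    proof -
      have i1: "integrable lborel (\<lambda>s. indicator S s * f s)"
        using integrable_mult_indicator[of S lborel f] S(1) int by simp
      have "\<bar>\<integral>s. indicator S s * f s \<partial>lborel\<bar> \<le> (\<integral>s. \<bar>indicator S s * f s\<bar> \<partial>lborel)"
        by (rule integral_abs_bound)
      also have "\<dots> \<le> (\<integral>s. C * exp (- real n * \<bar>t\<bar>) * exp (- \<bar>s\<bar>) \<partial>lborel)"
      proof (rule integral_mono)
        fix s
        show "\<bar>indicator S s * f s\<bar> \<le> C * exp (- real n * \<bar>t\<bar>) * exp (- \<bar>s\<bar>)"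
        proof (cases "s \<in> S")
          case True
          have "\<bar>f s\<bar> \<le> C * exp (- real (Suc n) * \<bar>s\<bar>)" by (rule C)
          also have "\<dots> = C * exp (- real n * \<bar>s\<bar>) * exp (- \<bar>s\<bar>)" by (simp add: mult_exp_exp algebra_simps)
          also have "\<dots> \<le> C * exp (- real n * \<bar>t\<bar>) * exp (- \<bar>s\<bar>)"
            using S(2)[OF True] C(1) by (intro mult_right_mono mult_left_mono) (auto intro: mult_left_mono)
          finally show ?thesis using True by simp
        qed (use C(1) in auto)
      qed (use i1 integrable_exp_neg_abs in auto)
      finally show ?thesis by (simp add: I_def mult_ac)
    qed
    have "\<bar>left_primitive f t\<bar> \<le> C * I * exp (- real n * \<bar>t\<bar>)" for t
    proof (cases "t > 0")
      case True
      have "left_primitive f t = - (\<integral>s. indicator {t<..} s * f s \<partial>lborel)"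
        unfolding R[OF True]
        by (simp add: interval_lebesgue_integral_def set_lebesgue_integral_def einterval_def greaterThan_def)
      then show ?thesis using *[of "{t<..}" t] True by auto
    next
      case False
      have "left_primitive f t = (\<integral>s. indicator {..<t} s * f s \<partial>lborel)"
        using False by (simp add: left_primitive_def interval_lebesgue_integral_def set_lebesgue_integral_def einterval_def lessThan_def)
      then show ?thesis using *[of "{..<t}" t] False by auto
    qed
    then show ?thesis by blast
  qed
  with meas show "superexp (left_primitive f)" unfolding superexp_def by blast
qed

text \<open>As a distribution, the derivative of \<open>left_primitive f\<close> is \<open>f\<close>
  minus its total integral times the point mass at 0. The proof integrates by parts on each
  half-line, where the boundary terms at infinity vanish by decay.\<close>

lemma integral_left_primitive_by_parts:
  assumes f: "superexp f" "\<And>t. isCont f t"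
    and F: "\<And>t. (F has_real_derivative F' t) (at t)" "\<And>t. isCont F' t"
    and b: "\<And>t. \<bar>F t\<bar> \<le> C * exp (real n * \<bar>t\<bar>)" "\<And>t. \<bar>F' t\<bar> \<le> C * exp (real n * \<bar>t\<bar>)"
  shows "(\<integral>t. left_primitive f t * F' t \<partial>lborel) = (\<integral>t. f t \<partial>lborel) * F 0 - (\<integral>t. f t * F t \<partial>lborel)"
proof -
  define P where "P t = (LBINT s=-\<infinity>..ereal t. f s)" for t
  define c where "c = (\<integral>t. f t \<partial>lborel)"
  have P: "(P has_real_derivative f t) (at t)" for t unfolding P_def by (rule superexp_left_primitive(2)[OF f])
  have cumn: "left_primitive f t = P t" if "t \<le> 0" for t using that by (simp add: left_primitive_def P_def)
  have cump: "left_primitive f t = P t - c" if "t > 0" for t using that by (simp add: left_primitive_def P_def LBINT_UNIV c_def)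
  have S: "superexp (left_primitive f)" by (rule superexp_left_primitive(1)[OF f])
  have Fc: "isCont F t" for t using F(1) by (rule DERIV_isCont)
  have Fm: "F \<in> borel_measurable borel" "F' \<in> borel_measurable borel"
    using F(2) Fc by (auto intro!: borel_measurable_continuous_onI continuous_at_imp_continuous_on)
  have i1: "integrable lborel (\<lambda>t. left_primitive f t * F' t)" by (rule superexp_integrable[OF S Fm(2) b(2)])
  have i2: "integrable lborel (\<lambda>t. f t * F t)" by (rule superexp_integrable[OF f(1) Fm(1) b(1)])
  have i3: "integrable lborel (\<lambda>t. f t * F t + left_primitive f t * F' t)" using i1 i2 by simp
  have Pc: "isCont P t" for t using P by (rule DERIV_isCont)
  have neg: "(LBINT t=-\<infinity>..0. f t * F t + left_primitive f t * F' t) = P 0 * F 0 - 0"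
  proof -
    have "(LBINT t=-\<infinity>..0. f t * F t + left_primitive f t * F' t) = (LBINT t=-\<infinity>..ereal 0. f t * F t + P t * F' t)"
      unfolding zero_ereal_def by (rule interval_integral_cong) (auto simp: einterval_def cumn)
    also have "\<dots> = P 0 * F 0 - 0"
    proof (rule interval_integral_FTC_integrable)
      show "((\<lambda>t. P t * F t) has_vector_derivative f t * F t + P t * F' t) (at t)" for t
        using DERIV_mult[OF P F(1), of t]
        by (simp add: has_real_derivative_iff_has_vector_derivative algebra_simps)
      show "isCont (\<lambda>t. f t * F t + P t * F' t) t" for t using f(2) F(2) Fc Pc by simp
      have "set_integrable lborel (einterval (-\<infinity>) (ereal 0)) (\<lambda>t. f t * F t + left_primitive f t * F' t)"
        using interval_integrable_lborel[OF i3, of "-\<infinity>" "ereal 0"] by (simp add: interval_lebesgue_integrable_def)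
      then show "set_integrable lborel (einterval (-\<infinity>) (ereal 0)) (\<lambda>t. f t * F t + P t * F' t)"
        by (rule set_integrable_cong[THEN iffD1, rotated 3]) (auto simp: einterval_def cumn)
      have "((\<lambda>t. P t * F t) \<longlongrightarrow> 0) at_bot"
        by (rule Lim_transform_eventually[OF superexp_tendsto(2)[OF S b(1)]])
          (auto intro: eventually_mono[OF eventually_le_at_bot[of 0]] simp: cumn)
      then show "(((\<lambda>t. P t * F t) \<circ> real_of_ereal) \<longlongrightarrow> 0) (at_right (-\<infinity>))"
        by (simp add: ereal_tendsto_simps)
      have "isCont (\<lambda>t. P t * F t) 0" using Fc Pc by simp
      then show "(((\<lambda>t. P t * F t) \<circ> real_of_ereal) \<longlongrightarrow> P 0 * F 0) (at_left (ereal 0))"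
        unfolding ereal_tendsto_simps isCont_def by (rule tendsto_mono[rotated]) (simp add: at_le)
    qed simp
    finally show ?thesis .
  qed
  have pos: "(LBINT t=0..\<infinity>. f t * F t + left_primitive f t * F' t) = 0 - (P 0 - c) * F 0"
  proof -
    have "(LBINT t=0..\<infinity>. f t * F t + left_primitive f t * F' t) = (LBINT t=ereal 0..\<infinity>. f t * F t + (P t - c) * F' t)"
      unfolding zero_ereal_def by (rule interval_integral_cong) (auto simp: einterval_def cump)
    also have "\<dots> = 0 - (P 0 - c) * F 0"
    proof (rule interval_integral_FTC_integrable)
      show "((\<lambda>t. (P t - c) * F t) has_vector_derivative f t * F t + (P t - c) * F' t) (at t)" for t
        using DERIV_mult[OF DERIV_diff[OF P DERIV_const] F(1), of c t]
        by (simp add: has_real_derivative_iff_has_vector_derivative algebra_simps)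
      show "isCont (\<lambda>t. f t * F t + (P t - c) * F' t) t" for t using f(2) F(2) Fc Pc by simp
      have "set_integrable lborel (einterval (ereal 0) \<infinity>) (\<lambda>t. f t * F t + left_primitive f t * F' t)"
        using interval_integrable_lborel[OF i3, of "ereal 0" "\<infinity>"] by (simp add: interval_lebesgue_integrable_def)
      then show "set_integrable lborel (einterval (ereal 0) \<infinity>) (\<lambda>t. f t * F t + (P t - c) * F' t)"
        by (rule set_integrable_cong[THEN iffD1, rotated 3]) (auto simp: einterval_def cump)
      have "((\<lambda>t. (P t - c) * F t) \<longlongrightarrow> 0) at_top"
        by (rule Lim_transform_eventually[OF superexp_tendsto(1)[OF S b(1)]])
          (auto intro: eventually_mono[OF eventually_gt_at_top[of 0]] simp: cump)
      then show "(((\<lambda>t. (P t - c) * F t) \<circ> real_of_ereal) \<longlongrightarrow> 0) (at_left \<infinity>)"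
        by (simp add: ereal_tendsto_simps)
      have "isCont (\<lambda>t. (P t - c) * F t) 0" using Fc Pc by simp
      then show "(((\<lambda>t. (P t - c) * F t) \<circ> real_of_ereal) \<longlongrightarrow> (P 0 - c) * F 0) (at_right (ereal 0))"
        unfolding ereal_tendsto_simps isCont_def by (rule tendsto_mono[rotated]) (simp add: at_le)
    qed simp
    finally show ?thesis .
  qed
  have "(\<integral>t. f t * F t \<partial>lborel) + (\<integral>t. left_primitive f t * F' t \<partial>lborel) = (LBINT t=-\<infinity>..\<infinity>. f t * F t + left_primitive f t * F' t)"
    unfolding LBINT_UNIV using i1 i2 by simp
  also have "\<dots> = (P 0 * F 0 - 0) + (0 - (P 0 - c) * F 0)"
    unfolding neg[symmetric] pos[symmetric]
    by (rule interval_integral_sum[symmetric]) (rule interval_integrable_lborel[OF i3])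
  finally show ?thesis by (simp add: c_def algebra_simps)
qed

text \<open>As in the indeterminacy of the log-normal moment problem, all integer exponential moments of
  \<^term>\<open>gauss_sin\<close> vanish, so its primitive has only the moment of order 0.\<close>

definition gauss_sin :: "real \<Rightarrow> real" where
  "gauss_sin t = exp (- t\<^sup>2 / 2) * sin (2 * pi * t)"

lemma gauss_bound: "exp (- t\<^sup>2 / 2) \<le> exp ((real n)\<^sup>2 / 2) * exp (- real n * \<bar>t\<bar>)"
proof -
  have "0 \<le> (\<bar>t\<bar> - real n)\<^sup>2" by simp
  also have "(\<bar>t\<bar> - real n)\<^sup>2 = t\<^sup>2 - 2 * real n * \<bar>t\<bar> + (real n)\<^sup>2"
    by (simp add: power2_diff algebra_simps)
  finally have "- t\<^sup>2 / 2 \<le> (real n)\<^sup>2 / 2 + (- real n * \<bar>t\<bar>)" by (simp add: field_simps)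
  then show ?thesis by (simp only: exp_add[symmetric] exp_le_cancel_iff)
qed

lemma isCont_gauss_sin: "isCont gauss_sin t"
  unfolding gauss_sin_def by (intro continuous_intros) auto

lemma superexp_gauss_mult:
  assumes "g \<in> borel_measurable borel" "\<And>t. \<bar>g t\<bar> \<le> C * exp (real m * \<bar>t\<bar>)"
  shows "superexp (\<lambda>t. exp (- t\<^sup>2 / 2) * g t)"
  unfolding superexp_def
proof (intro conjI allI)
  show "(\<lambda>t. exp (- t\<^sup>2 / 2) * g t) \<in> borel_measurable borel" using assms(1) by measurable
  fix n
  have "\<bar>exp (- t\<^sup>2 / 2) * g t\<bar> \<le> exp ((real (n + m))\<^sup>2 / 2) * C * exp (- real n * \<bar>t\<bar>)" for t
  proof -
    have "\<bar>exp (- t\<^sup>2 / 2) * g t\<bar> = exp (- t\<^sup>2 / 2) * \<bar>g t\<bar>" by (simp add: abs_mult)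
    also have "\<dots> \<le> (exp ((real (n + m))\<^sup>2 / 2) * exp (- real (n + m) * \<bar>t\<bar>)) * (C * exp (real m * \<bar>t\<bar>))"
      by (intro mult_mono gauss_bound assms(2)) auto
    also have "\<dots> = exp ((real (n + m))\<^sup>2 / 2) * C * (exp (- real (n + m) * \<bar>t\<bar>) * exp (real m * \<bar>t\<bar>))"
      by (simp only: mult_ac)
    also have "exp (- real (n + m) * \<bar>t\<bar>) * exp (real m * \<bar>t\<bar>) = exp (- real n * \<bar>t\<bar>)"
      unfolding exp_add[symmetric] by (simp add: algebra_simps)
    finally show ?thesis .
  qed
  then show "\<exists>C. \<forall>t. \<bar>exp (- t\<^sup>2 / 2) * g t\<bar> \<le> C * exp (- real n * \<bar>t\<bar>)" by blast
qed

lemma superexp_gauss_sin: "superexp gauss_sin"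
  unfolding gauss_sin_def[abs_def] by (rule superexp_gauss_mult[of _ 1 0]) auto

text \<open>Completing the square turns multiplication by \<open>exp (l t)\<close> into a shift by \<open>l\<close>, which is a period of
  the odd factor.\<close>

lemma gauss_sin_moment:
  fixes l :: int
  shows "(\<integral>t. gauss_sin t * exp (of_int l * t) \<partial>lborel) = 0"
proof -
  let ?f = "\<lambda>t. gauss_sin t * exp (of_int l * t)"
  let ?g = "\<lambda>u. exp ((of_int l)\<^sup>2 / 2) * gauss_sin u"
  have s: "sin (2 * pi * (of_int l + u)) = sin (2 * pi * u)" for u :: real
  proof -
    have "sin (2 * pi * u + 2 * pi * of_int l) = sin (2 * pi * u)"
      by (simp only: sin_add sin_int_2pin cos_int_2pin mult_1_right mult_zero_right add_0_right)
    then show ?thesis by (simp add: algebra_simps)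
  qed
  have shift: "?f (of_int l + u) = ?g u" for u
  proof -
    have e: "exp (- (of_int l + u)\<^sup>2 / 2) * exp (of_int l * (of_int l + u)) = exp ((of_int l)\<^sup>2 / 2) * exp (- u\<^sup>2 / 2)"
      unfolding exp_add[symmetric] by (simp add: field_simps power2_eq_square)
    show ?thesis unfolding gauss_sin_def s
      using arg_cong[OF e, of "\<lambda>x. x * sin (2 * pi * u)"] by (simp only: mult_ac)
  qed
  have odd: "?g (- u) = - ?g u" for u by (simp add: gauss_sin_def)
  have "(\<integral>t. ?f t \<partial>lborel) = (\<integral>u. ?f (of_int l + 1 * u) \<partial>lborel)"
    using lborel_integral_real_affine[of 1 ?f "of_int l"] by simp
  then have 1: "(\<integral>t. ?f t \<partial>lborel) = (\<integral>u. ?g u \<partial>lborel)" by (simp only: shift mult_1)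
  have "(\<integral>u. ?g u \<partial>lborel) = (\<integral>u. ?g (0 + (-1) * u) \<partial>lborel)"
    using lborel_integral_real_affine[of "-1" ?g 0] by simp
  also have "\<dots> = (\<integral>u. - ?g u \<partial>lborel)" by (simp only: odd add_0 mult_minus1)
  also have "\<dots> = - (\<integral>u. ?g u \<partial>lborel)" by (rule integral_minus)
  finally show ?thesis unfolding 1 by linarith
qed

lemma exp_ge_abs: "\<bar>t\<bar> \<le> exp \<bar>t\<bar>" for t :: real
  using exp_ge_add_one_self[of "\<bar>t\<bar>"] by linarith

text \<open>Up to normalisation this is the characteristic function of the standard normal law at 2
  pi, an exponential and hence nonzero.\<close>

lemma gauss_cos: "(\<integral>t. exp (- t\<^sup>2 / 2) * cos (2 * pi * t) \<partial>lborel) \<noteq> 0"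
proof -
  let ?N = std_normal_distribution
  interpret N: real_distribution ?N by (rule real_dist_normal_dist)
  have int: "integrable ?N (\<lambda>x. iexp (2 * pi * x))"
    by (rule N.integrable_const_bound[where B = 1]) auto
  have "Re (char ?N (2 * pi)) = (\<integral>x. Re (iexp (2 * pi * x)) \<partial>?N)"
    unfolding char_def by (rule integral_Re[OF int, symmetric])
  also have "\<dots> = (\<integral>x. cos (2 * pi * x) \<partial>?N)" by (simp add: Re_exp)
  also have "\<dots> = (\<integral>x. std_normal_density x *\<^sub>R cos (2 * pi * x) \<partial>lborel)"
    by (subst integral_density) (auto simp: normal_density_nonneg)
  also have "\<dots> = (\<integral>x. (1 / sqrt (2 * pi)) * (exp (- x\<^sup>2 / 2) * cos (2 * pi * x)) \<partial>lborel)"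
    by (simp add: std_normal_density_def mult.assoc)
  also have "\<dots> = (1 / sqrt (2 * pi)) * (\<integral>x. exp (- x\<^sup>2 / 2) * cos (2 * pi * x) \<partial>lborel)"
    by (rule integral_mult_right_zero)
  finally have "exp (- (2 * pi)\<^sup>2 / 2) = (1 / sqrt (2 * pi)) * (\<integral>x. exp (- x\<^sup>2 / 2) * cos (2 * pi * x) \<partial>lborel)"
    by (simp only: char_std_normal_distribution Re_complex_of_real)
  then show ?thesis by (metis exp_not_eq_zero mult_zero_right)
qed

text \<open>The derivative of \<open>gauss_sin\<close> integrates to 0 and equals 2 pi times the
  integrand of \<open>gauss_cos\<close> minus t times \<open>gauss_sin\<close>. The moment is needed
  to normalise the primitive, whose integral is its negative.\<close>

lemma gauss_sin_first_moment: "(\<integral>t. gauss_sin t * t \<partial>lborel) \<noteq> 0"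
proof -
  have i1: "integrable lborel (\<lambda>t. gauss_sin t * t)"
    by (rule superexp_integrable[OF superexp_gauss_sin, of _ 1 1]) (auto simp: exp_ge_abs)
  have S: "superexp (\<lambda>t. exp (- t\<^sup>2 / 2) * cos (2 * pi * t))"
    by (rule superexp_gauss_mult[of _ 1 0]) auto
  have i2: "integrable lborel (\<lambda>t. exp (- t\<^sup>2 / 2) * cos (2 * pi * t))"
    by (rule superexp_integrable1[OF S])
  let ?h = "\<lambda>t. 2 * pi * (exp (- t\<^sup>2 / 2) * cos (2 * pi * t)) - gauss_sin t * t"
  have i: "integrable lborel ?h" using i1 i2 by auto
  have "(LBINT t=-\<infinity>..\<infinity>. ?h t) = 0 - 0"
  proof (rule interval_integral_FTC_integrable)
    show "(gauss_sin has_vector_derivative ?h t) (at t)" for t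
      unfolding has_real_derivative_iff_has_vector_derivative[symmetric] gauss_sin_def[abs_def]
      by (auto intro!: derivative_eq_intros simp: algebra_simps)
    show "isCont ?h t" for t by (intro continuous_intros isCont_gauss_sin) auto
    show "set_integrable lborel (einterval (-\<infinity>) \<infinity>) ?h"
      using interval_integrable_lborel[OF i, of "-\<infinity>" "\<infinity>"] by (simp add: interval_lebesgue_integrable_def)
    have "(gauss_sin \<longlongrightarrow> 0) at_bot" "(gauss_sin \<longlongrightarrow> 0) at_top"
      using superexp_tendsto[OF superexp_gauss_sin, of "\<lambda>t. 1" 1 0] by auto
    then show "((gauss_sin \<circ> real_of_ereal) \<longlongrightarrow> 0) (at_right (-\<infinity>))"
      "((gauss_sin \<circ> real_of_ereal) \<longlongrightarrow> 0) (at_left \<infinity>)"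
      by (simp_all add: ereal_tendsto_simps)
  qed simp
  then have "(\<integral>t. ?h t \<partial>lborel) = 0" unfolding LBINT_UNIV by simp
  moreover have "(\<integral>t. ?h t \<partial>lborel) = (\<integral>t. 2 * pi * (exp (- t\<^sup>2 / 2) * cos (2 * pi * t)) \<partial>lborel) - (\<integral>t. gauss_sin t * t \<partial>lborel)"
    by (rule Bochner_Integration.integral_diff) (use i1 i2 in auto)
  ultimately have "(\<integral>t. gauss_sin t * t \<partial>lborel) = 2 * pi * (\<integral>t. exp (- t\<^sup>2 / 2) * cos (2 * pi * t) \<partial>lborel)"
    by simp
  then show ?thesis using gauss_cos by simp
qed

text \<open>The function rho of the overview. Integration by parts divides the l-th exponential
  moment of \<open>gauss_sin\<close>, which is 0, by -l; at l = 0 nothing is lost and the integral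
  can be normalised to 1.\<close>

definition proj_kernel :: "real \<Rightarrow> real" where
  "proj_kernel t = left_primitive gauss_sin t / (\<integral>t. left_primitive gauss_sin t \<partial>lborel)"

text \<open>Since the moment of order 0 vanishes there is no jump at 0. Hence
  \<open>proj_kernel\<close> is continuous and a primitive can be taken once more.\<close>

lemma left_primitive_gauss_sin: "left_primitive gauss_sin t = (LBINT s=-\<infinity>..ereal t. gauss_sin s)"
  using gauss_sin_moment[of 0] by (simp add: left_primitive_def LBINT_UNIV)

lemma isCont_proj_kernel: "isCont proj_kernel t"
proof -
  have "(left_primitive gauss_sin has_real_derivative gauss_sin t) (at t)"
    using superexp_left_primitive(2)[OF superexp_gauss_sin isCont_gauss_sin] unfolding left_primitive_gauss_sin[symmetric] .
  then have "isCont (left_primitive gauss_sin) t" by (rule DERIV_isCont)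
  then show ?thesis unfolding proj_kernel_def[abs_def] divide_inverse by (intro continuous_intros)
qed

lemma superexp_cmult: "superexp f \<Longrightarrow> superexp (\<lambda>t. c * f t)"
  unfolding superexp_def
proof (elim conjE, intro conjI allI)
  assume f: "\<forall>n::nat. \<exists>C. \<forall>t. \<bar>f t\<bar> \<le> C * exp (- real n * \<bar>t\<bar>)"
  fix n :: nat
  from f obtain C where "\<forall>t. \<bar>f t\<bar> \<le> C * exp (- real n * \<bar>t\<bar>)" by blast
  then have "\<forall>t. \<bar>c * f t\<bar> \<le> (\<bar>c\<bar> * C) * exp (- real n * \<bar>t\<bar>)"
    unfolding abs_mult by (auto simp: mult.assoc intro: mult_left_mono)
  then show "\<exists>C. \<forall>t. \<bar>c * f t\<bar> \<le> C * exp (- real n * \<bar>t\<bar>)" by blast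
qed auto

lemma superexp_proj_kernel: "superexp proj_kernel"
proof -
  have e: "proj_kernel = (\<lambda>t. inverse (\<integral>t. left_primitive gauss_sin t \<partial>lborel) * left_primitive gauss_sin t)"
    by (rule ext) (simp add: proj_kernel_def divide_inverse)
  show ?thesis
    by (subst e) (rule superexp_cmult[OF superexp_left_primitive(1)[OF superexp_gauss_sin isCont_gauss_sin]])
qed

lemma left_primitive_gauss_sin_integral: "(\<integral>t. left_primitive gauss_sin t \<partial>lborel) \<noteq> 0"
proof -
  have "(\<integral>t. left_primitive gauss_sin t * 1 \<partial>lborel) = (\<integral>t. gauss_sin t \<partial>lborel) * 0 - (\<integral>t. gauss_sin t * t \<partial>lborel)"
  proof (rule integral_left_primitive_by_parts[OF superexp_gauss_sin isCont_gauss_sin])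
    show "\<bar>t\<bar> \<le> 1 * exp (real 1 * \<bar>t\<bar>)" for t :: real using exp_ge_abs by simp
    show "\<bar>1\<bar> \<le> 1 * exp (real 1 * \<bar>t\<bar>)" for t :: real by simp
  qed auto
  then show ?thesis using gauss_sin_first_moment by simp
qed

lemma proj_kernel_integral: "(\<integral>t. proj_kernel t \<partial>lborel) = 1"
  unfolding proj_kernel_def[abs_def] using left_primitive_gauss_sin_integral by simp

lemma proj_kernel_moment:
  fixes l :: int
  assumes "l \<noteq> 0"
  shows "(\<integral>t. proj_kernel t * exp (of_int l * t) \<partial>lborel) = 0"
proof -
  define m where "m = nat \<bar>l\<bar>"
  have e: "exp (of_int l * t) \<le> exp (real m * \<bar>t\<bar>)" for t :: real
  proof -
    have "of_int l * t \<le> \<bar>of_int l * t\<bar>" by simp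
    also have "\<dots> = real m * \<bar>t\<bar>" by (simp add: m_def abs_mult)
    finally show ?thesis by simp
  qed
  have "(\<integral>t. left_primitive gauss_sin t * (of_int l * exp (of_int l * t)) \<partial>lborel)
    = (\<integral>t. gauss_sin t \<partial>lborel) * exp (of_int l * 0) - (\<integral>t. gauss_sin t * exp (of_int l * t) \<partial>lborel)"
  proof (rule integral_left_primitive_by_parts[OF superexp_gauss_sin isCont_gauss_sin, where C = "1 + \<bar>of_int l\<bar>" and n = m])
    show "((\<lambda>t. exp (of_int l * t)) has_real_derivative of_int l * exp (of_int l * t)) (at t)" for t
      by (auto intro!: derivative_eq_intros)
    have "exp (of_int l * t) \<le> (1 + \<bar>of_int l\<bar>) * exp (real m * \<bar>t\<bar>)" for t :: real
      using mult_mono[of 1 "1 + \<bar>of_int l\<bar>", OF _ e[of t]] by simp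
    then show "\<bar>exp (of_int l * t)\<bar> \<le> (1 + \<bar>of_int l\<bar>) * exp (real m * \<bar>t\<bar>)" for t :: real by simp
    show "\<bar>of_int l * exp (of_int l * t)\<bar> \<le> (1 + \<bar>of_int l\<bar>) * exp (real m * \<bar>t\<bar>)" for t :: real
      unfolding abs_mult by (intro mult_mono) (use e in auto)
  qed auto
  also have "\<dots> = 0" using gauss_sin_moment[of 0] gauss_sin_moment[of l] by simp
  finally have "of_int l * (\<integral>t. left_primitive gauss_sin t * exp (of_int l * t) \<partial>lborel) = 0"
    unfolding integral_mult_right_zero[symmetric] by (simp only: mult.left_commute)
  then have "(\<integral>t. left_primitive gauss_sin t * exp (of_int l * t) \<partial>lborel) = 0" using assms by simp
  then show ?thesis by (simp add: proj_kernel_def[abs_def])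
qed

text \<open>The kernel K of the overview: because \<open>proj_kernel\<close> has integral 1, its
  jump at 0 is exactly -1 and gives the point mass in K' = rho - delta.\<close>

definition solve_kernel :: "real \<Rightarrow> real" where "solve_kernel = left_primitive proj_kernel"

lemma superexp_solve_kernel: "superexp solve_kernel"
  unfolding solve_kernel_def by (rule superexp_left_primitive(1)[OF superexp_proj_kernel isCont_proj_kernel])

lemmas solve_kernel_by_parts = integral_left_primitive_by_parts[OF superexp_proj_kernel isCont_proj_kernel,
  folded solve_kernel_def, unfolded proj_kernel_integral mult_1]

subsection \<open>Averaging over linear flows\<close>

text \<open>The class on which averaging acts: averages along an unbounded flow lose compact support
  but keep bounded derivatives of all orders.\<close>

definition bdd_smooth :: "('n::finite pt \<Rightarrow> real) \<Rightarrow> bool" where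
  "bdd_smooth f \<longleftrightarrow> smooth_on UNIV f \<and> (\<forall>ds. \<exists>C. \<forall>p. \<bar>pds ds f p\<bar> \<le> C)"

definition cpt_smooth :: "('n::finite pt \<Rightarrow> real) \<Rightarrow> bool" where
  "cpt_smooth f \<longleftrightarrow> smooth_on UNIV f \<and> (\<exists>R. \<forall>p. R < norm p \<longrightarrow> f p = 0)"

lemma cpt_smooth_pd: "cpt_smooth f \<Longrightarrow> cpt_smooth (pd f v)"
proof -
  assume f: "cpt_smooth f"
  obtain R where R: "\<forall>p. R < norm p \<longrightarrow> f p = 0" using f unfolding cpt_smooth_def by blast
  have o: "open {p :: 'a pt. R < norm p}" by (intro open_Collect_less continuous_intros)
  have "pd f v p = 0" if "R < norm p" for p
    using pd_cong_open[OF o, of p f "\<lambda>p. 0"] R that by simp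
  then show ?thesis using f smooth_on_pd unfolding cpt_smooth_def by blast
qed

lemma cpt_smooth_pds: "cpt_smooth f \<Longrightarrow> cpt_smooth (pds ds f)"
  by (induction ds) (simp_all add: pds_Cons cpt_smooth_pd)

lemma cpt_smooth_mult: "cpt_smooth f \<Longrightarrow> smooth_on UNIV g \<Longrightarrow> cpt_smooth (\<lambda>p. f p * g p)"
  unfolding cpt_smooth_def
proof (elim conjE exE, intro conjI)
  fix R assume R: "\<forall>p. R < norm p \<longrightarrow> f p = 0"
  show "\<exists>R. \<forall>p. R < norm p \<longrightarrow> f p * g p = 0" by (rule exI[of _ R]) (use R in simp)
qed (simp add: smooth_on_mult)

lemma cpt_smooth_smooth: "cpt_smooth f \<Longrightarrow> smooth_on UNIV f" by (simp add: cpt_smooth_def)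

lemma cpt_smooth_bounded: assumes "cpt_smooth f" shows "\<exists>C\<ge>0. \<forall>p. \<bar>f p\<bar> \<le> C"
proof -
  obtain R where R: "\<And>p. R < norm p \<Longrightarrow> f p = 0" using assms unfolding cpt_smooth_def by blast
  have "continuous_on (cball 0 R) f"
    using smooth_on_cont[OF cpt_smooth_smooth[OF assms], of _ "[]"] by (intro continuous_at_imp_continuous_on) simp
  then have "bounded (f ` cball 0 R)" by (intro compact_imp_bounded compact_continuous_image) auto
  then obtain C where C: "\<forall>x\<in>f ` cball 0 R. norm x \<le> C" unfolding bounded_iff by blast
  have "\<bar>f p\<bar> \<le> max C 0" for p
  proof (cases "R < norm p")
    case False then show ?thesis using C by (force simp: le_max_iff_disj)
  qed (simp add: R)
  then show ?thesis by (intro exI[of _ "max C 0"]) simp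
qed

lemma cpt_smooth_bdd_smooth: "cpt_smooth f \<Longrightarrow> bdd_smooth f"
  unfolding bdd_smooth_def using cpt_smooth_smooth cpt_smooth_bounded[OF cpt_smooth_pds] by blast

lemma bdd_smooth_smooth: "bdd_smooth f \<Longrightarrow> smooth_on UNIV f" by (simp add: bdd_smooth_def)

lemma bdd_smooth_multilinear:
  assumes "bdd_smooth f"
  obtains C where "C \<ge> 0" "\<And>ds p. length ds = n \<Longrightarrow> \<bar>pds ds f p\<bar> \<le> C * prod_list (map norm ds)"
proof -
  have "\<exists>C. \<forall>p\<in>UNIV. \<bar>pds ds f p\<bar> \<le> C * 1" for ds using assms unfolding bdd_smooth_def by simp
  from pds_multilinear_bound[OF open_UNIV bdd_smooth_smooth[OF assms] this, of n]
  obtain C where C: "\<And>ds p. length ds = n \<Longrightarrow> \<bar>pds ds f p\<bar> \<le> C * prod_list (map norm ds)" by auto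
  have "\<bar>pds ds f p\<bar> \<le> max C 0 * prod_list (map norm ds)" if "length ds = n" for ds p
  proof -
    have "prod_list (map norm ds) \<ge> 0" by (induction ds) auto
    then have "C * prod_list (map norm ds) \<le> max C 0 * prod_list (map norm ds)"
      by (intro mult_right_mono) auto
    then show ?thesis using C[OF that, of p] by linarith
  qed
  then show ?thesis by (intro that[of "max C 0"]) auto
qed

text \<open>Shared by hyperbolic and periodic flows. The growth rate 1, the largest size of an
  eigenvalue in the hyperbolic case, gives the factor exp(n |t|) for derivatives of order n.\<close>

locale lflow =
  fixes A :: "'n::finite pt \<Rightarrow> 'n pt" and \<phi> :: "real \<Rightarrow> 'n pt \<Rightarrow> 'n pt" and c :: real
  assumes linear_A: "linear A"
    and linear: "linear (\<phi> t)"
    and deriv: "((\<lambda>t. \<phi> t p) has_vector_derivative A (\<phi> t p)) (at t)"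
    and zero: "\<phi> 0 p = p"
    and commA: "A (\<phi> t p) = \<phi> t (A p)"
    and growth: "norm (\<phi> t p) \<le> c * exp \<bar>t\<bar> * norm p" and c_nonneg: "c \<ge> 0"
begin

definition T :: "(real \<Rightarrow> real) \<Rightarrow> ('n pt \<Rightarrow> real) \<Rightarrow> 'n pt \<Rightarrow> real" where
  "T w G p = (\<integral>t. w t * G (\<phi> t p) \<partial>lborel)"

lemma isCont_flow: "isCont (\<lambda>t. \<phi> t p) t"
  using deriv by (rule has_vector_derivative_continuous)

text \<open>Base point and directions both move with \<open>t\<close>. Expanding the innermost
  direction in the basis leaves scalar coefficients continuous in \<open>t\<close> and a derivative
  with one moving direction less.\<close>

lemma isCont_pds_flow:
  "smooth_on UNIV G \<Longrightarrow> isCont (\<lambda>t. pds (map (\<phi> t) ds) G (\<phi> t p)) t"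
proof (induction ds arbitrary: G rule: rev_induct)
  case Nil
  have "isCont G (\<phi> t p)" using smooth_on_cont[OF Nil UNIV_I, where ds = "[]"] by simp
  then show ?case by (simp add: isCont_o2[OF isCont_flow])
next
  case (snoc v ds)
  have "pds (map (\<phi> t) (ds @ [v])) G (\<phi> t p)
      = (\<Sum>b\<in>Basis. (\<phi> t v \<bullet> b) * pds (map (\<phi> t) ds) (pd G b) (\<phi> t p))" for t
    using pds_snoc_Basis[OF open_UNIV snoc.prems UNIV_I] by simp
  then show ?case
    by (simp only:) (intro continuous_intros isCont_flow snoc.IH smooth_on_pd snoc.prems)
qed

lemma pds_flow:
  assumes "smooth_on UNIV G"
  shows "pds ds (\<lambda>p. w t * G (\<phi> t p)) p = w t * pds (map (\<phi> t) ds) G (\<phi> t p)"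
    "smooth_on UNIV (\<lambda>p. w t * G (\<phi> t p))"
proof -
  have s: "smooth_on UNIV (\<lambda>p. G (\<phi> t p))"
    by (rule smooth_on_compose_linear[OF linear open_UNIV assms]) auto
  show "smooth_on UNIV (\<lambda>p. w t * G (\<phi> t p))" by (intro smooth_on_mult open_UNIV smooth_on_const s)
  show "pds ds (\<lambda>p. w t * G (\<phi> t p)) p = w t * pds (map (\<phi> t) ds) G (\<phi> t p)"
    using pds_cmult[OF open_UNIV s UNIV_I, of ds "w t" p]
      pds_compose_linear[OF linear open_UNIV assms UNIV_I open_UNIV UNIV_I, of ds t p] by simp
qed

lemma family:
  assumes G: "smooth_on UNIV G" and w: "w \<in> borel_measurable borel" and U: "open U"
    and dom: "\<And>ds. \<exists>B. integrable lborel B \<and> (\<forall>t. \<forall>p\<in>U. \<bar>w t * pds (map (\<phi> t) ds) G (\<phi> t p)\<bar> \<le> B t)"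
  shows "param_family lborel U (\<lambda>t p. w t * G (\<phi> t p))"
proof
  show "open U" by fact
  show "smooth_on U (\<lambda>p. w t * G (\<phi> t p))" for t
    using pds_flow(2)[OF G] by (rule smooth_on_subset) simp
  show "(\<lambda>t. pds ds (\<lambda>p. w t * G (\<phi> t p)) p) \<in> borel_measurable lborel" for ds p
  proof -
    have "(\<lambda>t. pds (map (\<phi> t) ds) G (\<phi> t p)) \<in> borel_measurable borel"
      by (intro borel_measurable_continuous_onI continuous_at_imp_continuous_on ballI isCont_pds_flow G)
    then show ?thesis unfolding pds_flow(1)[OF G] using w by measurable
  qed
  show "\<exists>B. integrable lborel B \<and> (\<forall>t. \<forall>p\<in>U. \<bar>pds ds (\<lambda>p. w t * G (\<phi> t p)) p\<bar> \<le> B t)" for ds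
    unfolding pds_flow(1)[OF G] by (rule dom)
qed

lemma prod_list_flow:
  "prod_list (map norm (map (\<phi> t) ds)) \<le> c ^ length ds * exp (real (length ds) * \<bar>t\<bar>) * prod_list (map norm ds)"
proof (induction ds)
  case (Cons v ds)
  have nn: "prod_list (map norm (map (\<phi> t) ds)) \<ge> 0" by (induction ds) auto
  have "prod_list (map norm (map (\<phi> t) (v # ds)))
      \<le> (c * exp \<bar>t\<bar> * norm v) * (c ^ length ds * exp (real (length ds) * \<bar>t\<bar>) * prod_list (map norm ds))"
    unfolding list.map prod_list.Cons
    by (intro mult_mono growth Cons.IH nn) (use c_nonneg in auto)
  also have "\<dots> = c ^ length (v # ds) * (exp \<bar>t\<bar> * exp (real (length ds) * \<bar>t\<bar>)) * prod_list (map norm (v # ds))"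
    by (simp add: mult_ac)
  also have "exp \<bar>t\<bar> * exp (real (length ds) * \<bar>t\<bar>) = exp (real (length (v # ds)) * \<bar>t\<bar>)"
    unfolding exp_add[symmetric] by (simp add: algebra_simps)
  finally show ?case .
qed simp

lemma bound_pds_flow:
  assumes "bdd_smooth G"
  shows "\<exists>C\<ge>0. \<forall>t p. \<bar>pds (map (\<phi> t) ds) G (\<phi> t p)\<bar> \<le> C * exp (real (length ds) * \<bar>t\<bar>)"
proof -
  obtain C where C: "C \<ge> 0" "\<And>es p. length es = length ds \<Longrightarrow> \<bar>pds es G p\<bar> \<le> C * prod_list (map norm es)"
    using bdd_smooth_multilinear[OF assms] by blast
  have pn: "prod_list (map norm ds) \<ge> 0" by (induction ds) auto
  have "\<bar>pds (map (\<phi> t) ds) G (\<phi> t p)\<bar> \<le> C * c ^ length ds * prod_list (map norm ds) * exp (real (length ds) * \<bar>t\<bar>)" for t p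
  proof -
    have "\<bar>pds (map (\<phi> t) ds) G (\<phi> t p)\<bar> \<le> C * prod_list (map norm (map (\<phi> t) ds))" by (rule C) simp
    also have "\<dots> \<le> C * (c ^ length ds * exp (real (length ds) * \<bar>t\<bar>) * prod_list (map norm ds))"
      by (intro mult_left_mono prod_list_flow C)
    finally show ?thesis by (simp add: mult_ac)
  qed
  moreover have "C * c ^ length ds * prod_list (map norm ds) \<ge> 0" using C c_nonneg pn by simp
  ultimately show ?thesis by blast
qed

lemma superexp_dominated:
  assumes "superexp w" "bdd_smooth G"
  shows "\<exists>B. integrable lborel B \<and> (\<forall>t p. \<bar>w t * pds (map (\<phi> t) ds) G (\<phi> t p)\<bar> \<le> B t)"
proof -
  obtain C where C: "C \<ge> 0" "\<And>t p. \<bar>pds (map (\<phi> t) ds) G (\<phi> t p)\<bar> \<le> C * exp (real (length ds) * \<bar>t\<bar>)"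
    using bound_pds_flow[OF assms(2)] by blast
  obtain B where B: "integrable lborel B" "\<And>t. \<bar>w t\<bar> * exp (real (length ds) * \<bar>t\<bar>) \<le> B t"
    using superexp_bound[OF assms(1)] by blast
  have "\<bar>w t * pds (map (\<phi> t) ds) G (\<phi> t p)\<bar> \<le> C * B t" for t p
  proof -
    have "\<bar>w t * pds (map (\<phi> t) ds) G (\<phi> t p)\<bar> \<le> \<bar>w t\<bar> * (C * exp (real (length ds) * \<bar>t\<bar>))"
      unfolding abs_mult by (intro mult_left_mono C) auto
    also have "\<dots> \<le> C * B t" using mult_left_mono[OF B(2)[of t] C(1)] by (simp add: mult_ac)
    finally show ?thesis .
  qed
  then show ?thesis using B(1) by (intro exI[of _ "\<lambda>t. C * B t"]) simp
qed

lemma superexp_family: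
  assumes "superexp w" "bdd_smooth G"
  shows "param_family lborel UNIV (\<lambda>t p. w t * G (\<phi> t p))"
proof (rule family)
  show "smooth_on UNIV G" using assms by (simp add: bdd_smooth_def)
  show "w \<in> borel_measurable borel" using assms by (simp add: superexp_def)
  show "\<exists>B. integrable lborel B \<and> (\<forall>t. \<forall>p\<in>UNIV. \<bar>w t * pds (map (\<phi> t) ds) G (\<phi> t p)\<bar> \<le> B t)" for ds
    using superexp_dominated[OF assms] by simp
qed simp

lemma T_pds:
  assumes "superexp w" "bdd_smooth G"
  shows "pds ds (T w G) p = (\<integral>t. w t * pds (map (\<phi> t) ds) G (\<phi> t p) \<partial>lborel)"
proof -
  interpret F: param_family lborel UNIV "\<lambda>t p. w t * G (\<phi> t p)" by (rule superexp_family[OF assms])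
  show ?thesis
    using F.pds_integral[OF UNIV_I, of ds p] unfolding T_def[abs_def] pds_flow(1)[OF bdd_smooth_smooth[OF assms(2)]] .
qed

lemma T_pd:
  assumes "superexp w" "bdd_smooth G"
  shows "pd (T w G) v p = (\<integral>t. w t * pd G (\<phi> t v) (\<phi> t p) \<partial>lborel)"
  using T_pds[OF assms, of "[v]" p] by (simp add: pds_Cons)

lemma T_bdd_smooth:
  assumes "superexp w" "bdd_smooth G"
  shows "bdd_smooth (T w G)"
proof -
  interpret F: param_family lborel UNIV "\<lambda>t p. w t * G (\<phi> t p)" by (rule superexp_family[OF assms])
  have "\<exists>C. \<forall>p. \<bar>pds ds (T w G) p\<bar> \<le> C" for ds
  proof -
    obtain B where B: "integrable lborel B" "\<And>t p. \<bar>w t * pds (map (\<phi> t) ds) G (\<phi> t p)\<bar> \<le> B t"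
      using superexp_dominated[OF assms] by blast
    have "\<bar>pds ds (T w G) p\<bar> \<le> (\<integral>t. B t \<partial>lborel)" for p
      unfolding T_pds[OF assms]
    proof (rule order_trans[OF integral_abs_bound], rule integral_mono)
      show "integrable lborel (\<lambda>t. \<bar>w t * pds (map (\<phi> t) ds) G (\<phi> t p)\<bar>)"
        using F.integrable[OF UNIV_I, of ds p] unfolding pds_flow(1)[OF bdd_smooth_smooth[OF assms(2)]] by simp
    qed (use B in auto)
    then show ?thesis by blast
  qed
  moreover have "smooth_on UNIV (T w G)" using F.smooth_integral unfolding T_def[abs_def] .
  ultimately show ?thesis unfolding bdd_smooth_def by blast
qed

lemma orbit_deriv:
  assumes "smooth_on UNIV G"
  shows "((\<lambda>t. G (\<phi> t p)) has_real_derivative pd G (A (\<phi> t p)) (\<phi> t p)) (at t)"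
proof -
  have d: "(G has_derivative (\<lambda>v. pd G v (\<phi> t p))) (at (\<phi> t p))"
    by (rule has_derivative_pd[OF smooth_on_diff[OF assms UNIV_I]])
  have "((\<lambda>t. G (\<phi> t p)) has_derivative (\<lambda>h. pd G (h *\<^sub>R A (\<phi> t p)) (\<phi> t p))) (at t)"
    by (rule has_derivative_compose[where g = G and f = "\<lambda>t. \<phi> t p",
        OF deriv[unfolded has_vector_derivative_def] d])
  moreover have "pd G (h *\<^sub>R A (\<phi> t p)) (\<phi> t p) = pd G (A (\<phi> t p)) (\<phi> t p) * h" for h
    using linear_cmul[OF pd_linear[OF smooth_on_diff[OF assms UNIV_I]]] by simp
  ultimately show ?thesis by (simp only: has_field_derivative_def)
qed

lemma isCont_orbit_deriv:
  assumes "smooth_on UNIV G"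
  shows "isCont (\<lambda>t. pd G (A (\<phi> t p)) (\<phi> t p)) t"
  using isCont_pds_flow[OF assms, where ds = "[A p]" and p = p and t = t] by (simp add: pds_Cons commA)

text \<open>Since \<open>A\<close> commutes with its flow, differentiating under the integral yields
  the time derivative of \<open>G\<close> along the orbit. Integration by parts moves it to the
  kernel, and the point mass at time 0 returns \<open>G p\<close>.\<close>

lemma T_solve_kernel:
  assumes "bdd_smooth G"
  shows "pd (T solve_kernel G) (A p) p = G p - T proj_kernel G p"
proof -
  obtain C where C: "C \<ge> 0" "\<And>t q. \<bar>pds (map (\<phi> t) [A p]) G (\<phi> t q)\<bar> \<le> C * exp (real (length [A p]) * \<bar>t\<bar>)"
    using bound_pds_flow[OF assms] by blast
  obtain D where D: "D \<ge> 0" "\<And>t q. \<bar>pds (map (\<phi> t) []) G (\<phi> t q)\<bar> \<le> D * exp (real (length ([] :: 'n pt list)) * \<bar>t\<bar>)"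
    using bound_pds_flow[OF assms, of "[]"] by blast
  have s: "smooth_on UNIV G" by (rule bdd_smooth_smooth[OF assms])
  have "pd (T solve_kernel G) (A p) p = (\<integral>t. solve_kernel t * pd G (A (\<phi> t p)) (\<phi> t p) \<partial>lborel)"
    unfolding T_pd[OF superexp_solve_kernel assms] commA ..
  also have "\<dots> = G (\<phi> 0 p) - (\<integral>t. proj_kernel t * G (\<phi> t p) \<partial>lborel)"
  proof (rule solve_kernel_by_parts[where C = "C + D" and n = 1])
    show "\<bar>G (\<phi> t p)\<bar> \<le> (C + D) * exp (real 1 * \<bar>t\<bar>)" for t
    proof -
      have "D * 1 \<le> (C + D) * exp (real 1 * \<bar>t\<bar>)" using C(1) D(1) by (intro mult_mono) auto
      then show ?thesis using D(2)[of t p] by simp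
    qed
    show "\<bar>pd G (A (\<phi> t p)) (\<phi> t p)\<bar> \<le> (C + D) * exp (real 1 * \<bar>t\<bar>)" for t
    proof -
      have le: "C * exp (real 1 * \<bar>t\<bar>) \<le> (C + D) * exp (real 1 * \<bar>t\<bar>)" using D(1) by (intro mult_right_mono) auto
      show ?thesis by (rule order_trans[OF _ le]) (use C(2)[of t p] in \<open>simp add: pds_Cons commA\<close>)
    qed
  qed (rule orbit_deriv[OF s] isCont_orbit_deriv[OF s])+
  finally show ?thesis by (simp add: zero T_def)
qed

end

subsection \<open>Hyperbolic linear fields\<close>

lemma smooth_on_norm2:
  fixes L :: "'n::finite pt \<Rightarrow> 'n pt"
  assumes "linear L"
  shows "smooth_on UNIV (\<lambda>p. (norm (L p))\<^sup>2)" "pd (\<lambda>p. (norm (L p))\<^sup>2) v p = 2 * (L p \<bullet> L v)"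
proof -
  have bl: "bounded_linear L" using assms by (simp add: linear_conv_bounded_linear)
  have L: "(L has_derivative L) (at p)" for p by (rule bounded_linear_imp_has_derivative[OF bl])
  have "((\<lambda>p. L p \<bullet> L p) has_derivative (\<lambda>v. L p \<bullet> L v + L v \<bullet> L p)) (at p)" for p
    by (rule has_derivative_inner[OF L L])
  moreover have "(\<lambda>v. L p \<bullet> L v + L v \<bullet> L p) = (\<lambda>v. 2 * (L p \<bullet> L v))" for p
    by (rule ext) (metis inner_commute mult_2)
  ultimately have d: "((\<lambda>p. (norm (L p))\<^sup>2) has_derivative (\<lambda>v. 2 * (L p \<bullet> L v))) (at p)" for p
    unfolding power2_norm_eq_inner by (simp only:)
  show *: "pd (\<lambda>p. (norm (L p))\<^sup>2) v p = 2 * (L p \<bullet> L v)" for v p by (rule pd_eqI[OF d])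
  have bl2: "bounded_linear (\<lambda>p. 2 * (L p \<bullet> L v))" for v
    by (rule bounded_linear_const_mult[OF bounded_linear_inner_left_comp[OF bl]])
  have e: "pd (\<lambda>p. (norm (L p))\<^sup>2) v = (\<lambda>p. 2 * (L p \<bullet> L v))" for v by (rule ext) (rule *)
  show "smooth_on UNIV (\<lambda>p. (norm (L p))\<^sup>2)"
    by (rule smooth_onI_pd) (simp_all only: e smooth_on_linear(1)[OF bl2] differentiableI[OF d])
qed

lemma pds_pd_commute:
  assumes "open U" "smooth_on U f" "p \<in> U"
  shows "pds es (pd f v) p = pd (pds es f) v p"
  using assms(3)
proof (induction es arbitrary: p)
  case (Cons w es)
  have "pd (pds es (pd f v)) w p = pd (pd (pds es f) v) w p"
    by (rule pd_cong_open[OF assms(1) Cons.prems]) (rule Cons.IH)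
  also have "\<dots> = pd (pd (pds es f) w) v p"
    by (rule pd_commute[OF assms(1) Cons.prems smooth_on_pds'[OF assms(2)]])
  finally show ?case by (simp add: pds_Cons)
qed simp

lemma flat_point_mult:
  assumes "smooth_on UNIV e" "smooth_on UNIV g" "\<And>ds. pds ds e p = 0"
  shows "pds ds (\<lambda>q. e q * g q) p = 0"
  using assms
proof (induction "length ds" arbitrary: ds e g)
  case 0
  from 0(4)[of "[]"] show ?case using 0(1) by simp
next
  case (Suc n)
  obtain es v where ds: "ds = es @ [v]" "length es = n"
    using Suc.hyps(2) by (cases ds rule: rev_cases) auto
  have "pds ds (\<lambda>q. e q * g q) p = pds es (\<lambda>q. pd e v q * g q + e q * pd g v q) p"
    unfolding ds pds_snoc
    by (rule pds_cong_open[OF open_UNIV _ UNIV_I])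
      (rule pd_mult[OF smooth_on_diff[OF Suc.prems(1) UNIV_I] smooth_on_diff[OF Suc.prems(2) UNIV_I]])
  also have "\<dots> = pds es (\<lambda>q. pd e v q * g q) p + pds es (\<lambda>q. e q * pd g v q) p"
    by (intro pds_add[OF open_UNIV _ _ UNIV_I] smooth_on_mult open_UNIV smooth_on_pd Suc.prems(1,2))
  also have "pds es (\<lambda>q. pd e v q * g q) p = 0"
    by (rule Suc.hyps(1)[OF ds(2)[symmetric] smooth_on_pd[OF Suc.prems(1)] Suc.prems(2)])
      (simp flip: pds_snoc add: Suc.prems(3))
  also have "pds es (\<lambda>q. e q * pd g v q) p = 0"
    by (rule Suc.hyps(1)[OF ds(2)[symmetric] Suc.prems(1) smooth_on_pd[OF Suc.prems(2)] Suc.prems(3)])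
  finally show ?case by simp
qed

text \<open>An orthogonally diagonalisable field with eigenvalues 1, -1 and 0, encoded by identities
  so that the eigenprojections are polynomials in \<open>A\<close> and commute with all that
  commutes with \<open>A\<close>.\<close>

locale hyperbolic =
  fixes A :: "'n::finite pt \<Rightarrow> 'n pt"
  assumes linA: "linear A" and cube: "A (A (A p)) = A p" and selfadj: "A p \<bullet> q = p \<bullet> A q"
begin

text \<open>The orthogonal projections onto the eigenspaces for \<open>1\<close>, \<open>-1\<close> and \<open>0\<close>.\<close>

definition pp :: "'n pt \<Rightarrow> 'n pt" where "pp p = (1/2) *\<^sub>R (A (A p) + A p)"
definition pm :: "'n pt \<Rightarrow> 'n pt" where "pm p = (1/2) *\<^sub>R (A (A p) - A p)"
definition pz :: "'n pt \<Rightarrow> 'n pt" where "pz p = p - A (A p)"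

lemmas A_simps = linear_add[OF linA] linear_diff[OF linA] linear_cmul[OF linA] linear_0[OF linA]
  linear_neg[OF linA]

lemma lin_AA: "linear (\<lambda>p. A (A p))"
  using linear_compose[OF linA linA] by (simp add: o_def)

lemma lin_pp: "linear pp" and lin_pm: "linear pm" and lin_pz: "linear pz"
  unfolding pp_def[abs_def] pm_def[abs_def] pz_def[abs_def]
  by (intro linear_compose_scale_right linear_compose_add linear_compose_sub lin_AA linA linear_id[unfolded id_def])+

lemma decomp: "pp p + pm p + pz p = p"
  by (simp add: pp_def pm_def pz_def algebra_simps flip: scaleR_left.add)

lemma A_pp: "A (pp p) = pp p" and A_pm: "A (pm p) = - pm p" and A_pz: "A (pz p) = 0"
  by (simp_all add: pp_def pm_def pz_def A_simps cube algebra_simps)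

lemma A_eq: "A p = pp p - pm p" and AA_eq: "A (A p) = pp p + pm p"
  by (simp_all add: pp_def pm_def algebra_simps flip: scaleR_left.add)

lemma eig_plus: "A v = v \<Longrightarrow> pp v = v" "A v = v \<Longrightarrow> pm v = 0" "A v = v \<Longrightarrow> pz v = 0"
  and eig_minus: "A v = - v \<Longrightarrow> pp v = 0" "A v = - v \<Longrightarrow> pm v = v" "A v = - v \<Longrightarrow> pz v = 0"
  and eig_zero: "A v = 0 \<Longrightarrow> pp v = 0" "A v = 0 \<Longrightarrow> pm v = 0" "A v = 0 \<Longrightarrow> pz v = v"
  by (simp_all add: pp_def pm_def pz_def A_simps flip: scaleR_2)

lemma proj_simps [simp]:
  "pp (pp p) = pp p" "pm (pp p) = 0" "pz (pp p) = 0"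
  "pp (pm p) = 0" "pm (pm p) = pm p" "pz (pm p) = 0"
  "pp (pz p) = 0" "pm (pz p) = 0" "pz (pz p) = pz p"
  by (simp_all add: eig_plus[OF A_pp] eig_minus[OF A_pm] eig_zero[OF A_pz])

lemma norm_A2: "(norm (A p))\<^sup>2 = (norm (pp p))\<^sup>2 + (norm (pm p))\<^sup>2"
proof -
  have "pp p \<bullet> pm p = A (pp p) \<bullet> pm p" by (simp add: A_pp)
  also have "\<dots> = - (pp p \<bullet> pm p)" by (simp add: selfadj A_pm)
  finally have "pp p \<bullet> pm p = 0" by simp
  then show ?thesis by (simp add: A_eq power2_norm_eq_inner inner_diff_left inner_diff_right inner_commute)
qed

lemma pz_orth: "(norm p)\<^sup>2 = (norm (A p))\<^sup>2 + (norm (pz p))\<^sup>2"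
proof -
  have o: "A (A p) \<bullet> pz p = 0" "pz p \<bullet> A (A p) = 0"
    by (simp_all add: selfadj A_pz inner_commute[of "pz p"])
  have "p \<bullet> p = (A (A p) + pz p) \<bullet> (A (A p) + pz p)" by (simp add: pz_def)
  also have "\<dots> = A (A p) \<bullet> A (A p) + pz p \<bullet> pz p"
    by (simp only: inner_add_left inner_add_right o add_0_right add_0_left)
  finally have "p \<bullet> p = A (A p) \<bullet> A (A p) + pz p \<bullet> pz p" .
  moreover have "A (A p) \<bullet> A (A p) = A p \<bullet> A p"
    using selfadj[of "A p" "A (A p)"] by (simp add: cube)
  ultimately show ?thesis by (simp add: power2_norm_eq_inner)
qed

lemma norm_A_le: "norm (A p) \<le> norm p" and norm_pz_le: "norm (pz p) \<le> norm p"
  by (rule power2_le_imp_le[OF _ norm_ge_zero], simp only: pz_orth[of p], simp)+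

lemma norm_pp_leA: "norm (pp p) \<le> norm (A p)" and norm_pm_leA: "norm (pm p) \<le> norm (A p)"
  by (rule power2_le_imp_le[OF _ norm_ge_zero], simp only: norm_A2[of p], simp)+

lemma norm_pp_le: "norm (pp p) \<le> norm p" and norm_pm_le: "norm (pm p) \<le> norm p"
  by (rule order_trans[OF norm_pp_leA norm_A_le] order_trans[OF norm_pm_leA norm_A_le])+

definition hyp_flow :: "real \<Rightarrow> 'n pt \<Rightarrow> 'n pt" where
  "hyp_flow t p = exp t *\<^sub>R pp p + exp (- t) *\<^sub>R pm p + pz p"

lemma pp_hyp_flow: "pp (hyp_flow t p) = exp t *\<^sub>R pp p"
  and pm_hyp_flow: "pm (hyp_flow t p) = exp (- t) *\<^sub>R pm p"
  and pz_hyp_flow: "pz (hyp_flow t p) = pz p"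
  unfolding hyp_flow_def
  by (simp_all add: linear_add[OF lin_pp] linear_add[OF lin_pm] linear_add[OF lin_pz]
      linear_cmul[OF lin_pp] linear_cmul[OF lin_pm] linear_cmul[OF lin_pz])

lemma A_hyp_flow: "A (hyp_flow t p) = exp t *\<^sub>R pp p - exp (- t) *\<^sub>R pm p"
  unfolding A_eq[of "hyp_flow t p"] by (simp add: pp_hyp_flow pm_hyp_flow)

text \<open>The constant 3 counts the eigencomponents, each of which grows at most by exp
  |t|.\<close>

sublocale F: lflow A hyp_flow 3
proof (rule lflow.intro)
  show "linear A" by (rule linA)
  show "linear (hyp_flow t)" for t
    unfolding hyp_flow_def[abs_def]
    by (intro linear_compose_add linear_compose_scale_right lin_pp lin_pm lin_pz)
  show "((\<lambda>t. hyp_flow t p) has_vector_derivative A (hyp_flow t p)) (at t)" for t p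
    unfolding hyp_flow_def[abs_def] A_hyp_flow[unfolded hyp_flow_def]
    by (auto intro!: derivative_eq_intros has_vector_derivative_scaleR simp: has_real_derivative_iff_has_vector_derivative[symmetric])
  show "hyp_flow 0 p = p" for p by (simp add: hyp_flow_def decomp)
  show "A (hyp_flow t p) = hyp_flow t (A p)" for t p
    by (simp add: A_hyp_flow) (simp add: hyp_flow_def A_eq[of p] linear_diff[OF lin_pp] linear_diff[OF lin_pm] linear_diff[OF lin_pz])
  show "norm (hyp_flow t p) \<le> 3 * exp \<bar>t\<bar> * norm p" for t p
  proof -
    have "norm (hyp_flow t p) \<le> exp t * norm (pp p) + exp (- t) * norm (pm p) + norm (pz p)"
      unfolding hyp_flow_def by (intro order_trans[OF norm_triangle_ineq] add_mono) auto
    also have "\<dots> \<le> exp \<bar>t\<bar> * norm p + exp \<bar>t\<bar> * norm p + exp \<bar>t\<bar> * norm p"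
      by (intro add_mono mult_mono norm_pp_le norm_pm_le order_trans[OF norm_pz_le])
        (auto simp: mult_le_cancel_right1)
    finally show ?thesis by (simp add: mult.assoc mult.commute)
  qed
qed simp

section \<open>Functions flat on the zero set of a hyperbolic field, and their quotients\<close>

definition flat :: "('n pt \<Rightarrow> real) \<Rightarrow> bool" where
  "flat f \<longleftrightarrow> (\<forall>ds p. A p = 0 \<longrightarrow> pds ds f p = 0)"

text \<open>The segment from the projection \<open>pz p\<close> to \<open>p\<close> has direction
  \<open>A (A p)\<close>, of norm at most that of \<open>A p\<close>, so each use of the mean value
  theorem gains one factor. Compact support makes the constants uniform.\<close>

lemma flat_bound:
  assumes "cpt_smooth f" "flat f"
  shows "\<exists>C\<ge>0. \<forall>p. \<bar>f p\<bar> \<le> C * norm (A p) ^ N"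
  using assms
proof (induction N arbitrary: f)
  case 0
  then show ?case using cpt_smooth_bounded by simp
next
  case (Suc N)
  have "\<exists>C\<ge>0. \<forall>p. \<bar>pd f b p\<bar> \<le> C * norm (A p) ^ N" for b
  proof (rule Suc.IH[OF cpt_smooth_pd[OF Suc.prems(1)]])
    show "flat (pd f b)" using Suc.prems(2) unfolding flat_def by (simp flip: pds_snoc)
  qed
  then obtain C where C: "\<And>b. C b \<ge> 0" "\<And>b p. \<bar>pd f b p\<bar> \<le> C b * norm (A p) ^ N" by metis
  have s: "smooth_on UNIV f" by (rule cpt_smooth_smooth[OF Suc.prems(1)])
  have "\<bar>f p\<bar> \<le> (\<Sum>b\<in>Basis. C b) * norm (A p) ^ Suc N" for p
  proof -
    let ?v = "A (A p)"
    have f0: "f (pz p) = 0" using Suc.prems(2) A_pz[of p] unfolding flat_def by (metis pds_Nil)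
    have "\<exists>z>0. z < 1 \<and> f (pz p + 1 *\<^sub>R ?v) - f (pz p + 0 *\<^sub>R ?v) = (1 - 0) * pd f ?v (pz p + z *\<^sub>R ?v)"
      by (rule MVT2) (auto intro!: has_derivative_line smooth_on_diff[OF s])
    then obtain z where z: "0 < z" "z < 1" "f (pz p + ?v) - f (pz p) = pd f ?v (pz p + z *\<^sub>R ?v)" by auto
    let ?x = "pz p + z *\<^sub>R ?v"
    have Ax: "norm (A ?x) \<le> norm (A p)"
      using z by (simp add: A_simps A_pz cube mult_left_le_one_le)
    have e: "f p = pd f ?v ?x" using z(3) f0 by (simp add: pz_def)
    have vb: "\<bar>?v \<bullet> b\<bar> \<le> norm (A p)" if "b \<in> Basis" for b
      using Basis_le_norm[OF that, of ?v] norm_A_le[of "A p"] by linarith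
    have "\<bar>f p\<bar> = \<bar>\<Sum>b\<in>Basis. (?v \<bullet> b) * pd f b ?x\<bar>"
      unfolding e by (subst pd_Basis[OF smooth_on_diff[OF s UNIV_I]]) (rule refl)
    also have "\<dots> \<le> (\<Sum>b\<in>Basis. \<bar>?v \<bullet> b\<bar> * \<bar>pd f b ?x\<bar>)"
      by (rule order_trans[OF sum_abs]) (simp add: abs_mult)
    also have "\<dots> \<le> (\<Sum>b\<in>Basis. norm (A p) * (C b * norm (A p) ^ N))"
    proof (intro sum_mono mult_mono vb)
      fix b
      have "\<bar>pd f b ?x\<bar> \<le> C b * norm (A ?x) ^ N" by (rule C)
      also have "\<dots> \<le> C b * norm (A p) ^ N" by (intro mult_left_mono power_mono Ax C) auto
      finally show "\<bar>pd f b ?x\<bar> \<le> C b * norm (A p) ^ N" .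
    qed auto
    finally show ?thesis by (simp add: sum_distrib_left sum_distrib_right mult_ac)
  qed
  moreover have "(\<Sum>b\<in>Basis. C b) \<ge> 0" by (intro sum_nonneg C)
  ultimately show ?case by blast
qed

lemma flat_mult: "cpt_smooth e \<Longrightarrow> flat e \<Longrightarrow> smooth_on UNIV g \<Longrightarrow> flat (\<lambda>p. e p * g p)"
  unfolding flat_def using flat_point_mult[OF cpt_smooth_smooth] by blast

lemma flat_pd: "flat e \<Longrightarrow> flat (pd e v)"
  unfolding flat_def by (simp flip: pds_snoc)

lemma flat_0: "flat e \<Longrightarrow> A p = 0 \<Longrightarrow> e p = 0"
  unfolding flat_def by (metis pds_Nil)

definition aa :: "'n pt \<Rightarrow> real" where "aa p = (norm (pp p))\<^sup>2"
definition rr :: "'n pt \<Rightarrow> real" where "rr p = (norm (A p))\<^sup>2"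

lemma smooth_aa: "smooth_on UNIV aa" and smooth_rr: "smooth_on UNIV rr"
  unfolding aa_def[abs_def] rr_def[abs_def] by (rule smooth_on_norm2(1)[OF lin_pp] smooth_on_norm2(1)[OF linA])+

lemma aa_le_rr: "0 \<le> aa p" "aa p \<le> rr p" by (simp_all add: aa_def rr_def norm_A2)

lemma rr_0: "rr p = 0 \<longleftrightarrow> A p = 0" by (simp add: rr_def)

text \<open>This class is closed under differentiation, and its members are small near the zero set of \<^term>\<open>A\<close>; hence they
  are smooth across it although \<^term>\<open>aa p / rr p\<close> is not (and there has the junk value 0).\<close>

inductive flat_quot :: "('n pt \<Rightarrow> real) \<Rightarrow> bool" where
  base: "cpt_smooth e \<Longrightarrow> flat e \<Longrightarrow> flat_quot (\<lambda>p. e p * step k (aa p / rr p) / rr p ^ j)"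
| add: "flat_quot f \<Longrightarrow> flat_quot g \<Longrightarrow> flat_quot (\<lambda>p. f p + g p)"

text \<open>Where the step function does not vanish, \<open>rr\<close> is at most 3 times
  \<open>aa\<close>. Flatness of \<open>e\<close> supplies any power of \<open>rr\<close>: enough to
  cancel the denominator and leave the wanted power of \<open>aa\<close>, the quantity that decays
  in backward time.\<close>

lemma flat_quot_bound: "flat_quot f \<Longrightarrow> \<exists>C\<ge>0. \<forall>p. \<bar>f p\<bar> \<le> C * aa p ^ N"
proof (induction rule: flat_quot.induct)
  case (base e k j)
  obtain C where C: "C \<ge> 0" "\<And>p. \<bar>e p\<bar> \<le> C * norm (A p) ^ (2 * (N + j))"
    using flat_bound[OF base] by blast
  obtain D where D: "\<And>t. 0 \<le> t \<Longrightarrow> t \<le> 1 \<Longrightarrow> \<bar>step k t\<bar> \<le> D" using step_bounded by blast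
  have D0: "D \<ge> 0" using D[of 0] by simp
  have "\<bar>e p * step k (aa p / rr p) / rr p ^ j\<bar> \<le> (C * D * 3 ^ N) * aa p ^ N" for p
  proof (cases "rr p = 0 \<or> aa p / rr p < 1/3")
    case True
    then have "e p * step k (aa p / rr p) / rr p ^ j = 0"
      by (elim disjE) (simp_all add: flat_0[OF base(2) rr_0[THEN iffD1]] step_0)
    then have "\<bar>e p * step k (aa p / rr p) / rr p ^ j\<bar> = 0" by (simp only: abs_zero)
    then show ?thesis using C(1) D0 aa_le_rr(1)[of p] by (simp only:) simp
  next
    case False
    then have r: "rr p > 0" using aa_le_rr[of p] by linarith
    have r3: "rr p \<le> 3 * aa p" using False r by (auto simp: field_simps)
    have d: "\<bar>step k (aa p / rr p)\<bar> \<le> D" using aa_le_rr[of p] r by (intro D) auto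
    have ee: "\<bar>e p\<bar> \<le> C * rr p ^ (N + j)" unfolding rr_def power_mult[symmetric] by (rule C)
    have "\<bar>e p\<bar> * \<bar>step k (aa p / rr p)\<bar> / rr p ^ j \<le> (C * rr p ^ (N + j)) * D / rr p ^ j"
      using C(1) r by (intro divide_right_mono mult_mono d ee) auto
    also have "\<dots> = C * D * rr p ^ N" using r by (simp add: power_add)
    also have "\<dots> \<le> C * D * (3 * aa p) ^ N" using C(1) D0 r r3 by (intro mult_left_mono power_mono) auto
    also have "\<dots> = (C * D * 3 ^ N) * aa p ^ N" by (simp add: power_mult_distrib)
    finally show ?thesis using r by (simp add: abs_mult)
  qed
  moreover have "C * D * 3 ^ N \<ge> 0" using C(1) D0 by simp
  ultimately show ?case by blast
next
  case (add f g)
  obtain C D where CD: "C \<ge> 0" "\<And>p. \<bar>f p\<bar> \<le> C * aa p ^ N" "D \<ge> 0" "\<And>p. \<bar>g p\<bar> \<le> D * aa p ^ N"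
    using add.IH by metis
  have "\<bar>f p + g p\<bar> \<le> (C + D) * aa p ^ N" for p
    using CD(2)[of p] CD(4)[of p] by (simp add: distrib_right)
  then show ?case using CD by (intro exI[of _ "C + D"]) auto
qed

text \<open>Since \<open>aa\<close> is at most the squared distance to any zero of \<open>A\<close>,
  the bound by \<open>aa\<close> alone forces value and derivative to be 0 there.\<close>

lemma flat_quot_flat_deriv:
  assumes "flat_quot f" "A p = 0"
  shows "(f has_derivative (\<lambda>v. 0)) (at p)" "f p = 0"
proof -
  obtain C where C: "C \<ge> 0" "\<And>p. \<bar>f p\<bar> \<le> C * aa p ^ 1" using flat_quot_bound[OF assms(1)] by blast
  have ap: "aa p = 0" using aa_le_rr[of p] assms(2) rr_0[of p] by simp
  show fp: "f p = 0" using C(2)[of p] ap by simp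
  show "(f has_derivative (\<lambda>v. 0)) (at p)"
  proof (rule has_derivativeI_sandwich[of 1])
    show "((\<lambda>q. C * norm (q - p)) \<longlongrightarrow> 0) (at p)" by (rule tendsto_eq_intros refl | simp)+
    fix q assume q: "q \<noteq> p" "dist q p < 1"
    have "aa q \<le> (norm (q - p))\<^sup>2"
    proof -
      have "A q = A (q - p)" using assms(2) by (simp add: A_simps)
      then have "norm (A q) \<le> norm (q - p)" using norm_A_le by metis
      then have "rr q \<le> (norm (q - p))\<^sup>2" unfolding rr_def by (intro power_mono) auto
      then show ?thesis using aa_le_rr[of q] by linarith
    qed
    then have "\<bar>f q\<bar> \<le> C * (norm (q - p))\<^sup>2"
      using C(2)[of q] mult_left_mono[OF _ C(1)] by fastforce
    then show "norm (f q - f p - 0) / norm (q - p) \<le> C * norm (q - p)"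
      using q fp by (simp add: divide_le_eq power2_eq_square mult.assoc)
  qed simp_all
qed

lemma flat_quot_pd: "flat_quot f \<Longrightarrow> (\<forall>p. f differentiable (at p)) \<and> flat_quot (pd f v)"
proof (induction rule: flat_quot.induct)
  case (base e k j)
  let ?f = "\<lambda>p. e p * step k (aa p / rr p) / rr p ^ j"
  \<comment> \<open>The numerators from differentiating \<open>e\<close>, the argument of the step
    function, and the denominator. Each is a derivative of \<open>e\<close> or a smooth multiple of
    \<open>e\<close>, hence again flat with bounded support.\<close>
  let ?e1 = "pd e v" and ?e2 = "\<lambda>p. e p * (pd aa v p * rr p - aa p * pd rr v p)"
    and ?e3 = "\<lambda>p. e p * (- real j * pd rr v p)"
  let ?f' = "\<lambda>p. (?e1 p * step k (aa p / rr p) / rr p ^ j + ?e2 p * step (Suc k) (aa p / rr p) / rr p ^ (j + 2))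
    + ?e3 p * step k (aa p / rr p) / rr p ^ (j + 1)"
  have f: "flat_quot ?f" by (rule flat_quot.base[OF base])
  note se = cpt_smooth_smooth[OF base(1)]
  have sm: "smooth_on UNIV (\<lambda>p. pd aa v p * rr p - aa p * pd rr v p)" "smooth_on UNIV (\<lambda>p. - real j * pd rr v p)"
    by (intro smooth_on_minus smooth_on_mult smooth_on_const smooth_on_pd smooth_aa smooth_rr open_UNIV)+
  have f': "flat_quot ?f'"
    by (intro flat_quot.intros cpt_smooth_pd flat_pd cpt_smooth_mult flat_mult base sm)
  have d: "(?f has_derivative (\<lambda>w. (pd e w p * step k (aa p / rr p) / rr p ^ j
      + e p * (pd aa w p * rr p - aa p * pd rr w p) * step (Suc k) (aa p / rr p) / rr p ^ (j + 2))
    + e p * (- real j * pd rr w p) * step k (aa p / rr p) / rr p ^ (j + 1))) (at p)" if r: "rr p \<noteq> 0" for p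
  proof -
    note de = has_derivative_pd[OF smooth_on_diff[OF se UNIV_I], of p]
    note da = has_derivative_pd[OF smooth_on_diff[OF smooth_aa UNIV_I], of p]
    note dr = has_derivative_pd[OF smooth_on_diff[OF smooth_rr UNIV_I], of p]
    have dq: "((\<lambda>p. aa p / rr p) has_derivative (\<lambda>w. (pd aa w p * rr p - aa p * pd rr w p) / (rr p * rr p))) (at p)"
      by (rule has_derivative_divide'[OF da dr r])
    have ds: "((\<lambda>p. step k (aa p / rr p)) has_derivative
        (\<lambda>w. step (Suc k) (aa p / rr p) * ((pd aa w p * rr p - aa p * pd rr w p) / (rr p * rr p)))) (at p)"
      by (rule has_derivative_compose[OF dq, where g = "step k",
          OF step_deriv[unfolded has_field_derivative_def]])
    have dp: "((\<lambda>p. rr p ^ j) has_derivative (\<lambda>w. pd rr w p * real j * rr p ^ (j - 1))) (at p)"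
      using has_derivative_power[OF dr, of j] by (simp add: mult_ac)
    have jj: "real j * rr p ^ (j - 1) = real j * rr p ^ j / rr p" using r by (cases j) auto
    have rj: "rr p ^ j \<noteq> 0" using r by simp
    show ?thesis
    proof (rule has_derivative_eq_rhs[OF has_derivative_divide'[OF has_derivative_mult[OF de ds] dp rj]])
      show "(\<lambda>h. ((e p * (step (Suc k) (aa p / rr p) * ((pd aa h p * rr p - aa p * pd rr h p) / (rr p * rr p))) +
           pd e h p * step k (aa p / rr p)) * rr p ^ j - e p * step k (aa p / rr p) * (pd rr h p * real j * rr p ^ (j - 1)))
         / (rr p ^ j * rr p ^ j)) = (\<lambda>w. (pd e w p * step k (aa p / rr p) / rr p ^ j
      + e p * (pd aa w p * rr p - aa p * pd rr w p) * step (Suc k) (aa p / rr p) / rr p ^ (j + 2))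
    + e p * (- real j * pd rr w p) * step k (aa p / rr p) / rr p ^ (j + 1))"
        unfolding mult.assoc[of _ "real j"] jj using r
        by (simp add: fun_eq_iff field_simps power2_eq_square)
    qed
  qed
  have "pd ?f v p = ?f' p" for p
  proof (cases "rr p = 0")
    case True
    then have "A p = 0" by (simp add: rr_0)
    then show ?thesis using pd_eqI[OF flat_quot_flat_deriv(1)[OF f]] flat_quot_flat_deriv(2)[OF f'] by simp
  next
    case False
    show ?thesis by (rule pd_eqI[OF d[OF False]])
  qed
  then have e: "pd ?f v = ?f'" by (rule ext)
  have "?f differentiable at p" for p
  proof (cases "rr p = 0")
    case True
    then show ?thesis by (intro differentiableI[OF flat_quot_flat_deriv(1)[OF f]]) (simp add: rr_0)
  qed (rule differentiableI[OF d])
  then show ?case using f' e by simp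
next
  case (add f g)
  have e: "pd (\<lambda>p. f p + g p) v = (\<lambda>p. pd f v p + pd g v p)"
    by (rule ext) (rule pd_add, use add.IH in auto)
  show ?case unfolding e using add.IH by (auto intro: flat_quot.add differentiable_add)
qed

lemma flat_quot_pds: "flat_quot f \<Longrightarrow> flat_quot (pds ds f)"
  by (induction ds) (auto simp: pds_Cons flat_quot_pd)

lemma flat_quot_smooth: "flat_quot f \<Longrightarrow> smooth_on UNIV f"
  unfolding smooth_on_pds using flat_quot_pd[OF flat_quot_pds] by blast

end

lemma pds_mult_const:
  assumes "open U" "smooth_on U f" "smooth_on U m" "\<And>v q. v \<in> set ds \<Longrightarrow> q \<in> U \<Longrightarrow> pd m v q = 0" "p \<in> U"
  shows "pds ds (\<lambda>q. f q * m q) p = pds ds f p * m p"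
  using assms(4,5)
proof (induction ds arbitrary: p)
  case (Cons v ds)
  have "pd (pds ds (\<lambda>q. f q * m q)) v p = pd (\<lambda>q. pds ds f q * m q) v p"
    by (rule pd_cong_open[OF assms(1) Cons.prems(2)]) (rule Cons.IH, use Cons.prems(1) in auto)
  also have "\<dots> = pd (pds ds f) v p * m p + pds ds f p * pd m v p"
    by (rule pd_mult[OF smooth_on_diff[OF smooth_on_pds'[OF assms(2)] Cons.prems(2)]
      smooth_on_diff[OF assms(3) Cons.prems(2)]])
  finally show ?case using Cons.prems by (simp add: pds_Cons)
qed simp

lemma pd_step:
  assumes "c differentiable (at p)"
  shows "pd (\<lambda>q. step k (c q)) v p = step (Suc k) (c p) * pd c v p"
  by (rule pd_eqI, rule has_derivative_compose[where g = "step k" and f = c,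
      OF has_derivative_pd[OF assms] step_deriv[unfolded has_field_derivative_def]])

lemma pds_scale_dirs:
  assumes "smooth_on UNIV f"
  shows "pds (map (\<lambda>(s, v). a s *\<^sub>R v) zs) f p = prod_list (map (\<lambda>(s, v). a s) zs) * pds (map snd zs) f p"
  using assms
proof (induction zs arbitrary: f rule: rev_induct)
  case (snoc x zs)
  obtain s v where x: "x = (s, v)" by (cases x)
  let ?L = "map (\<lambda>(s, v). a s *\<^sub>R v) zs"
  have "pds (?L @ [a s *\<^sub>R v]) f p = a s * pds (?L @ [v]) f p"
    using pds_snoc_add[OF open_UNIV snoc.prems UNIV_I, of ?L "a s" v 0 0 p] by simp
  also have "pds (?L @ [v]) f p = prod_list (map (\<lambda>(s, v). a s) zs) * pds (map snd zs) (pd f v) p"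
    unfolding pds_snoc by (rule snoc.IH[OF smooth_on_pd[OF snoc.prems]])
  finally show ?case by (simp add: x pds_snoc)
qed simp

text \<open>Eigendirections stored with their weights. At a zero of \<open>A\<close> the flow scales
  the derivative along such a list by exp(l t), where l is the sum of the weights.\<close>

definition eigen_list :: "('n::finite pt \<Rightarrow> 'n pt) \<Rightarrow> (int \<times> 'n pt) list \<Rightarrow> bool" where
  "eigen_list A zs \<longleftrightarrow> (\<forall>(s, v) \<in> set zs. (s = 1 \<or> s = -1) \<and> A v = of_int s *\<^sub>R v)"

section \<open>Integration along the flow from infinity, and Taylor coefficients by weight\<close>

context hyperbolic
begin

definition bb :: "'n pt \<Rightarrow> real" where "bb p = (norm (pm p))\<^sup>2"
definition zz :: "'n pt \<Rightarrow> real" where "zz p = (norm (pz p))\<^sup>2"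

lemma smooth_bb: "smooth_on UNIV bb" and smooth_zz: "smooth_on UNIV zz"
  unfolding bb_def[abs_def] zz_def[abs_def] by (rule smooth_on_norm2(1)[OF lin_pm] smooth_on_norm2(1)[OF lin_pz])+

lemma rr_eq: "rr p = aa p + bb p" by (simp add: rr_def aa_def bb_def norm_A2)

lemma norm_eq: "(norm p)\<^sup>2 = aa p + bb p + zz p"
  using pz_orth[of p] by (simp add: zz_def norm_A2 aa_def bb_def)

lemma aa_hyp_flow: "aa (hyp_flow t p) = exp (2 * t) * aa p"
  by (simp add: aa_def pp_hyp_flow power_mult_distrib flip: exp_double)

lemma zz_hyp_flow [simp]: "zz (hyp_flow t p) = zz p" by (simp add: zz_def pz_hyp_flow)

lemma hyp_flow_fix: "A v = 0 \<Longrightarrow> hyp_flow t v = v"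
  by (simp add: hyp_flow_def eig_zero)

lemma flat_quot_weighted:
  assumes "flat_quot E"
  obtains C where "C \<ge> 0" "\<And>ds p. length ds = n \<Longrightarrow> \<bar>pds ds E p\<bar> \<le> C * prod_list (map norm ds) * aa p ^ N"
proof -
  have "\<exists>C. \<forall>p\<in>UNIV. \<bar>pds ds E p\<bar> \<le> C * aa p ^ N" for ds
    using flat_quot_bound[OF flat_quot_pds[OF assms], where N = N] by fastforce
  from pds_multilinear_bound[OF open_UNIV flat_quot_smooth[OF assms] this, of n]
  obtain C where C: "\<And>ds p. length ds = n \<Longrightarrow> \<bar>pds ds E p\<bar> \<le> C * prod_list (map norm ds) * aa p ^ N" by auto
  have "\<bar>pds ds E p\<bar> \<le> max C 0 * prod_list (map norm ds) * aa p ^ N" if "length ds = n" for ds p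
  proof -
    have "prod_list (map norm ds) \<ge> 0" by (induction ds) auto
    then have "C * prod_list (map norm ds) * aa p ^ N \<le> max C 0 * prod_list (map norm ds) * aa p ^ N"
      using aa_le_rr(1)[of p] by (intro mult_right_mono) auto
    then show ?thesis using C[OF that, of p] by linarith
  qed
  then show ?thesis by (intro that[of "max C 0"]) auto
qed

text \<open>Backward in time \<open>aa\<close> shrinks like exp(2 t), while n directions grow at
  most by exp(n |t|). A bound by the power n + 1 of \<open>aa\<close> therefore leaves exp((n + 2)
  t), which is integrable. The ball serves only to bound \<open>aa\<close> at time 0.\<close>

lemma half_line_family:
  assumes "flat_quot E"
  shows "param_family lborel (ball 0 R) (\<lambda>t p. indicator {..0} t * E (hyp_flow t p))"
proof (rule F.family[OF flat_quot_smooth[OF assms]])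
  show "indicator {..0} \<in> borel_measurable (borel :: real measure)" by measurable
  fix ds :: "'n pt list"
  let ?n = "length ds"
  obtain C where C: "C \<ge> 0" "\<And>es p. length es = ?n \<Longrightarrow> \<bar>pds es E p\<bar> \<le> C * prod_list (map norm es) * aa p ^ Suc ?n"
    using flat_quot_weighted[OF assms] by blast
  define D where "D = C * 3 ^ ?n * prod_list (map norm ds) * (R\<^sup>2) ^ Suc ?n"
  have pn: "prod_list (map norm ds) \<ge> 0" by (induction ds) auto
  have "\<bar>indicator {..0} t * pds (map (hyp_flow t) ds) E (hyp_flow t p)\<bar> \<le> D * exp (- \<bar>t\<bar>)" if p: "p \<in> ball 0 R" for t :: real and p
  proof (cases "t \<le> 0")
    case True
    have R: "aa p \<le> R\<^sup>2"
      using p norm_pp_le[of p] unfolding aa_def by (intro power_mono) auto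
    have "\<bar>pds (map (hyp_flow t) ds) E (hyp_flow t p)\<bar> \<le> C * prod_list (map norm (map (hyp_flow t) ds)) * aa (hyp_flow t p) ^ Suc ?n"
      by (rule C) simp
    also have "\<dots> \<le> C * (3 ^ ?n * exp (real ?n * \<bar>t\<bar>) * prod_list (map norm ds)) * (exp (2 * t) * R\<^sup>2) ^ Suc ?n"
      unfolding aa_hyp_flow using aa_le_rr(1)[of p] C(1) pn
      by (intro mult_mono mult_left_mono F.prod_list_flow power_mono R) auto
    also have "\<dots> = D * (exp (real ?n * \<bar>t\<bar>) * exp (2 * t) ^ Suc ?n)"
      unfolding D_def power_mult_distrib by (simp only: mult_ac)
    also have "exp (real ?n * \<bar>t\<bar>) * exp (2 * t) ^ Suc ?n = exp (real (?n + 2) * t)"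
      unfolding exp_of_nat_mult[symmetric] exp_add[symmetric] using True by (simp add: algebra_simps)
    also have "D * exp (real (?n + 2) * t) \<le> D * exp (- \<bar>t\<bar>)"
    proof -
      have "real (?n + 2) * t \<le> 1 * t" using True by (intro mult_right_mono_neg) auto
      moreover have "D \<ge> 0" unfolding D_def using C(1) pn by simp
      ultimately show ?thesis using True by (intro mult_left_mono) auto
    qed
    finally show ?thesis using True by simp
  next
    case False
    have "D \<ge> 0" unfolding D_def using C(1) pn by simp
    then show ?thesis using False by simp
  qed
  then show "\<exists>B. integrable lborel B \<and> (\<forall>t. \<forall>p\<in>ball 0 R. \<bar>indicator {..0} t * pds (map (hyp_flow t) ds) E (hyp_flow t p)\<bar> \<le> B t)"
    using integrable_exp_neg_abs by (intro exI[of _ "\<lambda>t. D * exp (- \<bar>t\<bar>)"]) auto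
qed simp

text \<open>\<open>u\<close> integrates \<open>E\<close> over the backward orbit, along which
  \<open>E\<close> tends to 0, so the fundamental theorem gives the equation. The last clause lets
  linear conditions on \<open>E\<close> that hold along whole orbits pass to
  \<open>u\<close>.\<close>

lemma half_line:
  assumes "flat_quot E"
  obtains u where "smooth_on UNIV u" "\<And>p. pd u (A p) p = E p"
    "\<And>ds p. (\<And>t. pds (map (hyp_flow t) ds) E (hyp_flow t p) = 0) \<Longrightarrow> pds ds u p = 0"
proof -
  note sE = flat_quot_smooth[OF assms]
  define u where "u p = (\<integral>t. indicator {..0} t * E (hyp_flow t p) \<partial>lborel)" for p
  have pb: "p \<in> ball 0 (norm p + 1)" for p :: "'n pt" by simp
  have pds_u: "pds ds u p = (\<integral>t. indicator {..0} t * pds (map (hyp_flow t) ds) E (hyp_flow t p) \<partial>lborel)" for ds p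
    using param_family.pds_integral[OF half_line_family[OF assms] pb, of ds p]
    unfolding F.pds_flow(1)[OF sE] u_def[abs_def] .
  have su: "smooth_on UNIV u"
  proof (rule smooth_on_UN)
    fix p :: "'n pt"
    show "\<exists>V. p \<in> V \<and> smooth_on V u"
      using param_family.smooth_integral[OF half_line_family[OF assms]] pb unfolding u_def[abs_def] by blast
  qed
  have "pd u (A p) p = E p" for p
  proof -
    let ?h = "\<lambda>t. pd E (A (hyp_flow t p)) (hyp_flow t p)"
    have "pd u (A p) p = (\<integral>t. indicator {..0} t * ?h t \<partial>lborel)"
      using pds_u[of "[A p]" p] by (simp add: pds_Cons F.commA)
    also have "\<dots> = (\<integral>t. indicator {..<0} t * ?h t \<partial>lborel)"
    proof (rule integral_cong_AE)
      have m: "?h \<in> borel_measurable borel"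
        by (intro borel_measurable_continuous_onI continuous_at_imp_continuous_on ballI F.isCont_orbit_deriv sE)
      then show "(\<lambda>t. indicator {..0} t * ?h t) \<in> borel_measurable lborel"
        "(\<lambda>t. indicator {..<0} t * ?h t) \<in> borel_measurable lborel" by measurable
      have "AE t in lborel. t \<noteq> (0::real)" by (rule AE_lborel_singleton)
      then show "AE t in lborel. indicator {..0} t * ?h t = indicator {..<0} t * ?h t"
        by eventually_elim (auto simp: indicator_def)
    qed
    also have "\<dots> = (LBINT t=-\<infinity>..ereal 0. ?h t)"
      by (simp add: interval_lebesgue_integral_def set_lebesgue_integral_def einterval_def lessThan_def)
    also have "\<dots> = E (hyp_flow 0 p) - 0"
    proof (rule interval_integral_FTC_integrable)
      show "((\<lambda>t. E (hyp_flow t p)) has_vector_derivative ?h t) (at t)" for t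
        using F.orbit_deriv[OF sE] by (simp add: has_real_derivative_iff_has_vector_derivative)
      show "isCont ?h t" for t by (rule F.isCont_orbit_deriv[OF sE])
      have "integrable lborel (\<lambda>t. indicator {..0} t * pds (map (hyp_flow t) [A p]) E (hyp_flow t p))"
        using param_family.integrable[OF half_line_family[OF assms] pb, of "[A p]" p]
        unfolding F.pds_flow(1)[OF sE] .
      then have "integrable lborel (\<lambda>t. indicator {..0} t * ?h t)" by (simp add: pds_Cons F.commA)
      then have "set_integrable lborel {..0} ?h" by (simp add: set_integrable_def)
      then show "set_integrable lborel (einterval (-\<infinity>) (ereal 0)) ?h"
        by (rule set_integrable_subset) (auto simp: einterval_def)
      obtain C where C: "C \<ge> 0" "\<And>q. \<bar>E q\<bar> \<le> C * aa q ^ 1" using flat_quot_bound[OF assms] by blast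
      have b: "norm (E (hyp_flow t p)) \<le> C * (exp (2 * t) * aa p)" for t
        using C(2)[of "hyp_flow t p"] by (simp add: aa_hyp_flow)
      have "((\<lambda>t::real. exp (2 * t)) \<longlongrightarrow> 0) at_bot" by real_asymp
      then have "((\<lambda>t. C * (exp (2 * t) * aa p)) \<longlongrightarrow> 0) at_bot"
        by (intro tendsto_mult_right_zero tendsto_mult_left_zero)
      then have "((\<lambda>t. E (hyp_flow t p)) \<longlongrightarrow> 0) at_bot"
        by (rule Lim_null_comparison[OF always_eventually[OF allI[OF b]]])
      then show "(((\<lambda>t. E (hyp_flow t p)) \<circ> real_of_ereal) \<longlongrightarrow> 0) (at_right (-\<infinity>))"
        by (simp add: ereal_tendsto_simps)
      have "isCont (\<lambda>t. E (hyp_flow t p)) 0" using F.orbit_deriv[OF sE] by (rule DERIV_isCont)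
      then show "(((\<lambda>t. E (hyp_flow t p)) \<circ> real_of_ereal) \<longlongrightarrow> E (hyp_flow 0 p)) (at_left (ereal 0))"
        unfolding ereal_tendsto_simps isCont_def by (rule tendsto_mono[rotated]) (simp add: at_le)
    qed simp
    finally show ?thesis by (simp add: F.zero)
  qed
  moreover have "pds ds u p = 0" if "\<And>t. pds (map (hyp_flow t) ds) E (hyp_flow t p) = 0" for ds p
    unfolding pds_u that by simp
  ultimately show ?thesis using su that by blast
qed

lemma T_pds_0:
  assumes "superexp w" "bdd_smooth G" "\<And>t. pds (map (hyp_flow t) ds) G (hyp_flow t p) = 0"
  shows "pds ds (F.T w G) p = 0"
  unfolding F.T_pds[OF assms(1,2)] assms(3) by simp

lemma hyp_flow_eigen_list: "eigen_list A zs \<Longrightarrow> map (hyp_flow t) (map snd zs) = map (\<lambda>(s, v). exp (of_int s * t) *\<^sub>R v) zs"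
proof (induction zs)
  case (Cons x zs)
  obtain s v where x: "x = (s, v)" by (cases x)
  have "s = 1 \<or> s = -1" "A v = of_int s *\<^sub>R v" using Cons.prems by (auto simp: eigen_list_def x)
  then have "hyp_flow t v = exp (of_int s * t) *\<^sub>R v"
    by (auto simp: hyp_flow_def eig_plus eig_minus)
  then show ?case using Cons by (simp add: x eigen_list_def)
qed simp

lemma prod_list_exp: "prod_list (map (\<lambda>(s, v). exp (of_int s * t :: real)) zs) = exp (of_int (sum_list (map fst zs)) * t)"
  by (induction zs) (auto simp: exp_add[symmetric] algebra_simps)

text \<open>A zero of \<open>A\<close> is fixed by the flow and the eigendirections are only
  rescaled, so averaging acts on a coefficient of weight l as multiplication by a number, the l-th
  exponential moment of \<open>w\<close>.\<close>

lemma T_pds_eigen_list: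
  assumes "superexp w" "bdd_smooth G" "eigen_list A zs" "A p = 0"
  shows "pds (map snd zs) (F.T w G) p
    = (\<integral>t. w t * exp (of_int (sum_list (map fst zs)) * t) \<partial>lborel) * pds (map snd zs) G p"
proof -
  have "pds (map (hyp_flow t) (map snd zs)) G (hyp_flow t p) = exp (of_int (sum_list (map fst zs)) * t) * pds (map snd zs) G p" for t
    unfolding hyp_flow_eigen_list[OF assms(3)] pds_scale_dirs[OF bdd_smooth_smooth[OF assms(2)]] prod_list_exp
    by (simp add: hyp_flow_fix[OF assms(4)])
  then show ?thesis unfolding F.T_pds[OF assms(1,2)]
    by (simp only: mult.assoc[symmetric] integral_mult_left_zero)
qed

text \<open>Vanishing of the derivatives in eigendirections suffices: the remaining directions are tangent to the
  zero set of \<^term>\<open>A\<close>.\<close>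

lemma pd_tangent:
  assumes "smooth_on UNIV f" "\<And>q. A q = 0 \<Longrightarrow> (norm q)\<^sup>2 < \<epsilon> \<Longrightarrow> f q = 0" "A v = 0" "A p = 0" "(norm p)\<^sup>2 < \<epsilon>"
  shows "pd f v p = 0"
proof -
  have "((\<lambda>s. f (p + s *\<^sub>R v)) has_real_derivative pd f v (p + 0 *\<^sub>R v)) (at 0)"
    by (rule has_derivative_line[OF smooth_on_diff[OF assms(1) UNIV_I]])
  moreover have "((\<lambda>s. f (p + s *\<^sub>R v)) has_real_derivative 0) (at 0)"
  proof (rule has_field_derivative_transform_within_open[of "\<lambda>s. 0" _ _ "{s. (norm (p + s *\<^sub>R v))\<^sup>2 < \<epsilon>}"])
    show "open {s. (norm (p + s *\<^sub>R v))\<^sup>2 < \<epsilon>}" by (intro open_Collect_less continuous_intros)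
  qed (use assms in \<open>auto simp: A_simps\<close>)
  ultimately show ?thesis using DERIV_unique by fastforce
qed

lemma flat_from_eigen_list:
  assumes "\<And>zs p. eigen_list A zs \<Longrightarrow> A p = 0 \<Longrightarrow> (norm p)\<^sup>2 < \<epsilon> \<Longrightarrow> pds (map snd zs) f p = 0"
    and "smooth_on UNIV f" "A p = 0" "(norm p)\<^sup>2 < \<epsilon>"
  shows "pds ds f p = 0"
  using assms(1,2)
proof (induction ds arbitrary: f rule: rev_induct)
  case Nil
  from Nil(1)[of "[]", OF _ assms(3,4)] show ?case by (simp add: eigen_list_def)
next
  case (snoc v ds)
  note s = snoc.prems(2)
  show ?case unfolding pds_snoc
  proof (rule snoc.IH[OF _ smooth_on_pd[OF s]])
    fix zs q assume zs: "eigen_list A zs" and q: "A q = 0" "(norm q)\<^sup>2 < \<epsilon>"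
    let ?L = "map snd zs"
    have v: "v = 1 *\<^sub>R (1 *\<^sub>R pp v + 1 *\<^sub>R pm v) + 1 *\<^sub>R pz v" by (simp add: decomp)
    have "pds (?L @ [v]) f q = pds (?L @ [pp v]) f q + pds (?L @ [pm v]) f q + pds (?L @ [pz v]) f q"
      by (subst v, simp only: pds_snoc_add[OF open_UNIV s UNIV_I]) simp
    moreover have "eigen_list A (zs @ [(1, pp v)])" "eigen_list A (zs @ [(-1, pm v)])"
      using zs by (auto simp: eigen_list_def A_pp A_pm)
    from snoc.prems(1)[OF this(1) q] snoc.prems(1)[OF this(2) q]
    have "pds (?L @ [pp v]) f q = 0" "pds (?L @ [pm v]) f q = 0" by simp_all
    moreover have "pds (?L @ [pz v]) f q = 0"
      \<comment> \<open>Symmetry of second derivatives moves the tangential direction to the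
        outside, where it differentiates a function already known to vanish on the zero set near
        0.\<close>
      unfolding pds_snoc pds_pd_commute[OF open_UNIV s UNIV_I]
      by (rule pd_tangent[OF smooth_on_pds'[OF s] snoc.prems(1)[OF zs] A_pz q])
    ultimately show "pds ?L (pd f v) q = 0" by (simp add: pds_snoc)
  qed
qed

end

section \<open>Cutoffs, and the local solution operator of a hyperbolic field\<close>

lemma smooth_n_inverse:
  assumes "open U" "\<And>p. p \<in> U \<Longrightarrow> g p \<noteq> 0"
  shows "smooth_n n U g \<Longrightarrow> smooth_n n U (\<lambda>p. inverse (g p))"
proof (induction n)
  case (Suc n)
  have g: "\<And>p. p \<in> U \<Longrightarrow> g differentiable at p" "\<And>v. smooth_n n U (pd g v)" "smooth_n n U g"
    using Suc.prems smooth_n_SucD unfolding smooth_n_Suc by blast+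
  have d: "((\<lambda>p. inverse (g p)) has_derivative (\<lambda>v. - (inverse (g p) * pd g v p * inverse (g p)))) (at p)"
    if "p \<in> U" for p
    by (rule Deriv.has_derivative_inverse[OF assms(2)[OF that] has_derivative_pd[OF g(1)[OF that]]])
  have s: "smooth_n n U (\<lambda>p. (-1) * (inverse (g p) * pd g v p * inverse (g p)))" for v
    by (intro smooth_n_mult[OF assms(1)] smooth_n_const Suc.IH g)
  have "smooth_n n U (pd (\<lambda>p. inverse (g p)) v)" for v
    by (rule smooth_n_cong[OF assms(1) _ s[of v]]) (simp add: pd_eqI[OF d])
  then show ?case unfolding smooth_n_Suc using differentiableI[OF d] by simp
qed simp

lemma smooth_on_divide:
  assumes "open U" "smooth_on U f" "smooth_on U g" "\<And>p. p \<in> U \<Longrightarrow> g p \<noteq> 0"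
  shows "smooth_on U (\<lambda>p. f p / g p)"
  unfolding divide_inverse
  by (rule smooth_on_mult[OF assms(1,2)]) (use smooth_n_inverse[OF assms(1,4)] assms(3) in \<open>simp add: smooth_on_smooth_n\<close>)

lemma pd_divide:
  assumes "f differentiable (at p)" "g differentiable (at p)" "g p \<noteq> 0"
  shows "pd (\<lambda>p. f p / g p) v p = (pd f v p * g p - f p * pd g v p) / (g p * g p)"
  by (rule pd_eqI[OF has_derivative_divide'[OF has_derivative_pd[OF assms(1)] has_derivative_pd[OF assms(2)] assms(3)]])

lemma smooth_on_step: "open U \<Longrightarrow> smooth_on U c \<Longrightarrow> smooth_on U (\<lambda>p. step k (c p))"
  by (rule smooth_on_compose_real[where F = step, OF step_deriv])

context hyperbolic
begin

text \<open>A substitute for being a function of \<open>aa\<close> and \<open>bb\<close>, stated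
  through derivatives so that closure under arithmetic and under \<open>step\<close> needs no
  factorisation through these two functions.\<close>

definition ab_invariant :: "'n pt set \<Rightarrow> ('n pt \<Rightarrow> real) \<Rightarrow> bool" where
  "ab_invariant U m \<longleftrightarrow> smooth_on U m \<and> (\<forall>q\<in>U. \<forall>v. pd aa v q = 0 \<longrightarrow> pd bb v q = 0 \<longrightarrow> pd m v q = 0)"

text \<open>Direction fields along which multiplication by functions of \<^term>\<open>aa\<close> and \<^term>\<open>bb\<close>, such as the cutoffs, commutes with
  differentiation. Both the other fields of a commuting family and the eigenvectors of another hyperbolic field are of this
  kind.\<close>

definition compatible :: "('n pt \<Rightarrow> 'n pt list) \<Rightarrow> bool" where
  "compatible ds \<longleftrightarrow> (\<forall>U f m p. open U \<longrightarrow> p \<in> U \<longrightarrow> smooth_on U f \<longrightarrow> ab_invariant U m \<longrightarrow>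
      pds (ds p) (\<lambda>q. f q * m q) p = pds (ds p) f p * m p)
    \<and> (\<forall>t p. ds (hyp_flow t p) = map (hyp_flow t) (ds p))"

lemma invD: "ab_invariant U m \<Longrightarrow> q \<in> U \<Longrightarrow> pd aa v q = 0 \<Longrightarrow> pd bb v q = 0 \<Longrightarrow> pd m v q = 0"
  and ab_invariant_smooth: "ab_invariant U m \<Longrightarrow> smooth_on U m"
  and ab_invariant_diff: "ab_invariant U m \<Longrightarrow> q \<in> U \<Longrightarrow> m differentiable at q"
  unfolding ab_invariant_def by (blast intro: smooth_on_diff)+

lemma ab_invariant_mono: "ab_invariant U m \<Longrightarrow> V \<subseteq> U \<Longrightarrow> ab_invariant V m"
  unfolding ab_invariant_def using smooth_on_subset by blast

lemma ab_invariant_aa: "ab_invariant UNIV aa" and ab_invariant_bb: "ab_invariant UNIV bb" and ab_invariant_const: "ab_invariant U (\<lambda>p. c)"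
  unfolding ab_invariant_def by (simp_all add: smooth_aa smooth_bb)

lemma ab_invariant_step: "open U \<Longrightarrow> ab_invariant U c \<Longrightarrow> ab_invariant U (\<lambda>p. step k (c p))"
  unfolding ab_invariant_def[of U "\<lambda>p. step k (c p)"]
  by (simp add: smooth_on_step ab_invariant_smooth pd_step[OF ab_invariant_diff] invD)

lemma ab_invariant_mult: "open U \<Longrightarrow> ab_invariant U f \<Longrightarrow> ab_invariant U g \<Longrightarrow> ab_invariant U (\<lambda>p. f p * g p)"
  unfolding ab_invariant_def[of U "\<lambda>p. f p * g p"]
  by (simp add: smooth_on_mult ab_invariant_smooth pd_mult[OF ab_invariant_diff ab_invariant_diff] invD)

lemma ab_invariant_diff': "open U \<Longrightarrow> ab_invariant U f \<Longrightarrow> ab_invariant U g \<Longrightarrow> ab_invariant U (\<lambda>p. f p - g p)"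
  unfolding ab_invariant_def[of U "\<lambda>p. f p - g p"]
  by (simp add: smooth_on_minus ab_invariant_smooth pd_diff[OF ab_invariant_diff ab_invariant_diff] invD)

lemma ab_invariant_add: "open U \<Longrightarrow> ab_invariant U f \<Longrightarrow> ab_invariant U g \<Longrightarrow> ab_invariant U (\<lambda>p. f p + g p)"
  unfolding ab_invariant_def[of U "\<lambda>p. f p + g p"]
  by (simp add: smooth_on_add ab_invariant_smooth pd_add[OF ab_invariant_diff ab_invariant_diff] invD)

lemma ab_invariant_divide:
  "open U \<Longrightarrow> ab_invariant U f \<Longrightarrow> ab_invariant U g \<Longrightarrow> (\<And>p. p \<in> U \<Longrightarrow> g p \<noteq> 0) \<Longrightarrow> ab_invariant U (\<lambda>p. f p / g p)"
  unfolding ab_invariant_def[of U "\<lambda>p. f p / g p"]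
  by (simp add: smooth_on_divide ab_invariant_smooth pd_divide[OF ab_invariant_diff ab_invariant_diff] invD)

lemma ab_invariant_rr: "ab_invariant UNIV rr"
  unfolding rr_eq[abs_def] by (intro ab_invariant_add open_UNIV ab_invariant_aa ab_invariant_bb)

lemma open_lt: "smooth_on UNIV f \<Longrightarrow> open {p. f p < c}" "smooth_on UNIV f \<Longrightarrow> open {p. c < f p}"
  and open_ne: "smooth_on UNIV f \<Longrightarrow> open {p. f p \<noteq> c}"
proof -
  assume f: "smooth_on UNIV f"
  have c: "continuous_on UNIV f"
    using smooth_on_cont[OF f UNIV_I, where ds = "[]"] by (intro continuous_at_imp_continuous_on) simp
  show "open {p. f p < c}" "open {p. c < f p}" by (intro open_Collect_less c continuous_on_const)+
  show "open {p. f p \<noteq> c}" by (intro open_Collect_neq c continuous_on_const)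
qed

lemma flat_quot_pds_0: "flat_quot f \<Longrightarrow> A p = 0 \<Longrightarrow> pds ds f p = 0"
  by (rule flat_quot_flat_deriv(2)[OF flat_quot_pds])

text \<open>Passing to the negative field reverses time and swaps \<open>aa\<close> with
  \<open>bb\<close>; results on backward orbits then apply to forward orbits.\<close>

lemma neg_hyperbolic: "hyperbolic (\<lambda>p. - A p)"
  by (rule hyperbolic.intro) (simp_all add: linA linear_compose_neg A_simps cube selfadj)

lemma neg_simps: "hyperbolic.pp (\<lambda>p. - A p) = pm" "hyperbolic.pm (\<lambda>p. - A p) = pp" "hyperbolic.pz (\<lambda>p. - A p) = pz"
  unfolding hyperbolic.pp_def[OF neg_hyperbolic, abs_def] hyperbolic.pm_def[OF neg_hyperbolic, abs_def] hyperbolic.pz_def[OF neg_hyperbolic, abs_def]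
    pm_def[abs_def] pp_def[abs_def] pz_def[abs_def] by (simp_all add: A_simps)

lemma neg_aa: "hyperbolic.aa (\<lambda>p. - A p) = bb" "hyperbolic.rr (\<lambda>p. - A p) = rr" "hyperbolic.hyp_flow (\<lambda>p. - A p) t = hyp_flow (- t)"
  "hyperbolic.flat (\<lambda>p. - A p) = flat"
  unfolding hyperbolic.aa_def[OF neg_hyperbolic, abs_def] hyperbolic.rr_def[OF neg_hyperbolic, abs_def] hyperbolic.hyp_flow_def[OF neg_hyperbolic, abs_def]
    hyperbolic.flat_def[OF neg_hyperbolic, abs_def] neg_simps bb_def[abs_def] rr_def[abs_def] hyp_flow_def[abs_def] flat_def[abs_def]
  by (simp_all add: add.commute)

text \<open>Splitting a flat right-hand side by the degree 0 homogeneous cutoff \<open>a / (a + b)\<close> leaves pieces that decay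
  along the flow in one time direction each.\<close>

lemma solve_flat:
  assumes "cpt_smooth e" "flat e"
  obtains u E1 E2 where "smooth_on UNIV u" "\<And>p. pd u (A p) p = e p" "flat_quot E1" "hyperbolic.flat_quot (\<lambda>p. - A p) E2"
    "E1 = (\<lambda>p. e p * step 0 (aa p / rr p))" "E2 = (\<lambda>p. e p * step 0 (bb p / rr p))"
    "\<And>ds p. (\<And>t. pds (map (hyp_flow t) ds) E1 (hyp_flow t p) = 0) \<Longrightarrow> (\<And>t. pds (map (hyp_flow t) ds) E2 (hyp_flow t p) = 0)
      \<Longrightarrow> pds ds u p = 0"
proof -
  define E1 where "E1 = (\<lambda>p. e p * step 0 (aa p / rr p))"
  define E2 where "E2 = (\<lambda>p. e p * step 0 (bb p / rr p))"
  have f1: "flat_quot E1" using flat_quot.base[OF assms, of 0 0] by (simp add: E1_def)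
  have f2: "hyperbolic.flat_quot (\<lambda>p. - A p) E2"
    using hyperbolic.flat_quot.base[OF neg_hyperbolic assms(1), of 0 0] assms(2) by (simp add: E2_def neg_aa)
  obtain u1 where u1: "smooth_on UNIV u1" "\<And>p. pd u1 (A p) p = E1 p"
    "\<And>ds p. (\<And>t. pds (map (hyp_flow t) ds) E1 (hyp_flow t p) = 0) \<Longrightarrow> pds ds u1 p = 0"
    using half_line[OF f1] by blast
  obtain u2 where u2: "smooth_on UNIV u2" "\<And>p. pd u2 (- A p) p = E2 p"
    "\<And>ds p. (\<And>t. pds (map (hyp_flow (- t)) ds) E2 (hyp_flow (- t) p) = 0) \<Longrightarrow> pds ds u2 p = 0"
    using hyperbolic.half_line[OF neg_hyperbolic f2, unfolded neg_aa] by blast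
  have s: "smooth_on UNIV (\<lambda>p. u1 p - u2 p)" by (intro smooth_on_minus open_UNIV u1 u2)
  have d: "pd (\<lambda>p. u1 p - u2 p) (A p) p = e p" for p
  proof -
    have "pd u2 (A p) p = - E2 p"
      using u2(2)[of p] linear_neg[OF pd_linear[OF smooth_on_diff[OF u2(1) UNIV_I]]] by simp
    then have "pd (\<lambda>p. u1 p - u2 p) (A p) p = E1 p + E2 p"
      using pd_diff[OF smooth_on_diff[OF u1(1) UNIV_I] smooth_on_diff[OF u2(1) UNIV_I]] u1(2) by simp
    also have "\<dots> = e p"
    proof (cases "rr p = 0")
      case True
      then show ?thesis using flat_0[OF assms(2)] rr_0 by (simp add: E1_def E2_def)
    next
      case False
      \<comment> \<open>The two arguments of the step function add up to 1, so by
        \<open>step_sym\<close> the pieces add up to \<open>e\<close>.\<close>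
      then have b: "bb p / rr p = 1 - aa p / rr p" by (simp add: rr_eq field_simps)
      show ?thesis unfolding E1_def E2_def b distrib_left[symmetric] step_sym by simp
    qed
    finally show ?thesis .
  qed
  have z: "pds ds (\<lambda>p. u1 p - u2 p) p = 0"
    if "\<And>t. pds (map (hyp_flow t) ds) E1 (hyp_flow t p) = 0" "\<And>t. pds (map (hyp_flow t) ds) E2 (hyp_flow t p) = 0" for ds p
    unfolding pds_minus[OF open_UNIV u1(1) u2(1) UNIV_I] using u1(3)[OF that(1)] u2(3)[OF that(2)] by simp
  show ?thesis by (rule that[OF s d f1 f2 E1_def E2_def z])
qed

text \<open>The solution is the \<open>solve_kernel\<close> average of the cut-off \<open>r\<close>
  plus a solution for the flat error. The cutoffs vanish unless the three parts of the squared norm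
  are below \<open>\<epsilon>\<close>, whence \<open>3 * \<epsilon>\<close>, and equal 1 where these
  are below \<open>\<epsilon> / 3\<close>. The last two clauses transfer conditions from
  \<open>r\<close> to \<open>y\<close>; \<open>Q\<close> allows conditions known only on a set that
  the flow preserves.\<close>

theorem solve:
  assumes r: "cpt_smooth r" and \<epsilon>: "0 < \<epsilon>"
    and nonresonant: "\<And>zs p. eigen_list A zs \<Longrightarrow> sum_list (map fst zs) = 0 \<Longrightarrow> A p = 0 \<Longrightarrow> (norm p)\<^sup>2 < 3 * \<epsilon>
      \<Longrightarrow> pds (map snd zs) r p = 0"
  obtains y where "smooth_on UNIV y" "\<And>p. (norm p)\<^sup>2 < \<epsilon> / 3 \<Longrightarrow> pd y (A p) p = r p"
    "\<And>ds Q p. compatible ds \<Longrightarrow> (\<And>t p. Q p \<Longrightarrow> Q (hyp_flow t p))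
      \<Longrightarrow> (\<And>q. (norm q)\<^sup>2 < 3 * \<epsilon> \<Longrightarrow> Q q \<Longrightarrow> pds (ds q) r q = 0)
      \<Longrightarrow> Q p \<Longrightarrow> (norm p)\<^sup>2 < \<epsilon> / 3 \<Longrightarrow> pds (ds p) y p = 0"
    "\<And>zs p. eigen_list A zs \<Longrightarrow> sum_list (map fst zs) = 0 \<Longrightarrow> A p = 0 \<Longrightarrow> (norm p)\<^sup>2 < \<epsilon> / 3
      \<Longrightarrow> pds (map snd zs) y p = 0"
proof -
  \<comment> \<open>\<open>chi\<close> must respect compatible directions, so it depends on
    \<open>aa\<close> and \<open>bb\<close> only. On the tube where \<open>zz\<close> is below
    \<open>\<epsilon>\<close>, which the flow preserves, it confines \<open>r\<close> to the region
    where the hypotheses hold.\<close>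
  define chi where "chi p = step 0 (1 - aa p / \<epsilon>) * step 0 (1 - bb p / \<epsilon>)" for p
  \<comment> \<open>\<open>zeta\<close> makes the flat error compactly supported and removes the
    zeros of \<open>A\<close> far from 0, where \<open>r\<close> is not controlled. It need not
    respect compatible directions: it equals 1 on a tube that the flow preserves.\<close>
  define zeta where "zeta p = step 0 (1 - zz p / \<epsilon>)" for p
  have ichi: "ab_invariant UNIV chi"
    unfolding chi_def[abs_def] using \<epsilon>
    by (intro ab_invariant_mult ab_invariant_step ab_invariant_diff' ab_invariant_divide ab_invariant_const ab_invariant_aa ab_invariant_bb open_UNIV) auto
  note schi = ab_invariant_smooth[OF ichi]
  have szeta: "smooth_on UNIV zeta"
    unfolding zeta_def[abs_def] using \<epsilon>
    by (intro smooth_on_step smooth_on_minus smooth_on_divide smooth_on_const smooth_zz open_UNIV) auto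
  have chi_ne: "aa p < \<epsilon> \<and> bb p < \<epsilon>" if "chi p \<noteq> 0" for p
  proof (rule ccontr)
    assume "\<not> ?thesis"
    then have "1 - aa p / \<epsilon> < 1/3 \<or> 1 - bb p / \<epsilon> < 1/3" using \<epsilon> by (auto simp: field_simps)
    then show False using that step_0 by (auto simp: chi_def)
  qed
  have chi_1: "chi p = 1" if "aa p < \<epsilon> / 3" "bb p < \<epsilon> / 3" for p
    using that \<epsilon> by (simp add: chi_def step_1 field_simps)
  have zeta_1: "zeta p = 1" if "zz p < \<epsilon> / 3" for p
    using that \<epsilon> by (simp add: zeta_def step_1 field_simps)
  have zeta_0: "zeta p = 0" if "2 * \<epsilon> / 3 < zz p" for p
    using that \<epsilon> by (simp add: zeta_def step_0 field_simps)
  have nn: "0 \<le> aa p" "0 \<le> bb p" "0 \<le> zz p" for p by (simp_all add: aa_def bb_def zz_def)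
  define G where "G q = r q * chi q" for q
  have csG: "cpt_smooth G" unfolding G_def[abs_def] by (rule cpt_smooth_mult[OF r schi])
  note bdG = cpt_smooth_bdd_smooth[OF csG]
  define T where "T = F.T proj_kernel G"
  define u1 where "u1 = F.T solve_kernel G"
  have bdT: "bdd_smooth T" unfolding T_def by (rule F.T_bdd_smooth[OF superexp_proj_kernel bdG])
  have su1: "smooth_on UNIV u1" unfolding u1_def by (rule bdd_smooth_smooth[OF F.T_bdd_smooth[OF superexp_solve_kernel bdG]])
  \<comment> \<open>On the zero set of \<open>A\<close> both \<open>aa\<close> and \<open>bb\<close>
    vanish, so \<open>chi\<close> is 1 around each of its points, however far from 0.\<close>
  have G_near: "pds ds G p = pds ds r p" if p: "A p = 0" for ds p
  proof (rule pds_cong_open)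
    show "open ({q. aa q < \<epsilon> / 3} \<inter> {q. bb q < \<epsilon> / 3})" by (intro open_Int open_lt smooth_aa smooth_bb)
    show "p \<in> {q. aa q < \<epsilon> / 3} \<inter> {q. bb q < \<epsilon> / 3}"
      using p \<epsilon> by (simp add: aa_def bb_def eig_zero)
  qed (simp add: G_def chi_1)
  define e where "e q = T q * (chi q * zeta q)" for q
  have cscz: "cpt_smooth (\<lambda>q. chi q * zeta q)"
    unfolding cpt_smooth_def
  proof (intro conjI exI allI impI)
    show "smooth_on UNIV (\<lambda>q. chi q * zeta q)" by (intro smooth_on_mult open_UNIV schi szeta)
    fix q :: "'n pt" assume q: "sqrt (3 * \<epsilon>) < norm q"
    have "3 * \<epsilon> < (norm q)\<^sup>2"
      using power_strict_mono[OF q, of 2] \<epsilon> by simp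
    then have "\<not> (aa q < \<epsilon> \<and> bb q < \<epsilon>) \<or> 2 * \<epsilon> / 3 < zz q" unfolding norm_eq using \<epsilon> by auto
    then show "chi q * zeta q = 0" using chi_ne[of q] zeta_0[of q] by auto
  qed
  have cse: "cpt_smooth e"
    unfolding e_def[abs_def] by (subst mult.commute) (rule cpt_smooth_mult[OF cscz bdd_smooth_smooth[OF bdT]])
  have flat_e: "flat e"
    unfolding flat_def
  proof (intro allI impI)
    fix ds p assume p: "A p = 0"
    have zp: "zz p = (norm p)\<^sup>2" using p by (simp add: zz_def eig_zero)
    show "pds ds e p = 0"
    proof (cases "(norm p)\<^sup>2 < \<epsilon>")
      case True
      have "pds ds T p = 0" for ds
      proof (rule flat_from_eigen_list[OF _ bdd_smooth_smooth[OF bdT] p True])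
        fix zs q assume zs: "eigen_list A zs" and q: "A q = 0" "(norm q)\<^sup>2 < \<epsilon>"
        show "pds (map snd zs) T q = 0"
          unfolding T_def T_pds_eigen_list[OF superexp_proj_kernel bdG zs q(1)]
          using proj_kernel_moment[of "sum_list (map fst zs)"] nonresonant[OF zs _ q(1)] q(2) \<epsilon>
          by (cases "sum_list (map fst zs) = 0") (simp_all add: G_near[OF q(1)])
      qed
      then show ?thesis unfolding e_def[abs_def]
        by (rule flat_point_mult[OF bdd_smooth_smooth[OF bdT] cpt_smooth_smooth[OF cscz]])
    next
      case False
      have "pds ds e p = pds ds (\<lambda>q. 0) p"
      proof (rule pds_cong_open[of "{q. 2 * \<epsilon> / 3 < zz q}"])
        show "open {q. 2 * \<epsilon> / 3 < zz q}" by (rule open_lt[OF smooth_zz])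
      qed (use False \<epsilon> zp in \<open>auto simp: e_def zeta_0\<close>)
      then show ?thesis by simp
    qed
  qed
  obtain u E1 E2 where u: "smooth_on UNIV u" "\<And>p. pd u (A p) p = e p" and ft1: "flat_quot E1" and ft2: "hyperbolic.flat_quot (\<lambda>p. - A p) E2"
    and E1: "E1 = (\<lambda>p. e p * step 0 (aa p / rr p))" and E2: "E2 = (\<lambda>p. e p * step 0 (bb p / rr p))"
    and u0: "\<And>ds p. (\<And>t. pds (map (hyp_flow t) ds) E1 (hyp_flow t p) = 0) \<Longrightarrow> (\<And>t. pds (map (hyp_flow t) ds) E2 (hyp_flow t p) = 0)
      \<Longrightarrow> pds ds u p = 0"
    apply (rule solve_flat[OF cse flat_e])
    subgoal premises prems for u E1 E2 using prems(2-8) by (rule prems(1))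
    done
  have E_0: "pds ds E1 p = 0" "pds ds E2 p = 0" if "A p = 0" for ds p
    using flat_quot_pds_0[OF ft1 that] hyperbolic.flat_quot_pds_0[OF neg_hyperbolic ft2] that by simp_all
  show ?thesis
  \<comment> \<open>The derivatives along \<open>A\<close> are \<open>G - T\<close> and
    \<open>e\<close>; near 0 the cutoffs are 1, so \<open>e\<close> cancels \<open>T\<close> and
    \<open>G\<close> is \<open>r\<close>.\<close>
  proof (rule that[of "\<lambda>p. u1 p + u p"])
    show "smooth_on UNIV (\<lambda>p. u1 p + u p)" by (intro smooth_on_add open_UNIV su1 u)
    show "pd (\<lambda>p. u1 p + u p) (A p) p = r p" if p: "(norm p)\<^sup>2 < \<epsilon> / 3" for p
    proof -
      have s: "aa p < \<epsilon> / 3" "bb p < \<epsilon> / 3" "zz p < \<epsilon> / 3" using p nn[of p] unfolding norm_eq by linarith+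
      have "pd (\<lambda>p. u1 p + u p) (A p) p = (G p - T p) + e p"
        using pd_add[OF smooth_on_diff[OF su1 UNIV_I] smooth_on_diff[OF u(1) UNIV_I], of "A p"]
          F.T_solve_kernel[OF bdG, of p] u(2)[of p] by (simp add: u1_def T_def)
      then show ?thesis by (simp add: G_def e_def chi_1[OF s(1,2)] zeta_1[OF s(3)])
    qed
    show "pds (map snd zs) (\<lambda>p. u1 p + u p) p = 0"
      if zs: "eigen_list A zs" "sum_list (map fst zs) = 0" and p: "A p = 0" "(norm p)\<^sup>2 < \<epsilon> / 3" for zs p
    proof -
      have "pds (map snd zs) u1 p = 0"
        unfolding u1_def T_pds_eigen_list[OF superexp_solve_kernel bdG zs(1) p(1)] G_near[OF p(1)]
        using nonresonant[OF zs p(1)] p(2) \<epsilon> by simp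
      moreover have "pds (map snd zs) u p = 0"
        by (rule u0) (simp_all add: hyp_flow_fix[OF p(1)] E_0[OF p(1)])
      ultimately show ?thesis by (simp add: pds_add[OF open_UNIV su1 u(1) UNIV_I])
    qed
    fix ds Q p
    assume ds: "compatible ds" and Q: "\<And>t p. Q p \<Longrightarrow> Q (hyp_flow t p)"
      and r0: "\<And>q. (norm q)\<^sup>2 < 3 * \<epsilon> \<Longrightarrow> Q q \<Longrightarrow> pds (ds q) r q = 0"
      and p: "Q p" "(norm p)\<^sup>2 < \<epsilon> / 3"
    have dsm: "pds (ds q) (\<lambda>q. f q * m q) q = pds (ds q) f q * m q"
      if "open U" "q \<in> U" "smooth_on U f" "ab_invariant U m" for U q f m
      using ds that unfolding compatible_def by blast
    have dst: "map (hyp_flow t) (ds q) = ds (hyp_flow t q)" for t q using ds unfolding compatible_def by metis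
    have zp: "zz p < \<epsilon> / 3" using p(2) nn[of p] unfolding norm_eq by linarith
    have G0: "pds (ds q) G q = 0" if "zz q < \<epsilon>" "Q q" for q
    proof -
      have "pds (ds q) G q = pds (ds q) r q * chi q"
        unfolding G_def[abs_def] by (rule dsm[OF open_UNIV UNIV_I cpt_smooth_smooth[OF r] ichi])
      moreover have "pds (ds q) r q = 0" if "chi q \<noteq> 0"
        by (rule r0) (use chi_ne[OF that] \<open>zz q < \<epsilon>\<close> \<open>Q q\<close> in \<open>auto simp: norm_eq\<close>)
      ultimately show ?thesis by auto
    qed
    have TG0: "pds (ds q) (F.T w G) q = 0" if "superexp w" "zz q < \<epsilon>" "Q q" for w q
      by (rule T_pds_0[OF that(1) bdG]) (unfold dst, rule G0, use that Q in auto)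
    have m0: "pds (ds q) E q = 0"
      if q: "zz q < \<epsilon> / 3" "Q q" and E: "E = (\<lambda>p. e p * step 0 (c p / rr p))" and c: "ab_invariant UNIV c"
        and E0: "\<And>ds. A q = 0 \<Longrightarrow> pds ds E q = 0" for q E c
    proof (cases "A q = 0")
      case False
      \<comment> \<open>Inside the tube and off the zero set of \<open>A\<close>, \<open>E\<close>
        is \<open>T\<close> times a function of \<open>aa\<close> and \<open>bb\<close>;
        compatibility leaves only the derivative of \<open>T\<close>, which vanishes. On the zero
        set itself \<open>E\<close> is flat.\<close>
      let ?W = "{q. zz q < \<epsilon> / 3} \<inter> {q. rr q \<noteq> 0}"
      have W: "open ?W" by (intro open_Int open_lt open_ne smooth_zz smooth_rr)
      have qW: "q \<in> ?W" using q False by (simp add: rr_0)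
      have im: "ab_invariant ?W (\<lambda>q. chi q * step 0 (c q / rr q))"
        by (intro ab_invariant_mult ab_invariant_step ab_invariant_divide W ab_invariant_mono[OF ichi] ab_invariant_mono[OF c] ab_invariant_mono[OF ab_invariant_rr]) auto
      have "pds (ds q) E q = pds (ds q) (\<lambda>q. T q * (chi q * step 0 (c q / rr q))) q"
        by (rule pds_cong_open[OF W _ qW]) (simp add: E e_def zeta_1)
      also have "\<dots> = pds (ds q) T q * (chi q * step 0 (c q / rr q))"
        by (rule dsm[OF W qW smooth_on_subset[OF bdd_smooth_smooth[OF bdT]] im]) simp
      also have "pds (ds q) T q = 0" unfolding T_def by (rule TG0[OF superexp_proj_kernel]) (use q \<epsilon> in auto)
      finally show ?thesis by simp
    qed (rule E0)
    have "pds (ds p) u p = 0"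
    proof (rule u0)
      show "pds (map (hyp_flow t) (ds p)) E1 (hyp_flow t p) = 0" for t
        unfolding dst by (rule m0[OF _ Q[OF p(1)] E1 ab_invariant_aa E_0(1)]) (use zp in simp)
      show "pds (map (hyp_flow t) (ds p)) E2 (hyp_flow t p) = 0" for t
        unfolding dst by (rule m0[OF _ Q[OF p(1)] E2 ab_invariant_bb E_0(2)]) (use zp in simp)
    qed
    moreover have "pds (ds p) u1 p = 0" unfolding u1_def by (rule TG0[OF superexp_solve_kernel]) (use zp \<epsilon> p in auto)
    ultimately show "pds (ds p) (\<lambda>p. u1 p + u p) p = 0"
      by (simp add: pds_add[OF open_UNIV su1 u(1) UNIV_I])
  qed
qed

end

subsection \<open>Linear fields with periodic flow\<close>

lemma smooth_germ_extend:
  assumes "smooth_germ f"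
  obtains g where "cpt_smooth g" "\<forall>\<^sub>F p in nhds 0. f p = g p"
proof -
  obtain U where U: "open U" "0 \<in> U" "smooth_on U f" using assms unfolding smooth_germ_def by blast
  obtain d where d: "d > 0" "ball 0 d \<subseteq> U" using U by (meson openE)
  define N :: "'a pt \<Rightarrow> real" where "N p = (norm p)\<^sup>2" for p
  have sN: "smooth_on UNIV N" unfolding N_def[abs_def] using smooth_on_norm2(1)[OF linear_id] by simp
  have cN: "continuous_on UNIV N" unfolding N_def[abs_def] by (intro continuous_intros)
  define c where "c p = step 0 (1 - N p / d\<^sup>2)" for p
  have sc: "smooth_on UNIV c" unfolding c_def[abs_def]
    using d(1) by (intro smooth_on_step smooth_on_minus smooth_on_divide smooth_on_const sN open_UNIV) auto
  have c0: "c p = 0" if "2 * d\<^sup>2 / 3 < N p" for p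
    using that d(1) by (simp add: c_def step_0 field_simps)
  have c1: "c p = 1" if "N p < d\<^sup>2 / 3" for p
    using that d(1) by (simp add: c_def step_1 field_simps)
  define g where "g p = f p * c p" for p
  have 1: "smooth_on (ball 0 d) g" unfolding g_def[abs_def]
    by (intro smooth_on_mult open_ball smooth_on_subset[OF U(3) d(2)] smooth_on_subset[OF sc]) simp
  \<comment> \<open>\<open>f\<close> is arbitrary outside its domain, but the cutoff vanishes on
    this open set, which together with the ball covers everything.\<close>
  have o: "open {p. 2 * d\<^sup>2 / 3 < N p}" by (intro open_Collect_less cN continuous_on_const)
  have 2: "smooth_on {p. 2 * d\<^sup>2 / 3 < N p} g"
    using smooth_on_cong[OF o, of g "\<lambda>p. 0"] by (simp add: g_def c0)
  have "ball 0 d \<union> {p. 2 * d\<^sup>2 / 3 < N p} = UNIV"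
  proof -
    have "2 * d\<^sup>2 / 3 < N p" if "d \<le> norm p" for p
      using power_mono[OF that, of 2] zero_less_power[OF d(1), of 2] d(1) unfolding N_def by linarith
    then show ?thesis by force
  qed
  then have s: "smooth_on UNIV g" using smooth_on_Un[OF 1 2] by simp
  have "cpt_smooth g" unfolding cpt_smooth_def
  proof (intro conjI exI allI impI)
    fix p :: "'a pt" assume "d < norm p"
    then have "2 * d\<^sup>2 / 3 < N p" using power_strict_mono[of d "norm p" 2] zero_less_power[OF d(1), of 2] d(1)
      unfolding N_def by linarith
    then show "g p = 0" by (simp add: g_def c0)
  qed (rule s)
  moreover have "\<forall>\<^sub>F p in nhds 0. f p = g p"
  proof -
    have o: "open {p. N p < d\<^sup>2 / 3}" by (intro open_Collect_less cN continuous_on_const)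
    have "(0 :: 'a pt) \<in> {p. N p < d\<^sup>2 / 3}" using d(1) by (simp add: N_def)
    then show ?thesis unfolding eventually_nhds using o c1 by (intro exI[of _ "{p. N p < d\<^sup>2 / 3}"]) (auto simp: g_def)
  qed
  ultimately show ?thesis using that by blast
qed

text \<open>Neighbourhoods are measured by the squared norm because it is the sum of
  \<open>aa\<close>, \<open>bb\<close> and \<open>zz\<close>.\<close>

lemma eventually_ball: "(\<forall>\<^sub>F p in nhds (0 :: 'n::finite pt). P p) \<longleftrightarrow> (\<exists>\<epsilon>>0. \<forall>p. (norm p)\<^sup>2 < \<epsilon> \<longrightarrow> P p)"
proof
  assume "\<forall>\<^sub>F p in nhds (0 :: 'n pt). P p"
  then obtain d where d: "d > 0" "\<And>p. dist p 0 < d \<Longrightarrow> P p" unfolding eventually_nhds_metric by blast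
  have "P p" if "(norm p)\<^sup>2 < d\<^sup>2" for p
    using that d power_less_imp_less_base[of "norm p" 2 d] by simp
  then show "\<exists>\<epsilon>>0. \<forall>p. (norm p)\<^sup>2 < \<epsilon> \<longrightarrow> P p" using d(1) by (intro exI[of _ "d\<^sup>2"]) simp
next
  assume "\<exists>\<epsilon>>0. \<forall>p. (norm p)\<^sup>2 < \<epsilon> \<longrightarrow> P p"
  then obtain e where e: "e > 0" "\<And>p. (norm p)\<^sup>2 < e \<Longrightarrow> P p" by blast
  have "P p" if "dist p 0 < sqrt e" for p
    using that e(1) power_strict_mono[of "norm p" "sqrt e" 2] by (intro e(2)) simp
  then show "\<forall>\<^sub>F p in nhds (0 :: 'n pt). P p"
    unfolding eventually_nhds_metric using e(1) by (intro exI[of _ "sqrt e"]) simp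
qed

section \<open>Derivatives along linear fields and their effect on resonant coefficients\<close>

definition lie :: "('n::finite pt \<Rightarrow> 'n pt) \<Rightarrow> ('n pt \<Rightarrow> real) \<Rightarrow> 'n pt \<Rightarrow> real" where
  "lie A f p = pd f (A p) p"

lemma lie_Basis: "smooth_on U f \<Longrightarrow> p \<in> U \<Longrightarrow> lie A f p = (\<Sum>b\<in>Basis. (A p \<bullet> b) * pd f b p)"
  unfolding lie_def by (rule pd_Basis) (rule smooth_on_diff)

lemma
  assumes A: "linear A"
  shows smooth_coord: "smooth_on UNIV (\<lambda>p. A p \<bullet> b)" and pd_coord: "pd (\<lambda>p. A p \<bullet> b) v p = A v \<bullet> b"
proof -
  have "bounded_linear A" using A by (simp add: linear_conv_bounded_linear)
  then have "bounded_linear (\<lambda>p. A p \<bullet> b)" by (rule bounded_linear_inner_left_comp)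
  then show "smooth_on UNIV (\<lambda>p. A p \<bullet> b)" "pd (\<lambda>p. A p \<bullet> b) v p = A v \<bullet> b"
    by (rule smooth_on_linear)+
qed

lemma lie_smooth:
  assumes "linear A" "smooth_on UNIV f"
  shows "smooth_on UNIV (lie A f)"
proof -
  have e: "lie A f = (\<lambda>p. \<Sum>b\<in>Basis. (A p \<bullet> b) * pd f b p)" by (rule ext) (rule lie_Basis[OF assms(2) UNIV_I])
  show ?thesis unfolding e by (intro smooth_on_sum smooth_on_mult open_UNIV smooth_coord assms(1) smooth_on_pd assms(2))
qed

text \<open>The extra term is the commutator of the constant field \<open>v\<close> with the linear
  field \<open>A\<close>, namely the constant field \<open>A v\<close>; for an eigenvector it
  contributes the weight.\<close>

lemma pd_lie:
  assumes "linear A" "smooth_on UNIV f"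
  shows "pd (lie A f) v p = lie A (pd f v) p + pd f (A v) p"
proof -
  have e: "lie A f = (\<lambda>p. \<Sum>b\<in>Basis. (A p \<bullet> b) * pd f b p)" by (rule ext) (rule lie_Basis[OF assms(2) UNIV_I])
  have d: "(\<lambda>p. A p \<bullet> b) differentiable at p" "pd f b differentiable at p" for b
    by (rule smooth_on_diff[OF smooth_coord[OF assms(1)] UNIV_I] smooth_on_diff[OF smooth_on_pd[OF assms(2)] UNIV_I])+
  have "pd (lie A f) v p = (\<Sum>b\<in>Basis. pd (\<lambda>p. (A p \<bullet> b) * pd f b p) v p)"
    unfolding e by (rule pd_sum) (intro differentiable_mult d)
  also have "\<dots> = (\<Sum>b\<in>Basis. (A v \<bullet> b) * pd f b p + (A p \<bullet> b) * pd (pd f v) b p)"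
    by (simp only: pd_mult[OF d] pd_coord[OF assms(1)] pd_commute[OF open_UNIV UNIV_I assms(2), of _ v])
  also have "\<dots> = pd f (A v) p + lie A (pd f v) p"
    unfolding sum.distrib lie_Basis[OF smooth_on_pd[OF assms(2)] UNIV_I]
    by (simp only: pd_Basis[OF smooth_on_diff[OF assms(2) UNIV_I], of "A v" p])
  finally show ?thesis by simp
qed

lemma lie_commute:
  assumes "linear A" "linear B" "\<And>p. A (B p) = B (A p)" "smooth_on UNIV f"
  shows "lie A (lie B f) p = lie B (lie A f) p"
  unfolding lie_def[of A "lie B f"] lie_def[of B "lie A f"] pd_lie[OF assms(1,4)] pd_lie[OF assms(2,4)]
  unfolding lie_def by (simp only: assms(3) pd_commute[OF open_UNIV UNIV_I assms(4), of "A p" "B p" p])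

text \<open>For \<^term>\<open>l = 0\<close>: the resonant Taylor coefficients vanish on the zero set of \<^term>\<open>A\<close> near 0. This characterises
  the germs in the image of \<^term>\<open>lie A\<close>.\<close>

definition nonresonant_on :: "('n::finite pt \<Rightarrow> 'n pt) \<Rightarrow> real \<Rightarrow> int \<Rightarrow> ('n pt \<Rightarrow> real) \<Rightarrow> bool" where
  "nonresonant_on A \<epsilon> l f \<longleftrightarrow> (\<forall>zs p. eigen_list A zs \<longrightarrow> sum_list (map fst zs) = l \<longrightarrow> A p = 0 \<longrightarrow> (norm p)\<^sup>2 < \<epsilon> \<longrightarrow>
     pds (map snd zs) f p = 0)"

lemma eigen_list_snoc: "eigen_list A (zs @ [(s, v)]) \<longleftrightarrow> eigen_list A zs \<and> (s = 1 \<or> s = -1) \<and> A v = of_int s *\<^sub>R v"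
  by (auto simp: eigen_list_def)

text \<open>Each eigendirection adds its weight when commuted past \<open>lie A\<close>, and the
  remaining term has \<open>A p = 0\<close> as direction. So a coefficient of weight l is multiplied
  by l.\<close>

lemma nonresonant_on_lie_self:
  assumes "linear A" "smooth_on UNIV f"
  shows "nonresonant_on A \<epsilon> 0 (lie A f)"
proof -
  have "pds (map snd zs) (lie A f) p = of_int (sum_list (map fst zs)) * pds (map snd zs) f p"
    if "eigen_list A zs" "A p = 0" "smooth_on UNIV f" for zs f p
    using that(1,3)
  proof (induction zs arbitrary: f rule: rev_induct)
    case Nil
    then show ?case using that(2) smooth_on_diff[OF Nil(2) UNIV_I] by (simp add: lie_def)
  next
    case (snoc x zs)
    obtain s v where x: "x = (s, v)" by (cases x)
    note z = snoc.prems(1)[unfolded x eigen_list_snoc]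
    note sf = snoc.prems(2)
    have e: "pd (lie A f) v = (\<lambda>p. 1 * lie A (pd f v) p + of_int s * pd f v p)"
    proof
      fix p
      have "pd f (of_int s *\<^sub>R v) p = of_int s * pd f v p"
        using linear_cmul[OF pd_linear[OF smooth_on_diff[OF sf UNIV_I]]] by simp
      then show "pd (lie A f) v p = 1 * lie A (pd f v) p + of_int s * pd f v p"
        using pd_lie[OF assms(1) sf, of v p] z by simp
    qed
    have "pds (map snd zs) (pd (lie A f) v) p
        = 1 * pds (map snd zs) (lie A (pd f v)) p + of_int s * pds (map snd zs) (pd f v) p"
      unfolding e by (rule pds_lin[OF open_UNIV lie_smooth[OF assms(1) smooth_on_pd[OF sf]] smooth_on_pd[OF sf] UNIV_I])
    then show ?case
      using snoc.IH[OF z[THEN conjunct1] smooth_on_pd[OF sf]] by (simp add: x pds_snoc algebra_simps)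
  qed
  then show ?thesis unfolding nonresonant_on_def using assms(2) by simp
qed

text \<open>A commuting \<open>B\<close> maps eigenvectors of \<open>A\<close> to eigenvectors of
  the same weight or to 0, and at a zero of \<open>A\<close> its own direction is tangent to the
  zero set.\<close>

lemma (in hyperbolic) nonresonant_on_lie_comm:
  assumes "linear B" "\<And>p. A (B p) = B (A p)" "smooth_on UNIV f" "nonresonant_on A \<epsilon> l f"
  shows "nonresonant_on A \<epsilon> l (lie B f)"
proof -
  have "pds (map snd zs) (lie B f) p = 0"
    if "eigen_list A zs" "A p = 0" "(norm p)\<^sup>2 < \<epsilon>" "smooth_on UNIV f" "nonresonant_on A \<epsilon> (sum_list (map fst zs)) f" for zs f p
    using that(1,4,5)
  proof (induction zs arbitrary: f rule: rev_induct)
    case Nil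
    have "f q = 0" if "A q = 0" "(norm q)\<^sup>2 < \<epsilon>" for q
      using Nil.prems(3) that unfolding nonresonant_on_def by (metis Nil.prems(1) list.map(1) pds_Nil)
    then have "pd f (B p) p = 0"
      by (rule pd_tangent[OF Nil.prems(2) _ _ that(2,3)]) (simp_all add: assms(2) that(2) linear_0[OF assms(1)])
    then show ?case by (simp add: lie_def)
  next
    case (snoc x zs)
    obtain s v where x: "x = (s, v)" by (cases x)
    note z = snoc.prems(1)[unfolded x eigen_list_snoc]
    note sf = snoc.prems(2)
    note bf = snoc.prems(3)[unfolded nonresonant_on_def, rule_format]
    have "nonresonant_on A \<epsilon> (sum_list (map fst zs)) (pd f v)" unfolding nonresonant_on_def
    proof (intro allI impI)
      fix ws q assume w: "eigen_list A ws" "sum_list (map fst ws) = sum_list (map fst zs)" "A q = 0" "(norm q)\<^sup>2 < \<epsilon>"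
      show "pds (map snd ws) (pd f v) q = 0"
        using bf[of "ws @ [(s, v)]" q] w z by (simp add: eigen_list_snoc x pds_snoc)
    qed
    from snoc.IH[OF z[THEN conjunct1] smooth_on_pd[OF sf] this]
    have 1: "pds (map snd zs) (lie B (pd f v)) p = 0" .
    have "A (B v) = of_int s *\<^sub>R B v" using z by (simp add: assms(2) linear_cmul[OF assms(1)])
    then have 2: "pds (map snd zs) (pd f (B v)) p = 0"
      using bf[of "zs @ [(s, B v)]" p] that(2,3) z by (simp add: eigen_list_snoc x pds_snoc)
    have e: "pd (lie B f) v = (\<lambda>p. lie B (pd f v) p + pd f (B v) p)" by (rule ext) (rule pd_lie[OF assms(1) sf])
    show ?case unfolding x map_append list.map snd_conv pds_snoc e
      by (subst pds_add[OF open_UNIV lie_smooth[OF assms(1) smooth_on_pd[OF sf]] smooth_on_pd[OF sf] UNIV_I])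
        (simp add: 1 2)
  qed
  then show ?thesis using assms(3,4) unfolding nonresonant_on_def[of A \<epsilon> l "lie B f"] by blast
qed

lemma superexp_compact:
  assumes "w \<in> borel_measurable borel" "\<And>t. \<bar>w t\<bar> \<le> B" "\<And>t. t < 0 \<or> T < t \<Longrightarrow> w t = 0"
  shows "superexp w"
  unfolding superexp_def
proof (intro conjI allI)
  fix n :: nat
  have "\<bar>w t\<bar> \<le> (B * exp (real n * T)) * exp (- real n * \<bar>t\<bar>)" for t
  proof (cases "t < 0 \<or> T < t")
    case True
    then show ?thesis using assms(2)[of t] assms(3)[of t] by simp
  next
    case False
    have B: "B \<ge> 0" using assms(2)[of 0] by linarith
    have "\<bar>w t\<bar> \<le> B * 1" using assms(2) by simp
    also have "\<dots> \<le> B * exp (real n * T - real n * \<bar>t\<bar>)"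
      using False B by (intro mult_left_mono) (auto intro: mult_left_mono)
    finally show ?thesis by (simp add: exp_diff exp_minus divide_inverse)
  qed
  then show "\<exists>C. \<forall>t. \<bar>w t\<bar> \<le> C * exp (- real n * \<bar>t\<bar>)" by blast
qed (rule assms)

section \<open>Averaging over a periodic isometric flow\<close>

locale rotational =
  fixes A :: "'n::finite pt \<Rightarrow> 'n pt" and c :: real
  assumes linA: "linear A" and cube: "A (A (A p)) = - (c\<^sup>2) *\<^sub>R A p" and skew: "A p \<bullet> q = - (p \<bullet> A q)"
    and c_pos: "c > 0"
begin

text \<open>Rodrigues' formula: the exponential series of \<open>t\<close> times \<open>A\<close>,
  summed by means of \<open>cube\<close>.\<close>

definition rot_flow :: "real \<Rightarrow> 'n pt \<Rightarrow> 'n pt" where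
  "rot_flow t p = p + (sin (c * t) / c) *\<^sub>R A p + ((1 - cos (c * t)) / c\<^sup>2) *\<^sub>R A (A p)"

lemmas A_simps = linear_add[OF linA] linear_diff[OF linA] linear_cmul[OF linA] linear_0[OF linA]

lemma A_rot_flow: "A (rot_flow t p) = cos (c * t) *\<^sub>R A p + (sin (c * t) / c) *\<^sub>R A (A p)"
proof -
  have e: "((1 - cos (c * t)) / c\<^sup>2) * - (c\<^sup>2) = cos (c * t) - 1" using c_pos by simp
  show ?thesis unfolding rot_flow_def by (simp only: A_simps cube scaleR_scaleR e) (simp add: algebra_simps)
qed

lemma norm_rot_flow: "norm (rot_flow t p) = norm p"
proof -
  have 1: "p \<bullet> A p = 0" using skew[of p p] by (simp add: inner_commute)
  have 2: "p \<bullet> A (A p) = - (A p \<bullet> A p)" using skew[of p "A p"] by simp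
  have 3: "A p \<bullet> A (A p) = 0" using skew[of "A p" "A p"] by (simp add: inner_commute)
  have 4: "A (A p) \<bullet> A (A p) = c\<^sup>2 * (A p \<bullet> A p)" using skew[of "A p" "A (A p)"] by (simp add: cube)
  define s where "s = sin (c * t) / c"
  define k where "k = (1 - cos (c * t)) / c\<^sup>2"
  have "rot_flow t p \<bullet> rot_flow t p = p \<bullet> p + (s\<^sup>2 + k\<^sup>2 * c\<^sup>2 - 2 * k) * (A p \<bullet> A p)"
    unfolding rot_flow_def s_def[symmetric] k_def[symmetric]
    by (simp add: inner_add_left inner_add_right 1 2 3 4 inner_commute[of "A p" p] inner_commute[of "A (A p)" p]
      inner_commute[of "A (A p)" "A p"] power2_eq_square algebra_simps)
  also have "s\<^sup>2 + k\<^sup>2 * c\<^sup>2 - 2 * k = ((sin (c * t))\<^sup>2 + (1 - cos (c * t))\<^sup>2 - 2 * (1 - cos (c * t))) / c\<^sup>2"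
  proof -
    have "k\<^sup>2 * c\<^sup>2 = (1 - cos (c * t))\<^sup>2 / c\<^sup>2"
      using c_pos by (simp add: k_def power_divide power2_eq_square)
    then show ?thesis by (simp add: s_def k_def power_divide diff_divide_distrib add_divide_distrib)
  qed
  also have "(sin (c * t))\<^sup>2 + (1 - cos (c * t))\<^sup>2 - 2 * (1 - cos (c * t)) = 0"
    by (simp add: power2_diff sin_squared_eq)
  finally show ?thesis by (simp add: norm_eq_sqrt_inner)
qed

lemma lin_rot_flow: "linear (rot_flow t)"
  unfolding rot_flow_def[abs_def]
  using linear_compose[OF linA linA] by (intro linear_compose_add linear_compose_scale_right linA linear_id[unfolded id_def]) (simp add: o_def)

lemma rot_flow_comm: assumes "linear B" "\<And>p. A (B p) = B (A p)" shows "B (rot_flow t p) = rot_flow t (B p)"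
  by (simp add: rot_flow_def linear_add[OF assms(1)] linear_cmul[OF assms(1)] assms(2))

sublocale F: lflow A rot_flow 1
proof (rule lflow.intro)
  show "((\<lambda>t. rot_flow t p) has_vector_derivative A (rot_flow t p)) (at t)" for t p
  proof -
    have "((\<lambda>t. sin (c * t) / c) has_real_derivative cos (c * t)) (at t)"
      "((\<lambda>t. (1 - cos (c * t)) / c\<^sup>2) has_real_derivative sin (c * t) / c) (at t)"
      using c_pos by (auto intro!: derivative_eq_intros simp: power2_eq_square)
    then have "((\<lambda>t. p + (sin (c * t) / c) *\<^sub>R A p + ((1 - cos (c * t)) / c\<^sup>2) *\<^sub>R A (A p)) has_vector_derivative
        0 + ((sin (c * t) / c) *\<^sub>R 0 + cos (c * t) *\<^sub>R A p)
          + (((1 - cos (c * t)) / c\<^sup>2) *\<^sub>R 0 + (sin (c * t) / c) *\<^sub>R A (A p))) (at t)"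
      by (intro has_vector_derivative_add has_vector_derivative_const has_vector_derivative_scaleR)
    then show ?thesis unfolding A_rot_flow unfolding rot_flow_def by simp
  qed
  show "A (rot_flow t p) = rot_flow t (A p)" for t p by (rule rot_flow_comm[OF linA]) simp
  show "rot_flow 0 p = p" for p by (simp add: rot_flow_def)
  show "norm (rot_flow t p) \<le> 1 * exp \<bar>t\<bar> * norm p" for t p
    unfolding norm_rot_flow using mult_right_mono[of 1 "exp \<bar>t\<bar>" "norm p"] by simp
qed (simp_all add: linA lin_rot_flow)

definition period :: real where "period = 2 * pi / c"

lemma period_pos: "period > 0" using c_pos by (simp add: period_def)

lemma rot_flow_period: "rot_flow period p = p" using c_pos by (simp add: rot_flow_def period_def)

definition avg_weight :: "real \<Rightarrow> real" where "avg_weight t = indicator {0..period} t / period"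
text \<open>A sawtooth in the role of \<open>solve_kernel\<close>: its distributional derivative is
  \<open>avg_weight\<close> minus the point mass at the period, where the flow is the identity
  again.\<close>

definition ramp_weight :: "real \<Rightarrow> real" where "ramp_weight t = indicator {0..period} t * t / period"

lemma superexp_weights: "superexp avg_weight" "superexp ramp_weight"
proof -
  show "superexp avg_weight"
    unfolding avg_weight_def[abs_def] by (rule superexp_compact[of _ "1 / period" period]) (use period_pos in \<open>auto simp: indicator_def\<close>)
  show "superexp ramp_weight"
    unfolding ramp_weight_def[abs_def] by (rule superexp_compact[of _ 1 period]) (use period_pos in \<open>auto simp: indicator_def\<close>)
qed

lemma avg_deriv:
  assumes u: "smooth_on UNIV u"
  shows "(\<integral>t. avg_weight t * lie A u (rot_flow t p) \<partial>lborel) = 0"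
proof -
  have "(\<integral>t. lie A u (rot_flow t p) * indicator {0..period} t \<partial>lborel) = u (rot_flow period p) - u (rot_flow 0 p)"
    unfolding lie_def using period_pos
    by (intro integral_FTC_Icc_real F.orbit_deriv[OF u] F.isCont_orbit_deriv[OF u]) auto
  also have "\<dots> = 0" by (simp add: rot_flow_period F.zero)
  finally have "(1 / period) * (\<integral>t. lie A u (rot_flow t p) * indicator {0..period} t \<partial>lborel) = 0" by simp
  then show ?thesis unfolding integral_mult_right_zero[symmetric] avg_weight_def by (simp add: mult_ac)
qed

lemma primitive_deriv:
  assumes u: "bdd_smooth u"
  shows "lie A (F.T ramp_weight u) p = u p - F.T avg_weight u p" "lie A (F.T avg_weight u) p = 0"
proof -
  note su = bdd_smooth_smooth[OF u]
  have e: "lie A (F.T w u) p = (\<integral>t. w t * lie A u (rot_flow t p) \<partial>lborel)" if "superexp w" for w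
    unfolding lie_def F.T_pd[OF that u] F.commA ..
  show "lie A (F.T avg_weight u) p = 0" unfolding e[OF superexp_weights(1)] by (rule avg_deriv[OF su])
  have i: "integrable lborel (\<lambda>t. avg_weight t * u (rot_flow t p))"
    using param_family.integrable[OF F.superexp_family[OF superexp_weights(1) u] UNIV_I, of "[]" p] by simp
  have i2: "integrable lborel (\<lambda>t. ramp_weight t * lie A u (rot_flow t p))"
    using param_family.integrable[OF F.superexp_family[OF superexp_weights(2) u] UNIV_I, of "[A p]" p]
    unfolding F.pds_flow(1)[OF su] by (simp add: pds_Cons lie_def F.commA)
  have "(\<integral>t. (1 / period * u (rot_flow t p) + t / period * lie A u (rot_flow t p)) * indicator {0..period} t \<partial>lborel)
      = period / period * u (rot_flow period p) - 0 / period * u (rot_flow 0 p)"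
  proof (rule integral_FTC_Icc_real)
    show "((\<lambda>t. t / period * u (rot_flow t p)) has_real_derivative 1 / period * u (rot_flow t p) + t / period * lie A u (rot_flow t p)) (at t)" for t
      using DERIV_mult[OF DERIV_cdivide[OF DERIV_ident, of period] F.orbit_deriv[OF su, where p = p and t = t]]
      by (simp add: lie_def mult.commute add.commute)
    show "isCont (\<lambda>t. 1 / period * u (rot_flow t p) + t / period * lie A u (rot_flow t p)) t" for t
      unfolding lie_def using DERIV_isCont[OF F.orbit_deriv[OF su]] period_pos
      by (intro continuous_intros F.isCont_orbit_deriv[OF su]) auto
  qed (use period_pos in auto)
  also have "(\<lambda>t. (1 / period * u (rot_flow t p) + t / period * lie A u (rot_flow t p)) * indicator {0..period} t)
      = (\<lambda>t. avg_weight t * u (rot_flow t p) + ramp_weight t * lie A u (rot_flow t p))"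
    by (rule ext) (simp add: avg_weight_def ramp_weight_def algebra_simps)
  finally have "(\<integral>t. avg_weight t * u (rot_flow t p) \<partial>lborel) + (\<integral>t. ramp_weight t * lie A u (rot_flow t p) \<partial>lborel) = u p"
    using i i2 period_pos by (simp add: rot_flow_period)
  then show "lie A (F.T ramp_weight u) p = u p - F.T avg_weight u p"
    unfolding e[OF superexp_weights(2)] F.T_def[of avg_weight] by simp
qed

lemma T_pds_0:
  assumes "superexp w" "bdd_smooth G" "\<And>t. pds (map (rot_flow t) ds) G (rot_flow t p) = 0"
  shows "pds ds (F.T w G) p = 0"
  unfolding F.T_pds[OF assms(1,2)] assms(3) by simp

end

subsection \<open>Families of commuting linear fields\<close>

abbreviation near :: "('n::finite pt \<Rightarrow> bool) \<Rightarrow> bool" where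
  "near P \<equiv> eventually P (nhds 0)"

definition nonresonant :: "('n::finite pt \<Rightarrow> 'n pt) \<Rightarrow> ('n pt \<Rightarrow> real) \<Rightarrow> bool" where
  "nonresonant A f \<longleftrightarrow> (\<exists>\<epsilon>>0. nonresonant_on A \<epsilon> 0 f)"

lemma nonresonant_on_mono: "nonresonant_on A \<epsilon> l f \<Longrightarrow> \<delta> \<le> \<epsilon> \<Longrightarrow> nonresonant_on A \<delta> l f"
  unfolding nonresonant_on_def
proof (intro allI impI)
  fix zs p
  assume *: "\<forall>zs p. eigen_list A zs \<longrightarrow> sum_list (map fst zs) = l \<longrightarrow> A p = 0 \<longrightarrow> (norm p)\<^sup>2 < \<epsilon> \<longrightarrow> pds (map snd zs) f p = 0"
    and "\<delta> \<le> \<epsilon>" "eigen_list A zs" "sum_list (map fst zs) = l" "A p = 0" "(norm p)\<^sup>2 < \<delta>"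
  then have "(norm p)\<^sup>2 < \<epsilon>" by linarith
  then show "pds (map snd zs) f p = 0" using * \<open>eigen_list A zs\<close> \<open>sum_list (map fst zs) = l\<close> \<open>A p = 0\<close> by blast
qed

lemma near_pds:
  assumes "near (\<lambda>p. f p = g p)"
  shows "near (\<lambda>p. \<forall>ds. pds ds f p = pds ds g p)"
proof -
  from assms have "near (\<lambda>q. \<forall>\<^sub>F p in nhds q. f p = g p)" by (simp add: eventually_eventually)
  then show ?thesis by (rule eventually_mono) (intro allI pds_cong_ev)
qed

lemma near_lie:
  assumes "near (\<lambda>p. f p = g p)"
  shows "near (\<lambda>p. lie A f p = lie A g p)"
  using near_pds[OF assms]
proof (rule eventually_mono)
  fix p assume "\<forall>ds. pds ds f p = pds ds g p"
  from this[rule_format, of "[A p]"] show "lie A f p = lie A g p" by (simp add: lie_def pds_Cons)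
qed

lemma near_lie_0: "near (\<lambda>p. f p = 0) \<Longrightarrow> near (\<lambda>p. lie A f p = 0)"
  using near_lie[of f "\<lambda>p. 0" A] by (simp add: lie_def)

lemma lie_diff: "smooth_on UNIV f \<Longrightarrow> smooth_on UNIV g \<Longrightarrow> lie A (\<lambda>p. f p - g p) p = lie A f p - lie A g p"
  unfolding lie_def by (rule pd_diff) (rule smooth_on_diff[OF _ UNIV_I], assumption)+

lemma lie_add: "smooth_on UNIV f \<Longrightarrow> smooth_on UNIV g \<Longrightarrow> lie A (\<lambda>p. f p + g p) p = lie A f p + lie A g p"
  unfolding lie_def by (rule pd_add) (rule smooth_on_diff[OF _ UNIV_I], assumption)+

lemma nonresonant_cong:
  assumes "near (\<lambda>p. f p = g p)" "nonresonant A f"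
  shows "nonresonant A g"
proof -
  obtain d where d: "d > 0" "\<And>p. (norm p)\<^sup>2 < d \<Longrightarrow> \<forall>ds. pds ds f p = pds ds g p"
    using near_pds[OF assms(1)] unfolding eventually_ball by blast
  obtain e where e: "e > 0" "nonresonant_on A e 0 f" using assms(2) unfolding nonresonant_def by blast
  have "nonresonant_on A (min d e) 0 g"
    using nonresonant_on_mono[OF e(2), of "min d e"] d(2) unfolding nonresonant_on_def by simp
  then show ?thesis unfolding nonresonant_def using d(1) e(1) by (intro exI[of _ "min d e"]) simp
qed

lemma nonresonant_diff:
  assumes "smooth_on UNIV f" "smooth_on UNIV g" "nonresonant A f" "nonresonant A g"
  shows "nonresonant A (\<lambda>p. f p - g p)"
proof -
  obtain d e where *: "d > 0" "nonresonant_on A d 0 f" "e > 0" "nonresonant_on A e 0 g" using assms(3,4) unfolding nonresonant_def by blast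
  have "nonresonant_on A (min d e) 0 (\<lambda>p. f p - g p)"
    using nonresonant_on_mono[OF *(2), of "min d e"] nonresonant_on_mono[OF *(4), of "min d e"]
    unfolding nonresonant_on_def by (simp add: pds_minus[OF open_UNIV assms(1,2) UNIV_I])
  then show ?thesis unfolding nonresonant_def using * by (intro exI[of _ "min d e"]) simp
qed

lemma nonresonant_add:
  assumes "smooth_on UNIV f" "smooth_on UNIV g" "nonresonant A f" "nonresonant A g"
  shows "nonresonant A (\<lambda>p. f p + g p)"
proof -
  obtain d e where *: "d > 0" "nonresonant_on A d 0 f" "e > 0" "nonresonant_on A e 0 g" using assms(3,4) unfolding nonresonant_def by blast
  have "nonresonant_on A (min d e) 0 (\<lambda>p. f p + g p)"
    using nonresonant_on_mono[OF *(2), of "min d e"] nonresonant_on_mono[OF *(4), of "min d e"]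
    unfolding nonresonant_on_def by (simp add: pds_add[OF open_UNIV assms(1,2) UNIV_I])
  then show ?thesis unfolding nonresonant_def using * by (intro exI[of _ "min d e"]) simp
qed

lemma smooth_germ_UNIV: "smooth_on UNIV f \<Longrightarrow> smooth_germ f"
  unfolding smooth_germ_def by (rule exI[of _ UNIV]) simp

lemma eigsD: "eigen_list A zs \<Longrightarrow> (s, v) \<in> set zs \<Longrightarrow> (s = 1 \<or> s = -1) \<and> A v = of_int s *\<^sub>R v"
  unfolding eigen_list_def by blast

lemma eigen_list_map:
  assumes "\<And>v. A (L v) = L (A v)" "linear L"
  shows "eigen_list A zs \<Longrightarrow> eigen_list A (map (\<lambda>(s, v). (s, L v)) zs)"
proof (induction zs)
  case (Cons x zs)
  obtain s v where x: "x = (s, v)" by (cases x)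
  show ?case using Cons by (simp add: x eigen_list_def assms(1) linear_cmul[OF assms(2)])
qed (simp add: eigen_list_def)

lemma (in hyperbolic) hyp_flow_comm: assumes "linear B" "\<And>p. A (B p) = B (A p)" shows "B (hyp_flow t p) = hyp_flow t (B p)"
  by (simp add: hyp_flow_def pp_def pm_def pz_def linear_add[OF assms(1)] linear_diff[OF assms(1)] linear_cmul[OF assms(1)] assms(2))

text \<open>Meant for eigenvectors of another hyperbolic field of the family: they lie in the kernel
  of \<open>A\<close>, so the flow fixes them and \<open>aa\<close> and \<open>bb\<close> are
  constant along them.\<close>

lemma (in hyperbolic) compatible_const:
  assumes "\<And>v. v \<in> set ds \<Longrightarrow> A v = 0"
  shows "compatible (\<lambda>p. ds)"
  unfolding compatible_def
proof (intro conjI allI impI)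
  show "ds = map (hyp_flow t) ds" for t
    by (rule map_idI[symmetric]) (rule hyp_flow_fix[OF assms])
  fix U f m p assume U: "open U" "p \<in> U" "smooth_on U f" "ab_invariant U m"
  show "pds ds (\<lambda>q. f q * m q) p = pds ds f p * m p"
  proof (rule pds_mult_const[OF U(1,3) ab_invariant_smooth[OF U(4)] _ U(2)])
    fix v q assume "v \<in> set ds" "q \<in> U"
    then show "pd m v q = 0"
      by (intro invD[OF U(4)])
        (simp_all add: aa_def[abs_def] bb_def[abs_def] smooth_on_norm2(2)[OF lin_pp] smooth_on_norm2(2)[OF lin_pm] eig_zero assms)
  qed
qed

text \<open>The orthogonality conditions say that \<open>aa\<close> and \<open>bb\<close> are
  constant along \<open>B\<close>.\<close>

lemma (in hyperbolic) compatible_field: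
  assumes B: "linear B" "\<And>p. A (B p) = B (A p)" and o: "\<And>p. pp p \<bullet> pp (B p) = 0" "\<And>p. pm p \<bullet> pm (B p) = 0"
  shows "compatible (\<lambda>p. [B p])"
  unfolding compatible_def
proof (intro conjI allI impI)
  show "[B (hyp_flow t p)] = map (hyp_flow t) [B p]" for t p by (simp add: hyp_flow_comm[OF B])
  fix U f m p assume U: "open U" "p \<in> U" "smooth_on U f" "ab_invariant U m"
  have "pd m (B p) p = 0"
    by (rule invD[OF U(4,2)])
      (simp_all add: aa_def[abs_def] bb_def[abs_def] smooth_on_norm2(2)[OF lin_pp] smooth_on_norm2(2)[OF lin_pm] o)
  then show "pds [B p] (\<lambda>q. f q * m q) p = pds [B p] f p * m p"
    by (simp add: pds_Cons pd_mult[OF smooth_on_diff[OF U(3,2)] ab_invariant_diff[OF U(4,2)]])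
qed

text \<open>Distinct hyperbolic fields act on different coordinates, hence \<open>orth\<close>. No
  such condition links a rotational field with a hyperbolic one, since a focus-focus block carries
  one of each.\<close>

locale commuting_fields =
  fixes J Hyp :: "nat set" and A :: "nat \<Rightarrow> 'n::finite pt \<Rightarrow> 'n pt"
  assumes fin: "finite J" and Hyp: "Hyp \<subseteq> J"
    and hyperbolic: "j \<in> Hyp \<Longrightarrow> hyperbolic (A j)"
    and rotational: "j \<in> J \<Longrightarrow> j \<notin> Hyp \<Longrightarrow> \<exists>c. rotational (A j) c"
    and comm: "i \<in> J \<Longrightarrow> j \<in> J \<Longrightarrow> A i (A j p) = A j (A i p)"
    and orth: "i \<in> Hyp \<Longrightarrow> j \<in> Hyp \<Longrightarrow> i \<noteq> j \<Longrightarrow> A i (A j p) = 0"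
begin

lemma lin: "j \<in> J \<Longrightarrow> linear (A j)"
  using hyperbolic rotational hyperbolic.linA rotational.linA by blast

lemma nonresonant_lie_self:
  assumes "k \<in> J" "smooth_on UNIV u"
  shows "nonresonant (A k) (lie (A k) u)"
  unfolding nonresonant_def by (intro exI[of _ 1] conjI nonresonant_on_lie_self lin assms) simp

lemma nonresonant_lie:
  assumes "k \<in> Hyp" "j \<in> J" "smooth_on UNIV f" "nonresonant (A k) f"
  shows "nonresonant (A k) (lie (A j) f)"
proof -
  obtain e where e: "e > 0" "nonresonant_on (A k) e 0 f" using assms(4) unfolding nonresonant_def by blast
  have "A k (A j p) = A j (A k p)" for p using comm assms Hyp by blast
  from hyperbolic.nonresonant_on_lie_comm[OF hyperbolic[OF assms(1)] lin[OF assms(2)] this assms(3) e(2)]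
  show ?thesis unfolding nonresonant_def using e(1) by blast
qed

lemma XX: "i \<in> J \<Longrightarrow> j \<in> J \<Longrightarrow> smooth_on UNIV f \<Longrightarrow> lie (A i) (lie (A j) f) p = lie (A j) (lie (A i) f) p"
  by (rule lie_commute) (simp_all add: lin comm)

section \<open>Solution operators that respect the whole family\<close>

lemma solve_hyperbolic:
  assumes j: "j \<in> Hyp" and r: "smooth_on UNIV r" "nonresonant (A j) r"
  obtains y where "smooth_on UNIV y" "near (\<lambda>p. lie (A j) y p = r p)"
    "\<And>i. i \<in> J \<Longrightarrow> i \<noteq> j \<Longrightarrow> near (\<lambda>p. lie (A i) r p = 0) \<Longrightarrow> near (\<lambda>p. lie (A i) y p = 0)"
    "\<And>k. k \<in> Hyp \<Longrightarrow> nonresonant (A k) r \<Longrightarrow> nonresonant (A k) y"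
proof -
  interpret hyperbolic "A j" by (rule hyperbolic[OF j])
  have jJ: "j \<in> J" using j Hyp by blast
  obtain r' where r': "cpt_smooth r'" "near (\<lambda>p. r p = r' p)" using smooth_germ_extend[OF smooth_germ_UNIV[OF r(1)]] by blast
  have "near (\<lambda>p. \<forall>i\<in>J. near (\<lambda>p. lie (A i) r p = 0) \<longrightarrow> lie (A i) r' p = 0)"
  proof (rule eventually_ball_finite[OF fin], rule ballI)
    fix i assume "i \<in> J"
    show "near (\<lambda>p. near (\<lambda>p. lie (A i) r p = 0) \<longrightarrow> lie (A i) r' p = 0)"
    proof (cases "near (\<lambda>p. lie (A i) r p = 0)")
      case True
      from True near_lie[OF r'(2), of "A i"] show ?thesis by eventually_elim simp
    qed simp
  qed
  then obtain d1 where d1: "d1 > 0" "\<And>p i. (norm p)\<^sup>2 < d1 \<Longrightarrow> i \<in> J \<Longrightarrow> near (\<lambda>p. lie (A i) r p = 0) \<Longrightarrow> lie (A i) r' p = 0"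
    unfolding eventually_ball[of "\<lambda>p. \<forall>i\<in>J. near (\<lambda>p. lie (A i) r p = 0) \<longrightarrow> lie (A i) r' p = 0"] by blast
  have "\<exists>d>0. nonresonant (A k) r \<longrightarrow> nonresonant_on (A k) d 0 r'" for k
    using nonresonant_cong[OF r'(2), of "A k"] unfolding nonresonant_def by (cases "nonresonant (A k) r") (auto simp: nonresonant_def intro: exI[of _ 1])
  then obtain dk where dk: "\<And>k. dk k > 0" "\<And>k. nonresonant (A k) r \<Longrightarrow> nonresonant_on (A k) (dk k) 0 r'" by metis
  obtain d2 where d2: "d2 > 0" "\<And>p. (norm p)\<^sup>2 < d2 \<Longrightarrow> r p = r' p"
    using r'(2) unfolding eventually_ball by blast
  \<comment> \<open>One radius has to serve all fields and all nonresonance conditions, which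
    finiteness of \<open>J\<close> permits; \<open>solve\<close> consumes its hypotheses up to three
    times its parameter.\<close>
  define m where "m = Min (insert d1 (insert d2 (dk ` Hyp)))"
  have finH: "finite Hyp" using fin Hyp finite_subset by blast
  have m: "m > 0" "m \<le> d1" "m \<le> d2" "\<And>k. k \<in> Hyp \<Longrightarrow> m \<le> dk k"
  proof -
    have fm: "finite (insert d1 (insert d2 (dk ` Hyp)))" using finH by simp
    show "m > 0" unfolding m_def using fm d1(1) d2(1) dk(1) by (subst Min_gr_iff) auto
    show "m \<le> d1" "m \<le> d2" unfolding m_def by (rule Min_le[OF fm], simp)+
    show "m \<le> dk k" if "k \<in> Hyp" for k unfolding m_def by (rule Min_le[OF fm]) (use that in simp)
  qed
  define \<epsilon> where "\<epsilon> = m / 3"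
  have \<epsilon>: "\<epsilon> > 0" "3 * \<epsilon> = m" using m by (simp_all add: \<epsilon>_def)
  have BFk: "nonresonant_on (A k) m 0 r'" if "k \<in> Hyp" "nonresonant (A k) r" for k
    by (rule nonresonant_on_mono[OF dk(2)[OF that(2)] m(4)[OF that(1)]])
  have BF': "pds (map snd zs) r' p = 0"
    if "eigen_list (A j) zs" "sum_list (map fst zs) = 0" "A j p = 0" "(norm p)\<^sup>2 < 3 * \<epsilon>" for zs p
    using BFk[OF j r(2)] that unfolding nonresonant_on_def \<epsilon>(2) by blast
  show ?thesis
  proof (rule solve[OF r'(1) \<epsilon>(1) BF'])
    fix y
    assume y: "smooth_on UNIV y" "\<And>p. (norm p)\<^sup>2 < \<epsilon> / 3 \<Longrightarrow> pd y (A j p) p = r' p"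
      and pres: "\<And>ds Q p. compatible ds \<Longrightarrow> (\<And>t p. Q p \<Longrightarrow> Q (hyp_flow t p))
        \<Longrightarrow> (\<And>q. (norm q)\<^sup>2 < 3 * \<epsilon> \<Longrightarrow> Q q \<Longrightarrow> pds (ds q) r' q = 0)
        \<Longrightarrow> Q p \<Longrightarrow> (norm p)\<^sup>2 < \<epsilon> / 3 \<Longrightarrow> pds (ds p) y p = 0"
      and yBF: "\<And>zs p. eigen_list (A j) zs \<Longrightarrow> sum_list (map fst zs) = 0 \<Longrightarrow> A j p = 0 \<Longrightarrow> (norm p)\<^sup>2 < \<epsilon> / 3
        \<Longrightarrow> pds (map snd zs) y p = 0"
    have e3: "\<epsilon> / 3 > 0" "\<epsilon> / 3 \<le> m" using \<epsilon> by auto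
    show thesis
    proof (rule that[of y])
      show "smooth_on UNIV y" by fact
      show "near (\<lambda>p. lie (A j) y p = r p)"
        unfolding eventually_ball lie_def
        using e3 m d2(2) y(2) by (intro exI[of _ "\<epsilon> / 3"]) auto
    next
      fix i assume i: "i \<in> J" "i \<noteq> j" "near (\<lambda>p. lie (A i) r p = 0)"
      have cji: "A j (A i p) = A i (A j p)" for p by (rule comm[OF jJ i(1)])
      \<comment> \<open>Another hyperbolic field takes values in the kernel of \<open>A j\<close>; a
        rotational field commutes with the projections and is skew.\<close>
      have o: "pp p \<bullet> pp (A i p) = 0 \<and> pm p \<bullet> pm (A i p) = 0" for p
      proof (cases "i \<in> Hyp")
        case True
        have "A j (A i p) = 0" by (rule orth[OF j True]) (use i in simp)
        then show ?thesis by (simp add: eig_zero)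
      next
        case False
        obtain c where "rotational (A i) c" using rotational[OF i(1) False] by blast
        then interpret R: rotational "A i" c .
        have c: "pp (A i p) = A i (pp p)" "pm (A i p) = A i (pm p)"
          by (simp_all add: pp_def pm_def R.A_simps cji)
        have "q \<bullet> A i q = 0" for q using R.skew[of q q] by (simp add: inner_commute)
        then show ?thesis unfolding c by simp
      qed
      have g: "compatible (\<lambda>p. [A i p])" by (rule compatible_field[OF lin[OF i(1)] cji]) (use o in auto)
      have "lie (A i) y p = 0" if p: "(norm p)\<^sup>2 < \<epsilon> / 3" for p
      proof -
        have "pds [A i p] y p = 0"
        proof (rule pres[where Q = "\<lambda>p. True", OF g])
          fix q :: "'n pt" assume "(norm q)\<^sup>2 < 3 * \<epsilon>"
          then have "lie (A i) r' q = 0" using d1(2)[of q, OF _ i(1,3)] m(2) \<epsilon>(2) by simp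
          then show "pds [A i q] r' q = 0" by (simp add: lie_def pds_Cons)
        qed (use p in auto)
        then show ?thesis by (simp add: lie_def pds_Cons)
      qed
      then show "near (\<lambda>p. lie (A i) y p = 0)" unfolding eventually_ball using e3(1) by blast
    next
      fix k assume k: "k \<in> Hyp" "nonresonant (A k) r"
      have "nonresonant_on (A k) (\<epsilon> / 3) 0 y"
        unfolding nonresonant_on_def
      proof (intro allI impI)
        fix zs p
        assume z: "eigen_list (A k) zs" "sum_list (map fst zs) = 0" "A k p = 0" "(norm p)\<^sup>2 < \<epsilon> / 3"
        show "pds (map snd zs) y p = 0"
        proof (cases "k = j")
          case True
          then show ?thesis using yBF z by blast
        next
          case False
          have kJ: "k \<in> J" using k Hyp by blast
          have nul: "A j v = 0" if vz: "v \<in> set (map snd zs)" for v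
          proof -
            obtain s where "(s, v) \<in> set zs" using vz by force
            from eigsD[OF z(1) this] have s: "s = 1 \<or> s = -1" "A k v = of_int s *\<^sub>R v" by blast+
            have "v = of_int s *\<^sub>R A k v" using s by auto
            then have "A j v = of_int s *\<^sub>R A j (A k v)" by (metis A_simps(3))
            then show ?thesis using orth[OF j k(1)] False by simp
          qed
          show ?thesis
          \<comment> \<open>The coefficients of \<open>r'\<close> are known to vanish only on the
            zero set of \<open>A k\<close>, which the flow of \<open>A j\<close> preserves because
            the fields commute.\<close>
          proof (rule pres[where Q = "\<lambda>p. A k p = 0", OF compatible_const[OF nul]])
            show "A k (hyp_flow t p) = 0" if "A k p = 0" for t p
              using hyp_flow_comm[OF lin[OF kJ] comm[OF jJ kJ], of t p] that linear_0[OF F.linear] by simp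
            show "pds (map snd zs) r' q = 0" if "(norm q)\<^sup>2 < 3 * \<epsilon>" "A k q = 0" for q
              using BFk[OF k] z that unfolding nonresonant_on_def \<epsilon>(2) by blast
          qed (use z in auto)
        qed
      qed
      then show "nonresonant (A k) y" unfolding nonresonant_def using e3(1) by blast
    qed
  qed
qed

text \<open>\<open>f\<close> is the average of \<open>g\<close> over a period and \<open>h\<close>
  the average with the sawtooth weight. The flow is isometric, so an equation valid on a ball is
  averaged along orbits inside that ball, without cutoffs adapted to the other fields.\<close>

lemma solve_rotational:
  assumes j: "j \<in> J" "j \<notin> Hyp" and g: "smooth_on UNIV g"
  obtains f h where "smooth_on UNIV f" "smooth_on UNIV h" "near (\<lambda>p. g p = f p + lie (A j) h p)"
    "\<And>i. i \<in> J \<Longrightarrow> near (\<lambda>p. lie (A i) g p = 0) \<Longrightarrow> near (\<lambda>p. lie (A i) h p = 0)"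
    "\<And>i u. i \<in> J \<Longrightarrow> smooth_on UNIV u \<Longrightarrow> near (\<lambda>p. lie (A i) g p = lie (A j) u p) \<Longrightarrow> near (\<lambda>p. lie (A i) f p = 0)"
    "\<And>u. smooth_on UNIV u \<Longrightarrow> near (\<lambda>p. g p = lie (A j) u p) \<Longrightarrow> near (\<lambda>p. f p = 0)"
    "\<And>k. k \<in> Hyp \<Longrightarrow> nonresonant (A k) g \<Longrightarrow> nonresonant (A k) h"
proof -
  obtain c where "rotational (A j) c" using rotational[OF j] by blast
  then interpret rotational "A j" c .
  obtain g' where g': "cpt_smooth g'" "near (\<lambda>p. g p = g' p)" using smooth_germ_extend[OF smooth_germ_UNIV[OF g]] by blast
  note bg = cpt_smooth_bdd_smooth[OF g'(1)]
  let ?f = "F.T avg_weight g'" and ?h = "F.T ramp_weight g'"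
  have XT: "lie (A i) (F.T w g') p = (\<integral>t. w t * lie (A i) g' (rot_flow t p) \<partial>lborel)" if "superexp w" "i \<in> J" for w i p
  proof -
    have "A i (rot_flow t p) = rot_flow t (A i p)" for t
      by (rule rot_flow_comm[OF lin[OF that(2)]]) (rule comm[OF j(1) that(2)])
    then show ?thesis unfolding lie_def F.T_pd[OF that(1) bg] by simp
  qed
  show ?thesis
  proof (rule that[of ?f ?h])
    show "smooth_on UNIV ?f" "smooth_on UNIV ?h"
      by (rule bdd_smooth_smooth[OF F.T_bdd_smooth[OF superexp_weights(1) bg]] bdd_smooth_smooth[OF F.T_bdd_smooth[OF superexp_weights(2) bg]])+
    show "near (\<lambda>p. g p = ?f p + lie (A j) ?h p)"
      using g'(2) by eventually_elim (simp add: primitive_deriv(1)[OF bg])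
  next
    fix i assume i: "i \<in> J" "near (\<lambda>p. lie (A i) g p = 0)"
    have "near (\<lambda>p. lie (A i) g' p = 0)" using i(2) near_lie[OF g'(2), of "A i"] by eventually_elim simp
    then show "near (\<lambda>p. lie (A i) ?h p = 0)"
      unfolding eventually_ball XT[OF superexp_weights(2) i(1)]
    proof (elim exE conjE)
      fix \<epsilon> :: real assume e: "0 < \<epsilon>" "\<forall>p. (norm p)\<^sup>2 < \<epsilon> \<longrightarrow> lie (A i) g' p = 0"
      show "\<exists>\<epsilon>>0. \<forall>p. (norm p)\<^sup>2 < \<epsilon> \<longrightarrow> (\<integral>t. ramp_weight t * lie (A i) g' (rot_flow t p) \<partial>lborel) = 0"
        using e by (intro exI[of _ \<epsilon>]) (simp add: norm_rot_flow)
    qed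
  next
    fix i u assume i: "i \<in> J" and u: "smooth_on UNIV u" and eq: "near (\<lambda>p. lie (A i) g p = lie (A j) u p)"
    have "near (\<lambda>p. lie (A i) g' p = lie (A j) u p)" using eq near_lie[OF g'(2), of "A i"] by eventually_elim simp
    then show "near (\<lambda>p. lie (A i) ?f p = 0)"
      unfolding eventually_ball XT[OF superexp_weights(1) i]
    proof (elim exE conjE)
      fix \<epsilon> :: real assume e: "0 < \<epsilon>" "\<forall>p. (norm p)\<^sup>2 < \<epsilon> \<longrightarrow> lie (A i) g' p = lie (A j) u p"
      show "\<exists>\<epsilon>>0. \<forall>p. (norm p)\<^sup>2 < \<epsilon> \<longrightarrow> (\<integral>t. avg_weight t * lie (A i) g' (rot_flow t p) \<partial>lborel) = 0"
        using e by (intro exI[of _ \<epsilon>]) (simp add: norm_rot_flow avg_deriv[OF u])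
    qed
  next
    fix u assume u: "smooth_on UNIV u" and eq: "near (\<lambda>p. g p = lie (A j) u p)"
    have "near (\<lambda>p. g' p = lie (A j) u p)" using eq g'(2) by eventually_elim simp
    then show "near (\<lambda>p. ?f p = 0)"
      unfolding eventually_ball F.T_def
    proof (elim exE conjE)
      fix \<epsilon> :: real assume e: "0 < \<epsilon>" "\<forall>p. (norm p)\<^sup>2 < \<epsilon> \<longrightarrow> g' p = lie (A j) u p"
      show "\<exists>\<epsilon>>0. \<forall>p. (norm p)\<^sup>2 < \<epsilon> \<longrightarrow> (\<integral>t. avg_weight t * g' (rot_flow t p) \<partial>lborel) = 0"
        using e by (intro exI[of _ \<epsilon>]) (simp add: norm_rot_flow avg_deriv[OF u])
    qed
  next
    fix k assume k: "k \<in> Hyp" "nonresonant (A k) g"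
    have kJ: "k \<in> J" using k Hyp by blast
    have ck: "A k (rot_flow t p) = rot_flow t (A k p)" for t p
      by (rule rot_flow_comm[OF lin[OF kJ]]) (rule comm[OF j(1) kJ])
    obtain e where e: "e > 0" "nonresonant_on (A k) e 0 g'" using nonresonant_cong[OF g'(2) k(2)] unfolding nonresonant_def by blast
    have "nonresonant_on (A k) e 0 ?h"
      unfolding nonresonant_on_def
    proof (intro allI impI)
      fix zs p
      assume z: "eigen_list (A k) zs" "sum_list (map fst zs) = 0" "A k p = 0" "(norm p)\<^sup>2 < e"
      show "pds (map snd zs) ?h p = 0"
      proof (rule T_pds_0[OF superexp_weights(2) bg])
        fix t
        let ?z = "map (\<lambda>(s, v). (s, rot_flow t v)) zs"
        have 1: "map snd ?z = map (rot_flow t) (map snd zs)" "map fst ?z = map fst zs" by (induction zs) auto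
        have "eigen_list (A k) ?z" by (rule eigen_list_map[OF ck lin_rot_flow z(1)])
        moreover have "A k (rot_flow t p) = 0" by (simp add: ck z(3) linear_0[OF lin_rot_flow])
        ultimately have "pds (map snd ?z) g' (rot_flow t p) = 0"
          using e(2) z(2,4) unfolding nonresonant_on_def by (metis 1(2) norm_rot_flow)
        then show "pds (map (rot_flow t) (map snd zs)) g' (rot_flow t p) = 0" unfolding 1(1) .
      qed
    qed
    then show "nonresonant (A k) ?h" unfolding nonresonant_def using e(1) by blast
  qed
qed

text \<open>Solving anew for the derivative of \<open>f\<close> replaces \<open>f\<close> by a
  function with the same derivative along \<open>A j\<close> that is killed by each other field
  killing that derivative. In the rotational case the average of a derivative vanishes, so no
  remainder is left.\<close>

lemma solve_any:
  assumes j: "j \<in> J" and f: "smooth_on UNIV f"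
  obtains y where "smooth_on UNIV y" "near (\<lambda>p. lie (A j) y p = lie (A j) f p)"
    "\<And>i. i \<in> J \<Longrightarrow> i \<noteq> j \<Longrightarrow> near (\<lambda>p. lie (A i) (lie (A j) f) p = 0) \<Longrightarrow> near (\<lambda>p. lie (A i) y p = 0)"
    "\<And>k. k \<in> Hyp \<Longrightarrow> nonresonant (A k) (lie (A j) f) \<Longrightarrow> nonresonant (A k) y"
proof (cases "j \<in> Hyp")
  case True
  show ?thesis
    by (rule solve_hyperbolic[OF True lie_smooth[OF lin[OF j] f] nonresonant_lie_self[OF j f]]) (rule that)
next
  case False
  show ?thesis
  proof (rule solve_rotational[OF j False lie_smooth[OF lin[OF j] f]])
    fix f1 h
    assume h: "smooth_on UNIV h" "near (\<lambda>p. lie (A j) f p = f1 p + lie (A j) h p)"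
      "\<And>i. i \<in> J \<Longrightarrow> near (\<lambda>p. lie (A i) (lie (A j) f) p = 0) \<Longrightarrow> near (\<lambda>p. lie (A i) h p = 0)"
      "\<And>u. smooth_on UNIV u \<Longrightarrow> near (\<lambda>p. lie (A j) f p = lie (A j) u p) \<Longrightarrow> near (\<lambda>p. f1 p = 0)"
      "\<And>k. k \<in> Hyp \<Longrightarrow> nonresonant (A k) (lie (A j) f) \<Longrightarrow> nonresonant (A k) h"
    have "near (\<lambda>p. f1 p = 0)" by (rule h(4)[OF f]) simp
    with h(2) have "near (\<lambda>p. lie (A j) h p = lie (A j) f p)" by eventually_elim simp
    then show thesis by (rule that[OF h(1) _ h(3) h(5)])
  qed
qed

text \<open>Start with \<open>f = g\<close> and, for each \<open>j\<close>, subtract some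
  \<open>y\<close> having the same derivative along \<open>A j\<close> as \<open>f\<close>. By
  commutation the fields treated before kill \<open>lie (A j) f\<close>, hence \<open>y\<close>; and
  \<open>y\<close> has no resonant part for \<open>A k\<close>, so the total change
  \<open>g - f\<close> has none.\<close>

lemma project:
  assumes k: "k \<in> Hyp" and g: "smooth_on UNIV g"
    and coc: "\<And>j. j \<in> J \<Longrightarrow> \<exists>u. smooth_on UNIV u \<and> near (\<lambda>p. lie (A j) g p = lie (A k) u p)"
    and I: "I \<subseteq> J"
  shows "\<exists>f. smooth_on UNIV f \<and> (\<forall>j\<in>I. near (\<lambda>p. lie (A j) f p = 0)) \<and> nonresonant (A k) (\<lambda>p. g p - f p)"
proof -
  have kJ: "k \<in> J" using k Hyp by blast
  have "finite I" using fin I finite_subset by blast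
  then show ?thesis using I
  proof (induction I)
    case empty
    have "nonresonant (A k) (\<lambda>p. g p - g p)" unfolding nonresonant_def nonresonant_on_def by (auto intro: exI[of _ 1])
    then show ?case using g by blast
  next
    case (insert j I)
    have jJ: "j \<in> J" using insert by blast
    obtain f where f: "smooth_on UNIV f" "\<And>i. i \<in> I \<Longrightarrow> near (\<lambda>p. lie (A i) f p = 0)" "nonresonant (A k) (\<lambda>p. g p - f p)"
      using insert by blast
    have sgf: "smooth_on UNIV (\<lambda>p. g p - f p)" by (intro smooth_on_minus open_UNIV g f)
    obtain u where u: "smooth_on UNIV u" "near (\<lambda>p. lie (A j) g p = lie (A k) u p)" using coc[OF jJ] by blast
    \<comment> \<open>\<open>lie (A j) f\<close> has no resonant part: that of \<open>g\<close> has
      none, being a derivative along \<open>A k\<close> near 0, and \<open>lie (A j)\<close>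
      preserves the absence of one in \<open>g - f\<close>.\<close>
    have "nonresonant (A k) (lie (A j) g)"
      by (rule nonresonant_cong[OF _ nonresonant_lie_self[OF kJ u(1)]]) (use u(2) in eventually_elim, simp)
    from nonresonant_diff[OF lie_smooth[OF lin[OF jJ] g] lie_smooth[OF lin[OF jJ] sgf] this nonresonant_lie[OF k jJ sgf f(3)]]
    have B: "nonresonant (A k) (lie (A j) f)"
      by (rule nonresonant_cong[rotated]) (simp add: lie_diff[OF g f(1)])
    obtain y where y: "smooth_on UNIV y" "near (\<lambda>p. lie (A j) y p = lie (A j) f p)"
      "\<And>i. i \<in> J \<Longrightarrow> i \<noteq> j \<Longrightarrow> near (\<lambda>p. lie (A i) (lie (A j) f) p = 0) \<Longrightarrow> near (\<lambda>p. lie (A i) y p = 0)"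
      "\<And>k. k \<in> Hyp \<Longrightarrow> nonresonant (A k) (lie (A j) f) \<Longrightarrow> nonresonant (A k) y"
      using solve_any[OF jJ f(1)] by blast
    show ?case
    proof (intro exI[of _ "\<lambda>p. f p - y p"] conjI ballI)
      show "smooth_on UNIV (\<lambda>p. f p - y p)" by (intro smooth_on_minus open_UNIV f y)
      have "nonresonant (A k) (\<lambda>p. (g p - f p) + y p)" by (rule nonresonant_add[OF sgf y(1) f(3) y(4)[OF k B]])
      then show "nonresonant (A k) (\<lambda>p. g p - (f p - y p))" by (rule nonresonant_cong[rotated]) simp
      fix i assume i: "i \<in> insert j I"
      show "near (\<lambda>p. lie (A i) (\<lambda>p. f p - y p) p = 0)"
      proof (cases "i = j")
        case True
        show ?thesis using y(2) unfolding True by eventually_elim (simp add: lie_diff[OF f(1) y(1)])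
      next
        case False
        then have iI: "i \<in> I" "i \<in> J" using i insert.prems by auto
        have "near (\<lambda>p. lie (A j) (lie (A i) f) p = 0)" by (rule near_lie_0[OF f(2)[OF iI(1)]])
        then have "near (\<lambda>p. lie (A i) (lie (A j) f) p = 0)" by (simp add: XX[OF iI(2) jJ f(1)])
        from f(2)[OF iI(1)] y(3)[OF iI(2) False this] show ?thesis
          by eventually_elim (simp add: lie_diff[OF f(1) y(1)])
      qed
    qed
  qed
qed

text \<open>For hyperbolic \<open>A k\<close> the difference \<open>g - lie (A k) h\<close> is the
  function found by \<open>project\<close>. Otherwise it is the average of \<open>g\<close>, killed
  by every \<open>A i\<close> because \<open>lie (A i) g\<close> is a derivative along
  \<open>A k\<close> and averages to 0.\<close>

lemma one_field:
  assumes k: "k \<in> J" and g: "smooth_on UNIV g"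
    and coc: "\<And>j. j \<in> J \<Longrightarrow> \<exists>u. smooth_on UNIV u \<and> near (\<lambda>p. lie (A j) g p = lie (A k) u p)"
  obtains h where "smooth_on UNIV h" "\<And>i. i \<in> J \<Longrightarrow> near (\<lambda>p. lie (A i) (\<lambda>p. g p - lie (A k) h p) p = 0)"
    "\<And>i. i \<in> J \<Longrightarrow> i \<noteq> k \<Longrightarrow> near (\<lambda>p. lie (A i) g p = 0) \<Longrightarrow> near (\<lambda>p. lie (A i) h p = 0)"
proof (cases "k \<in> Hyp")
  case True
  obtain f where f: "smooth_on UNIV f" "\<And>j. j \<in> J \<Longrightarrow> near (\<lambda>p. lie (A j) f p = 0)" "nonresonant (A k) (\<lambda>p. g p - f p)"
    using project[OF True g coc order_refl] by blast
  have sgf: "smooth_on UNIV (\<lambda>p. g p - f p)" by (intro smooth_on_minus open_UNIV g f)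
  show ?thesis
  proof (rule solve_hyperbolic[OF True sgf f(3)])
    fix h assume h: "smooth_on UNIV h" "near (\<lambda>p. lie (A k) h p = g p - f p)"
      "\<And>i. i \<in> J \<Longrightarrow> i \<noteq> k \<Longrightarrow> near (\<lambda>p. lie (A i) (\<lambda>p. g p - f p) p = 0) \<Longrightarrow> near (\<lambda>p. lie (A i) h p = 0)"
    show thesis
    proof (rule that[OF h(1)])
      fix i assume i: "i \<in> J"
      have "near (\<lambda>p. g p - lie (A k) h p = f p)" using h(2) by eventually_elim simp
      from near_lie[OF this, of "A i"] f(2)[OF i] show "near (\<lambda>p. lie (A i) (\<lambda>p. g p - lie (A k) h p) p = 0)"
        by eventually_elim simp
      assume "i \<noteq> k" "near (\<lambda>p. lie (A i) g p = 0)"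
      from this(2) f(2)[OF i] have "near (\<lambda>p. lie (A i) (\<lambda>p. g p - f p) p = 0)"
        by eventually_elim (simp add: lie_diff[OF g f(1)])
      then show "near (\<lambda>p. lie (A i) h p = 0)" by (rule h(3)[OF i \<open>i \<noteq> k\<close>])
    qed
  qed
next
  case False
  show ?thesis
  proof (rule solve_rotational[OF k False g])
    fix f h assume h: "smooth_on UNIV h" "near (\<lambda>p. g p = f p + lie (A k) h p)"
      "\<And>i. i \<in> J \<Longrightarrow> near (\<lambda>p. lie (A i) g p = 0) \<Longrightarrow> near (\<lambda>p. lie (A i) h p = 0)"
      "\<And>i u. i \<in> J \<Longrightarrow> smooth_on UNIV u \<Longrightarrow> near (\<lambda>p. lie (A i) g p = lie (A k) u p) \<Longrightarrow> near (\<lambda>p. lie (A i) f p = 0)"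
    show thesis
    proof (rule that[OF h(1)])
      fix i assume i: "i \<in> J"
      obtain u where u: "smooth_on UNIV u" "near (\<lambda>p. lie (A i) g p = lie (A k) u p)" using coc[OF i] by blast
      have "near (\<lambda>p. g p - lie (A k) h p = f p)" using h(2) by eventually_elim simp
      from near_lie[OF this, of "A i"] h(4)[OF i u] show "near (\<lambda>p. lie (A i) (\<lambda>p. g p - lie (A k) h p) p = 0)"
        by eventually_elim simp
      show "near (\<lambda>p. lie (A i) h p = 0)" if "near (\<lambda>p. lie (A i) g p = 0)" by (rule h(3)[OF i that])
    qed
  qed
qed

theorem cocycle:
  assumes g: "\<And>i. i \<in> J \<Longrightarrow> smooth_on UNIV (g i)"
    and coc: "\<And>i j. i \<in> J \<Longrightarrow> j \<in> J \<Longrightarrow> near (\<lambda>p. lie (A j) (g i) p = lie (A i) (g j) p)"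
  obtains h where "smooth_on UNIV h"
    "\<And>k i. k \<in> J \<Longrightarrow> i \<in> J \<Longrightarrow> near (\<lambda>p. lie (A i) (\<lambda>p. g k p - lie (A k) h p) p = 0)"
proof -
  have "\<exists>h. smooth_on UNIV h \<and> (\<forall>k\<in>I. \<forall>i\<in>J. near (\<lambda>p. lie (A i) (\<lambda>p. g k p - lie (A k) h p) p = 0))"
    if I: "I \<subseteq> J" for I
  proof -
    have "finite I" using fin I finite_subset by blast
    then show ?thesis using I
    proof (induction I)
      case empty
      then show ?case by (intro exI[of _ "\<lambda>p. 0"]) simp
    next
      case (insert k I)
      have kJ: "k \<in> J" using insert by blast
      obtain h where h: "smooth_on UNIV h"
        "\<And>k i. k \<in> I \<Longrightarrow> i \<in> J \<Longrightarrow> near (\<lambda>p. lie (A i) (\<lambda>p. g k p - lie (A k) h p) p = 0)"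
        using insert by blast
      have sX: "smooth_on UNIV (lie (A i) h)" if "i \<in> J" for i by (rule lie_smooth[OF lin[OF that] h(1)])
      have sg: "smooth_on UNIV (\<lambda>p. g i p - lie (A i) h p)" if "i \<in> J" for i
        by (intro smooth_on_minus open_UNIV g sX that)
      have c: "near (\<lambda>p. lie (A i) (\<lambda>p. g k p - lie (A k) h p) p = lie (A k) (\<lambda>p. g i p - lie (A i) h p) p)"
        if i: "i \<in> J" for i
        using coc[OF kJ i] by eventually_elim
          (simp add: lie_diff[OF g[OF kJ] sX[OF kJ]] lie_diff[OF g[OF i] sX[OF i]] XX[OF i kJ h(1)])
      have "\<exists>u. smooth_on UNIV u \<and> near (\<lambda>p. lie (A i) (\<lambda>p. g k p - lie (A k) h p) p = lie (A k) u p)" if "i \<in> J" for i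
        using sg[OF that] c[OF that] by blast
      from one_field[OF kJ sg[OF kJ] this]
      obtain h' where h': "smooth_on UNIV h'"
        "\<And>i. i \<in> J \<Longrightarrow> near (\<lambda>p. lie (A i) (\<lambda>p. (g k p - lie (A k) h p) - lie (A k) h' p) p = 0)"
        "\<And>i. i \<in> J \<Longrightarrow> i \<noteq> k \<Longrightarrow> near (\<lambda>p. lie (A i) (\<lambda>p. g k p - lie (A k) h p) p = 0) \<Longrightarrow> near (\<lambda>p. lie (A i) h' p = 0)"
        by blast
      have e: "(\<lambda>p. g l p - lie (A l) (\<lambda>p. h p + h' p) p) = (\<lambda>p. (g l p - lie (A l) h p) - lie (A l) h' p)" for l
        by (rule ext) (simp add: lie_add[OF h(1) h'(1)])
      show ?case
      proof (intro exI[of _ "\<lambda>p. h p + h' p"] conjI ballI)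
        show "smooth_on UNIV (\<lambda>p. h p + h' p)" by (intro smooth_on_add open_UNIV h h')
        fix l i assume l: "l \<in> insert k I" and i: "i \<in> J"
        show "near (\<lambda>p. lie (A i) (\<lambda>p. g l p - lie (A l) (\<lambda>p. h p + h' p) p) p = 0)"
        proof (cases "l = k")
          case True
          show ?thesis unfolding e True by (rule h'(2)[OF i])
        next
          case False
          then have lI: "l \<in> I" "l \<in> J" using l insert.prems by auto
          \<comment> \<open>The cocycle identity turns membership of the corrected component
            \<open>l\<close> in the common kernel into this equation. So \<open>A l\<close> kills
            \<open>h'\<close>, and adding \<open>h'\<close> does not disturb component
            \<open>l\<close>.\<close>
          have "near (\<lambda>p. lie (A l) (\<lambda>p. g k p - lie (A k) h p) p = 0)"
            using c[OF lI(2)] h(2)[OF lI(1) kJ] by eventually_elim simp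
          from near_lie_0[OF h'(3)[OF lI(2) False this], of "A i"] h(2)[OF lI(1) i]
          show ?thesis unfolding e
            by eventually_elim (simp add: lie_diff[OF sg[OF lI(2)] lie_smooth[OF lin[OF lI(2)] h'(1)]])
        qed
      qed
    qed
  qed
  from this[OF order_refl] show ?thesis using that by blast
qed

end

subsection \<open>The Williamson basis\<close>

text \<open>The Hamiltonian field of the sum of the products x y over \<open>S\<close>; a
  two-element \<open>S\<close> gives the first form of a focus-focus pair. The eigenvalue is -1 on
  the x and 1 on the y coordinates.\<close>

definition hyp_field :: "'n set \<Rightarrow> 'n::finite pt \<Rightarrow> 'n pt" where
  "hyp_field S p = ((\<chi> m. if m \<in> S then - fst p $ m else 0), (\<chi> m. if m \<in> S then snd p $ m else 0))"

definition ell_field :: "'n \<Rightarrow> 'n::finite pt \<Rightarrow> 'n pt" where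
  "ell_field a p = ((\<chi> m. if m = a then - 2 * snd p $ a else 0), (\<chi> m. if m = a then 2 * fst p $ a else 0))"

definition rot_field :: "'n \<Rightarrow> 'n \<Rightarrow> 'n::finite pt \<Rightarrow> 'n pt" where
  "rot_field a b p = ((\<chi> m. if m = a then fst p $ b else if m = b then - fst p $ a else 0),
               (\<chi> m. if m = a then snd p $ b else if m = b then - snd p $ a else 0))"

lemma pt_eqI: "(\<And>m. fst p $ m = fst q $ m) \<Longrightarrow> (\<And>m. snd p $ m = snd q $ m) \<Longrightarrow> p = q"
  for p q :: "'n::finite pt"
  by (simp add: prod_eq_iff vec_eq_iff)

lemma hyp_field_hyperbolic: "hyperbolic (hyp_field S)"
proof (rule hyperbolic.intro)
  show "linear (hyp_field S)"
    by (rule linearI) (auto simp: hyp_field_def vec_eq_iff)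
  show "hyp_field S (hyp_field S (hyp_field S p)) = hyp_field S p" for p
    by (rule pt_eqI) (simp_all add: hyp_field_def)
  show "hyp_field S p \<bullet> q = p \<bullet> hyp_field S q" for p q
    by (auto simp: hyp_field_def inner_prod_def inner_vec_def intro!: arg_cong2[where f = "(+)"] sum.cong)
qed

lemma ell_field_rotational: "rotational (ell_field a) 2"
proof (rule rotational.intro)
  show "linear (ell_field a)"
    by (rule linearI) (auto simp: ell_field_def vec_eq_iff algebra_simps)
  show "ell_field a (ell_field a (ell_field a p)) = - (2\<^sup>2) *\<^sub>R ell_field a p" for p
    by (rule pt_eqI) (simp_all add: ell_field_def)
  have i: "(if m = a then x else 0) * y = (if m = a then x * y else 0)"
    "y * (if m = a then x else 0) = (if m = a then y * x else 0)" for m :: 'a and x y :: real by auto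
  show "ell_field a p \<bullet> q = - (p \<bullet> ell_field a q)" for p q
    by (simp add: ell_field_def inner_prod_def inner_vec_def i)
qed simp

lemma rot_field_rotational: assumes "a \<noteq> b" shows "rotational (rot_field a b) 1"
proof (rule rotational.intro)
  show "linear (rot_field a b)"
    by (rule linearI) (auto simp: rot_field_def vec_eq_iff algebra_simps)
  show "rot_field a b (rot_field a b (rot_field a b p)) = - (1\<^sup>2) *\<^sub>R rot_field a b p" for p
    using assms by (intro pt_eqI) (simp_all add: rot_field_def)
  have s: "(\<Sum>m\<in>UNIV. (if m = a then x else if m = b then y else 0) * f m) = x * f a + y * f b"
    "(\<Sum>m\<in>UNIV. f m * (if m = a then x else if m = b then y else 0)) = f a * x + f b * y"
    for x y :: real and f :: "'a \<Rightarrow> real"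
  proof -
    have "(\<Sum>m\<in>UNIV. (if m = a then x else if m = b then y else 0) * f m)
      = (\<Sum>m\<in>UNIV. (if m = a then x * f m else 0) + (if m = b then y * f m else 0))"
      using assms by (intro sum.cong) auto
    then show "(\<Sum>m\<in>UNIV. (if m = a then x else if m = b then y else 0) * f m) = x * f a + y * f b"
      by (simp add: sum.distrib)
    then show "(\<Sum>m\<in>UNIV. f m * (if m = a then x else if m = b then y else 0)) = f a * x + f b * y"
      by (simp add: mult.commute)
  qed
  show "rot_field a b p \<bullet> q = - (p \<bullet> rot_field a b q)" for p q
    by (simp add: rot_field_def inner_prod_def inner_vec_def s)
qed simp

text \<open>Values and dependence are both confined to the coordinates in \<open>S\<close>, so
  fields with disjoint supports compose to 0 in either order.\<close>

definition localized :: "'n set \<Rightarrow> ('n::finite pt \<Rightarrow> 'n pt) \<Rightarrow> bool" where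
  "localized S B \<longleftrightarrow> (\<forall>p m. m \<notin> S \<longrightarrow> fst (B p) $ m = 0 \<and> snd (B p) $ m = 0)
     \<and> (\<forall>p. (\<forall>m\<in>S. fst p $ m = 0 \<and> snd p $ m = 0) \<longrightarrow> B p = 0)"

lemma localized_disjoint: "localized S B \<Longrightarrow> localized T C \<Longrightarrow> S \<inter> T = {} \<Longrightarrow> B (C p) = 0"
  unfolding localized_def by blast

lemma localized_hyp_field: "localized S (hyp_field S)" and localized_ell_field: "localized {a} (ell_field a)"
  and localized_rot_field: "localized {a, b} (rot_field a b)"
  unfolding localized_def by (auto intro!: pt_eqI simp: hyp_field_def ell_field_def rot_field_def)

text \<open>The rotation mixes x with x and y with y, and the hyperbolic field is a scalar on each
  of these two planes.\<close>

lemma hyp_field_rot_field_comm: "hyp_field {a, b} (rot_field a b p) = rot_field a b (hyp_field {a, b} p)"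
  by (rule pt_eqI) (simp_all add: hyp_field_def rot_field_def)

context
  fixes \<sigma> :: "nat \<Rightarrow> 'n::finite" and ke kh kf :: nat
  assumes card: "CARD('n) = ke + kh + 2 * kf"
    and bij: "bij_betw \<sigma> {1..CARD('n)} UNIV"
begin

text \<open>The Hamiltonian vector field of \<^term>\<open>wq \<sigma> ke kh i\<close>.\<close>

definition ham_field :: "nat \<Rightarrow> 'n pt \<Rightarrow> 'n pt" where
  "ham_field i = (if i \<le> ke then ell_field (\<sigma> i) else if i \<le> ke + kh then hyp_field {\<sigma> i}
     else if odd (i - (ke + kh)) then hyp_field {\<sigma> i, \<sigma> (i + 1)} else rot_field (\<sigma> (i - 1)) (\<sigma> i))"

definition block_indices :: "nat \<Rightarrow> nat set" where
  "block_indices i = (if i \<le> ke + kh then {i} else if odd (i - (ke + kh)) then {i, i + 1} else {i - 1, i})"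

definition hyperbolic_indices :: "nat set" where
  "hyperbolic_indices = {i \<in> {1..CARD('n)}. ke < i \<and> (i \<le> ke + kh \<or> odd (i - (ke + kh)))}"

lemma block_indices_subset: "i \<in> {1..CARD('n)} \<Longrightarrow> block_indices i \<subseteq> {1..CARD('n)}"
  unfolding card block_indices_def by (auto, presburger+)

lemma block_indices_overlap: "i \<in> {1..CARD('n)} \<Longrightarrow> j \<in> {1..CARD('n)} \<Longrightarrow> i < j \<Longrightarrow> block_indices i \<inter> block_indices j \<noteq> {}
   \<Longrightarrow> ke + kh < i \<and> odd (i - (ke + kh)) \<and> j = i + 1"
  unfolding card block_indices_def by (auto split: if_splits; presburger)

lemma inj: "i \<in> {1..CARD('n)} \<Longrightarrow> j \<in> {1..CARD('n)} \<Longrightarrow> \<sigma> i = \<sigma> j \<Longrightarrow> i = j"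
  using bij unfolding bij_betw_def inj_on_def by blast

lemma ham_field_localized: "localized (\<sigma> ` block_indices i) (ham_field i)"
proof -
  have "localized (\<sigma> ` (if i \<le> ke + kh then {i} else if b then {i, i + 1} else {i - 1, i}))
    (if i \<le> ke then ell_field (\<sigma> i) else if i \<le> ke + kh then hyp_field {\<sigma> i}
     else if b then hyp_field {\<sigma> i, \<sigma> (i + 1)} else rot_field (\<sigma> (i - 1)) (\<sigma> i))" for b
    by (simp add: localized_ell_field localized_hyp_field localized_rot_field)
  then show ?thesis unfolding ham_field_def block_indices_def .
qed

lemma ham_field_disj:
  assumes "i \<in> {1..CARD('n)}" "j \<in> {1..CARD('n)}" "block_indices i \<inter> block_indices j = {}"
  shows "ham_field i (ham_field j p) = 0"
proof (rule localized_disjoint[OF ham_field_localized ham_field_localized])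
  show "\<sigma> ` block_indices i \<inter> \<sigma> ` block_indices j = {}"
    using block_indices_subset[OF assms(1)] block_indices_subset[OF assms(2)] assms(3) inj by blast
qed

lemma ham_field_comm_less:
  assumes "i \<in> {1..CARD('n)}" "j \<in> {1..CARD('n)}" "i < j"
  shows "ham_field i (ham_field j p) = ham_field j (ham_field i p)"
proof (cases "block_indices i \<inter> block_indices j = {}")
  case True
  then show ?thesis using ham_field_disj assms by (simp add: Int_commute)
next
  case False
  from block_indices_overlap[OF assms False] have *: "ke + kh < i" "odd (i - (ke + kh))" "j = i + 1" by auto
  then have "ham_field i = hyp_field {\<sigma> i, \<sigma> (i + 1)}" "ham_field j = rot_field (\<sigma> i) (\<sigma> (i + 1))"
    by (auto simp: ham_field_def)
  then show ?thesis by (simp only: hyp_field_rot_field_comm)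
qed

lemma hyperbolic_indices_neq_disj:
  assumes "i \<in> hyperbolic_indices" "j \<in> hyperbolic_indices" "i \<noteq> j"
  shows "block_indices i \<inter> block_indices j = {}"
proof (rule ccontr)
  assume n: "block_indices i \<inter> block_indices j \<noteq> {}"
  have J: "i \<in> {1..CARD('n)}" "j \<in> {1..CARD('n)}" using assms by (auto simp: hyperbolic_indices_def)
  consider "i < j" | "j < i" using assms by linarith
  then show False
  proof cases
    case 1 then show False using block_indices_overlap[OF J 1 n] assms by (auto simp: hyperbolic_indices_def)
  next
    case 2 then show False using block_indices_overlap[OF J(2,1) 2] n assms by (auto simp: hyperbolic_indices_def Int_commute)
  qed
qed

lemma williamson_commuting_fields: "commuting_fields {1..CARD('n)} hyperbolic_indices ham_field"
proof (rule commuting_fields.intro)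
  show "finite {1..CARD('n)}" by simp
  show "hyperbolic_indices \<subseteq> {1..CARD('n)}" by (auto simp: hyperbolic_indices_def)
  show "hyperbolic (ham_field j)" if "j \<in> hyperbolic_indices" for j
    using that by (auto simp: hyperbolic_indices_def ham_field_def hyp_field_hyperbolic)
  show "\<exists>c. rotational (ham_field j) c" if j: "j \<in> {1..CARD('n)}" "j \<notin> hyperbolic_indices" for j
  proof (cases "j \<le> ke")
    case True then show ?thesis using ell_field_rotational by (auto simp: ham_field_def)
  next
    case False
    then have *: "ke + kh < j" "even (j - (ke + kh))" using j by (auto simp: hyperbolic_indices_def)
    then have "j - 1 \<in> {1..CARD('n)}" using j(1) unfolding atLeastAtMost_iff by presburger
    then have "\<sigma> (j - 1) \<noteq> \<sigma> j" using inj[OF _ j(1), of "j - 1"] * by auto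
    then show ?thesis using rot_field_rotational * by (auto simp: ham_field_def)
  qed
  show "ham_field i (ham_field j p) = ham_field j (ham_field i p)" if "i \<in> {1..CARD('n)}" "j \<in> {1..CARD('n)}" for i j p
    using ham_field_comm_less[OF that] ham_field_comm_less[OF that(2,1)] by (metis linorder_neqE_nat)
  show "ham_field i (ham_field j p) = 0" if "i \<in> hyperbolic_indices" "j \<in> hyperbolic_indices" "i \<noteq> j" for i j p
    by (rule ham_field_disj[OF _ _ hyperbolic_indices_neq_disj[OF that]]) (use that in \<open>auto simp: hyperbolic_indices_def\<close>)
qed

section \<open>Poisson brackets with the basis as derivatives along linear fields\<close>

lemma xc_deriv: "(xc \<sigma> i has_derivative xc \<sigma> i) (at p)" and yc_deriv: "(yc \<sigma> i has_derivative yc \<sigma> i) (at p)"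
  unfolding xc_def[abs_def] yc_def[abs_def]
  by (intro bounded_linear_imp_has_derivative bounded_linear_compose[OF bounded_linear_vec_nth]
      bounded_linear_fst bounded_linear_snd)+

lemma xc_yc_dirs:
  "xc \<sigma> i (ex m) = (if \<sigma> i = m then 1 else 0)" "xc \<sigma> i (ey m) = 0"
  "yc \<sigma> i (ey m) = (if \<sigma> i = m then 1 else 0)" "yc \<sigma> i (ex m) = 0"
  by (auto simp: xc_def yc_def ex_def ey_def axis_def)

lemma wq_grad:
  assumes i: "i \<in> {1..CARD('n)}"
  shows "pd (wq \<sigma> ke kh i) (ex m) p = snd (ham_field i p) $ m \<and> pd (wq \<sigma> ke kh i) (ey m) p = - (fst (ham_field i p) $ m)"
proof -
  note d = xc_deriv yc_deriv
  consider "i \<le> ke" | "ke < i" "i \<le> ke + kh" | "ke + kh < i" "odd (i - (ke + kh))"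
    | "ke + kh < i" "even (i - (ke + kh))" by linarith
  then show ?thesis
  proof cases
    case 1
    have "wq \<sigma> ke kh i = (\<lambda>p. xc \<sigma> i p * xc \<sigma> i p + yc \<sigma> i p * yc \<sigma> i p)"
      using 1 by (simp add: wq_def fun_eq_iff power2_eq_square)
    moreover have "((\<lambda>p. xc \<sigma> i p * xc \<sigma> i p + yc \<sigma> i p * yc \<sigma> i p) has_derivative
      (\<lambda>v. (xc \<sigma> i p * xc \<sigma> i v + xc \<sigma> i v * xc \<sigma> i p) + (yc \<sigma> i p * yc \<sigma> i v + yc \<sigma> i v * yc \<sigma> i p))) (at p)"
      by (intro has_derivative_add has_derivative_mult d)
    ultimately show ?thesis
      using 1 by (simp add: pd_eqI xc_yc_dirs ham_field_def ell_field_def) (simp add: xc_def yc_def)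
  next
    case 2
    have "wq \<sigma> ke kh i = (\<lambda>p. xc \<sigma> i p * yc \<sigma> i p)"
      using 2 by (simp add: wq_def fun_eq_iff)
    moreover have "((\<lambda>p. xc \<sigma> i p * yc \<sigma> i p) has_derivative
      (\<lambda>v. xc \<sigma> i p * yc \<sigma> i v + xc \<sigma> i v * yc \<sigma> i p)) (at p)"
      by (intro has_derivative_mult d)
    ultimately show ?thesis
      using 2 by (simp add: pd_eqI xc_yc_dirs ham_field_def hyp_field_def) (simp add: xc_def yc_def)
  next
    case 3
    have "i + 1 \<in> {1..CARD('n)}" using i 3 unfolding card atLeastAtMost_iff by presburger
    then have ne: "\<sigma> i \<noteq> \<sigma> (i + 1)" using inj[OF i, of "i + 1"] by auto
    have "wq \<sigma> ke kh i = (\<lambda>p. xc \<sigma> i p * yc \<sigma> i p + xc \<sigma> (i+1) p * yc \<sigma> (i+1) p)"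
      using 3 by (simp add: wq_def fun_eq_iff)
    moreover have "((\<lambda>p. xc \<sigma> i p * yc \<sigma> i p + xc \<sigma> (i+1) p * yc \<sigma> (i+1) p) has_derivative
      (\<lambda>v. (xc \<sigma> i p * yc \<sigma> i v + xc \<sigma> i v * yc \<sigma> i p)
        + (xc \<sigma> (i+1) p * yc \<sigma> (i+1) v + xc \<sigma> (i+1) v * yc \<sigma> (i+1) p))) (at p)"
      by (intro has_derivative_add has_derivative_mult d)
    ultimately show ?thesis
      using 3 ne by (simp add: pd_eqI xc_yc_dirs ham_field_def hyp_field_def) (auto simp add: xc_def yc_def)
  next
    case 4
    have "i - 1 \<in> {1..CARD('n)}" using i 4 unfolding atLeastAtMost_iff by presburger
    then have ne: "\<sigma> (i - 1) \<noteq> \<sigma> i" using inj[OF _ i, of "i - 1"] 4 by auto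
    have "wq \<sigma> ke kh i = (\<lambda>p. xc \<sigma> (i-1) p * yc \<sigma> i p - xc \<sigma> i p * yc \<sigma> (i-1) p)"
      using 4 by (simp add: wq_def fun_eq_iff)
    moreover have "((\<lambda>p. xc \<sigma> (i-1) p * yc \<sigma> i p - xc \<sigma> i p * yc \<sigma> (i-1) p) has_derivative
      (\<lambda>v. (xc \<sigma> (i-1) p * yc \<sigma> i v + xc \<sigma> (i-1) v * yc \<sigma> i p)
        - (xc \<sigma> i p * yc \<sigma> (i-1) v + xc \<sigma> i v * yc \<sigma> (i-1) p))) (at p)"
      by (intro has_derivative_diff has_derivative_mult d)
    ultimately show ?thesis
      using 4 ne by (simp add: pd_eqI xc_yc_dirs ham_field_def rot_field_def) (auto simp add: xc_def yc_def)
  qed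
qed

lemma pt_decomp: "p = (\<Sum>m\<in>UNIV. (fst p $ m) *\<^sub>R ex m + (snd p $ m) *\<^sub>R ey m)" for p :: "'n pt"
proof (rule pt_eqI)
  have f: "fst (\<Sum>m\<in>UNIV. h m) = (\<Sum>m\<in>UNIV. fst (h m))" "snd (\<Sum>m\<in>UNIV. h m) = (\<Sum>m\<in>UNIV. snd (h m))"
    for h :: "'n \<Rightarrow> 'n pt" by (simp_all add: fst_sum snd_sum)
  fix k
  show "fst p $ k = fst (\<Sum>m\<in>UNIV. (fst p $ m) *\<^sub>R ex m + (snd p $ m) *\<^sub>R ey m) $ k"
    "snd p $ k = snd (\<Sum>m\<in>UNIV. (fst p $ m) *\<^sub>R ex m + (snd p $ m) *\<^sub>R ey m) $ k"
    by (simp_all add: f ex_def ey_def axis_def if_distrib cong: if_cong)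
qed

text \<open>Differentiability of \<open>f\<close> provides linearity in the direction; without it
  \<open>pd\<close> would only be an arbitrary choice for each direction.\<close>

lemma pbr_lie:
  assumes i: "i \<in> {1..CARD('n)}" and f: "f differentiable (at p)"
  shows "pbr (wq \<sigma> ke kh i) f p = lie (ham_field i) f p"
proof -
  note l = pd_linear[OF f]
  have "lie (ham_field i) f p = pd f (\<Sum>m\<in>UNIV. (fst (ham_field i p) $ m) *\<^sub>R ex m + (snd (ham_field i p) $ m) *\<^sub>R ey m) p"
    unfolding lie_def by (subst pt_decomp) (rule refl)
  also have "\<dots> = (\<Sum>m\<in>UNIV. (fst (ham_field i p) $ m) * pd f (ex m) p + (snd (ham_field i p) $ m) * pd f (ey m) p)"
    by (simp only: linear_sum[OF l] linear_add[OF l] linear_cmul[OF l] real_scaleR_def)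
  also have "\<dots> = pbr (wq \<sigma> ke kh i) f p"
    unfolding pbr_def by (rule sum.cong) (simp_all add: wq_grad[OF i])
  finally show ?thesis by simp
qed

end

lemma pbr_antisym: "pbr f g p = - pbr g f p"
  unfolding pbr_def sum_negf[symmetric] by (rule sum.cong) (simp_all add: algebra_simps)

lemma smooth_germ_cong:
  assumes "near (\<lambda>p. f p = g p)" "smooth_germ g"
  shows "smooth_germ f"
proof -
  obtain U where U: "open U" "0 \<in> U" "smooth_on U g" using assms(2) unfolding smooth_germ_def by blast
  obtain V where V: "open V" "0 \<in> V" "\<And>p. p \<in> V \<Longrightarrow> f p = g p" using assms(1) unfolding eventually_nhds by blast
  have "smooth_on (U \<inter> V) f"
    using smooth_on_cong[of "U \<inter> V" f g] U V smooth_on_subset[OF U(3), of "U \<inter> V"] by auto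
  then show ?thesis unfolding smooth_germ_def using U V by (intro exI[of _ "U \<inter> V"]) auto
qed

lemma smooth_germ_diff: "smooth_germ f \<Longrightarrow> near (\<lambda>p. f differentiable (at p))"
  unfolding smooth_germ_def eventually_nhds using smooth_on_diff by blast

theorem theorem6p3:
  fixes \<sigma> :: "nat \<Rightarrow> 'n::finite" and ke kh kf :: nat
    and g :: "nat \<Rightarrow> 'n pt \<Rightarrow> real"
  assumes "CARD('n) = ke + kh + 2 * kf"
    and "bij_betw \<sigma> {1..CARD('n)} UNIV"
    and "\<forall>i\<in>{1..CARD('n)}. smooth_germ (g i)"
    and "\<forall>i\<in>{1..CARD('n)}. \<forall>j\<in>{1..CARD('n)}.
           (\<forall>\<^sub>F p in nhds 0. pbr (g i) (wq \<sigma> ke kh j) p = pbr (g j) (wq \<sigma> ke kh i) p)"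
  shows "\<exists>h. smooth_germ h \<and>
           (\<forall>i\<in>{1..CARD('n)}. in_Cq \<sigma> ke kh (\<lambda>p. g i p - pbr (wq \<sigma> ke kh i) h p))"
proof -
  let ?J = "{1..CARD('n)}"
  let ?A = "ham_field \<sigma> ke kh"
  interpret commuting_fields ?J "hyperbolic_indices TYPE('n) ke kh" ?A by (rule williamson_commuting_fields[OF assms(1,2)])
  note pX = pbr_lie[OF assms(1,2)]
  have "\<exists>g'. cpt_smooth g' \<and> near (\<lambda>p. g i p = g' p)" if "i \<in> ?J" for i
    using smooth_germ_extend[of "g i"] assms(3) that by blast
  then obtain g' where g': "\<And>i. i \<in> ?J \<Longrightarrow> cpt_smooth (g' i)" "\<And>i. i \<in> ?J \<Longrightarrow> near (\<lambda>p. g i p = g' i p)" by metis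
  note sg' = cpt_smooth_smooth[OF g'(1)]
  have "near (\<lambda>p. lie (?A j) (g' i) p = lie (?A i) (g' j) p)" if i: "i \<in> ?J" and j: "j \<in> ?J" for i j
  proof -
    have "near (\<lambda>p. pbr (g i) (wq \<sigma> ke kh j) p = pbr (g j) (wq \<sigma> ke kh i) p)" using assms(4) i j by blast
    moreover have "near (\<lambda>p. g i differentiable (at p))" "near (\<lambda>p. g j differentiable (at p))"
      using assms(3) i j by (auto intro: smooth_germ_diff)
    ultimately show ?thesis
      using near_lie[OF g'(2)[OF i], of "?A j"] near_lie[OF g'(2)[OF j], of "?A i"]
    proof eventually_elim
      case (elim p)
      \<comment> \<open>The basis functions stand second in both brackets; the two signs from
        antisymmetry cancel.\<close>
      then show ?case by (simp add: pbr_antisym[of "g i"] pbr_antisym[of "g j"] pX[OF i] pX[OF j])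
    qed
  qed
  from cocycle[OF sg' this] obtain h where h: "smooth_on UNIV h"
    "\<And>k i. k \<in> ?J \<Longrightarrow> i \<in> ?J \<Longrightarrow> near (\<lambda>p. lie (?A i) (\<lambda>p. g' k p - lie (?A k) h p) p = 0)" by blast
  have ph: "pbr (wq \<sigma> ke kh i) h p = lie (?A i) h p" if "i \<in> ?J" for i p
    by (rule pX[OF that smooth_on_diff[OF h(1) UNIV_I]])
  show ?thesis
  proof (intro exI[of _ h] conjI ballI)
    show "smooth_germ h" by (rule smooth_germ_UNIV[OF h(1)])
    fix k assume k: "k \<in> ?J"
    let ?f = "\<lambda>p. g k p - pbr (wq \<sigma> ke kh k) h p" and ?f' = "\<lambda>p. g' k p - lie (?A k) h p"
    have sf': "smooth_on UNIV ?f'" by (intro smooth_on_minus open_UNIV sg'[OF k] lie_smooth lin[OF k] h(1))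
    have e: "near (\<lambda>p. ?f p = ?f' p)" using g'(2)[OF k] by eventually_elim (simp add: ph[OF k])
    have sf: "smooth_germ ?f" by (rule smooth_germ_cong[OF e smooth_germ_UNIV[OF sf']])
    show "in_Cq \<sigma> ke kh ?f"
      unfolding in_Cq_def
    proof (intro conjI sf eventually_ball_finite ballI)
      fix i assume i: "i \<in> ?J"
      from smooth_germ_diff[OF sf] near_lie[OF e, of "?A i"] h(2)[OF k i]
      show "near (\<lambda>p. pbr (wq \<sigma> ke kh i) ?f p = 0)"
        by eventually_elim (simp add: pX[OF i])
    qed simp
  qed
qed

end
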